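(* Let $f_+,f_-:\mathbb R\to\mathbb R$ be of class $C^4$, let $u_1<u_0<u_2$ be real numbers and let $0\le\varepsilon_-<\varepsilon_0$. Assume that: (i) $D_+(u,\varepsilon)>0$ and $D_-(u,\varepsilon)>0$ for all $u\in[u_1,u_2]$ and all $\varepsilon\in(\varepsilon_-,\varepsilon_0)$; (ii) $\varepsilon_0$ is a simple root of the function $\varepsilon\mapsto D_+(u_0,\varepsilon)$, and $D_+(u,\varepsilon_0)>0$ for $u\in[u_1,u_2]\setminus\{u_0\}$; (iii) $D_-(u,\varepsilon_0)>0$ for all $u\in[u_1,u_2]$; (iv) $u_0$ is a root of the second order of the function $u\mapsto D_+(u,\varepsilon_0)$ (that is, the function and its first derivative vanish at $u_0$ and its second derivative does not). Then there exists $\varepsilon_+>\varepsilon_0$ such that for every $\varepsilon\in(\varepsilon_0,\varepsilon_+)$ there exist two roots $u^l<u^r$ in $(u_1,u_2)$ of the equation $D_+(u,\varepsilon)=0$, and one can construct the foliation $$\Omega^{\mathrm R}_\varepsilon(u_1,u^l)\cup\Omega^{\mathrm{W}+}_\varepsilon(u^l,u^r)\cup\Omega^{\mathrm R}_\varepsilon(u^r,u_2),$$ where the foliation of the domain $\Omega^{\mathrm{W}+}_\varepsilon(u^l,u^r)=\{(x_1,x_2): u^l\le x_1-x_2\le u^r,\ -\varepsilon\le x_2\le\varepsilon\}$ is a left horizontal herringbone whose spine extends from the point $(u^l+\varepsilon,\varepsilon)$ to the point $(u^r+\varepsilon,\varepsilon)$. That is, there is a $C^1$-smooth diagonally concave function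 $B$ on $\{u_1\le x_1-x_2\le u_2,\ |x_2|\le\varepsilon\}$ with $B(x_1,\pm\varepsilon)=f_\pm(x_1)$ whose restrictions to $\Omega^{\mathrm R}_\varepsilon(u_1,u^l)$ and $\Omega^{\mathrm R}_\varepsilon(u^r,u_2)$ are right simple candidates and whose restriction to $\Omega^{\mathrm{W}+}_\varepsilon(u^l,u^r)$ is a left herringbone candidate with a spine as described, which does not meet the line $x_2=0$.
   Context: Notation. For $x=(x_1,x_2)$ with $x_2\ne0$, the functions $D_\pm$ are defined by $$2x_2D_+(x)=f_+'(x_1+x_2)-f_-'(x_1-x_2)-2x_2f_+''(x_1+x_2),$$ $$2x_2D_-(x)=f_+'(x_1+x_2)-f_-'(x_1-x_2)-2x_2f_-''(x_1-x_2).$$ For $\varepsilon>0$ the strip is $\Omega_\varepsilon=\{(x_1,x_2):|x_2|\le\varepsilon\}$. A function on a subset of the strip is diagonally concave if it is concave on every segment contained in the subset and parallel to $(1,1)$ or to $(1,-1)$. Right simple candidate. $\Omega^{\mathrm R}_\varepsilon(a,b)=\{(x_1,x_2):a\le x_1-x_2\le b,\ |x_2|\le\varepsilon\}$, foliated by the segments $x_1-x_2=u$; the right simple candidate on it is the function, affine on each of these segments, $$B(x_1,x_2)=\frac{\varepsilon+x_2}{2\varepsilon}f_+(x_1-x_2+\varepsilon)+\frac{\varepsilon-x_2}{2\varepsilon}f_-(x_1-x_2-\varepsilon),$$ provided it is diagonally concave. Left (horizontal) herringbone. Its spine is a graph $\{(u,T(u)):u\in[p,q]\}$ with $T$ continuous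 on $[p,q]$, and $C^1$ with $|T|<\varepsilon$, $|T'|<1$ on $(p,q)$. From each spine point $(u,T)$, $T=T(u)$, two segments (ribs) go to the left: one to the upper boundary point $(u+T-\varepsilon,\varepsilon)$, the other to the lower boundary point $(u-T-\varepsilon,-\varepsilon)$. The domain is the union of all ribs. The shifted curve $\{(u-\varepsilon,T(u))\}$ is an integral curve of the field $$\dot x_1=\varepsilon(f_+'-f_-')-x_2(\varepsilon-x_2)f_-''-x_2(\varepsilon+x_2)f_+'',\qquad \dot x_2=x_2(f_-'-f_+')-x_2(\varepsilon-x_2)f_-''+x_2(\varepsilon+x_2)f_+'',$$ where the derivatives of $f_+$ are taken at $x_1+x_2$ and those of $f_-$ at $x_1-x_2$. A left herringbone candidate is a $C^1$-smooth diagonally concave function $B$ on this domain with $B(x_1,\pm\varepsilon)=f_\pm(x_1)$, affine on each rib, whose value at the spine point $(u,T)$ is $$\frac{\varepsilon^2-T^2}{2\varepsilon T}\big[(\varepsilon+T)f_+'-(\varepsilon-T)f_-'\big]+\frac{(\varepsilon+T)f_++(\varepsilon-T)f_-}{2\varepsilon},$$ with $f_+,f_+'$ taken at $u+T-\varepsilon$ and $f_-,f_-'$ taken at $u-T-\varepsilon$ (by continuity where $T=0$). *)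

theory Defs
  imports "HOL-Analysis.Analysis"
begin

definition C_k :: "nat \<Rightarrow> (real \<Rightarrow> real) \<Rightarrow> bool" where
  "C_k k f \<longleftrightarrow>
     (\<forall>i<k. ((deriv ^^ i) f) differentiable_on UNIV) \<and> continuous_on UNIV ((deriv ^^ k) f)"

definition root_of_order :: "nat \<Rightarrow> (real \<Rightarrow> real) \<Rightarrow> real \<Rightarrow> bool" where
  "root_of_order k g x \<longleftrightarrow> (\<forall>i<k. (deriv ^^ i) g x = 0) \<and> (deriv ^^ k) g x \<noteq> 0"

text \<open>On a closed domain, smoothness means differentiability relative to the domain with a
  continuous gradient. It is used below for closed parallelograms, where the relative
  gradient is unique; the smoothness thus includes one-sided smoothness up to the boundary.\<close>

definition C1_smooth_on :: "(real \<times> real) set \<Rightarrow> (real \<times> real \<Rightarrow> real) \<Rightarrow> bool" where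
  "C1_smooth_on S B \<longleftrightarrow>
     (\<exists>G. (\<forall>x\<in>S. (B has_derivative (\<lambda>h. G x \<bullet> h)) (at x within S)) \<and> continuous_on S G)"

definition diag_concave_on :: "(real \<times> real) set \<Rightarrow> (real \<times> real \<Rightarrow> real) \<Rightarrow> bool" where
  "diag_concave_on S B \<longleftrightarrow>
     (\<forall>x y. closed_segment x y \<subseteq> S \<and>
        (\<exists>t. y - x = t *\<^sub>R (1, 1) \<or> y - x = t *\<^sub>R (1, -1))
        \<longrightarrow> concave_on (closed_segment x y) B)"

definition affine_on_segment ::
  "real \<times> real \<Rightarrow> real \<times> real \<Rightarrow> (real \<times> real \<Rightarrow> real) \<Rightarrow> bool" where
  "affine_on_segment x y B \<longleftrightarrow>
     (\<forall>t\<in>{0..1}. B ((1 - t) *\<^sub>R x + t *\<^sub>R y) = (1 - t) * B x + t * B y)"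

text \<open>The boundary data \<open>fp\<close> and \<open>fm\<close> are the functions $f_+$ and $f_-$. The values of
  \<open>D_plus\<close> and \<open>D_minus\<close> are meaningful only where the second coordinate is nonzero.\<close>

definition D_plus :: "(real \<Rightarrow> real) \<Rightarrow> (real \<Rightarrow> real) \<Rightarrow> real \<times> real \<Rightarrow> real" where
  "D_plus fp fm = (\<lambda>(x1, x2).
     (deriv fp (x1 + x2) - deriv fm (x1 - x2) - 2 * x2 * (deriv ^^ 2) fp (x1 + x2)) / (2 * x2))"

definition D_minus :: "(real \<Rightarrow> real) \<Rightarrow> (real \<Rightarrow> real) \<Rightarrow> real \<times> real \<Rightarrow> real" where
  "D_minus fp fm = (\<lambda>(x1, x2).
     (deriv fp (x1 + x2) - deriv fm (x1 - x2) - 2 * x2 * (deriv ^^ 2) fm (x1 - x2)) / (2 * x2))"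

definition boundary_values ::
  "(real \<Rightarrow> real) \<Rightarrow> (real \<Rightarrow> real) \<Rightarrow> real \<Rightarrow> (real \<times> real) set \<Rightarrow> (real \<times> real \<Rightarrow> real) \<Rightarrow> bool" where
  "boundary_values fp fm \<epsilon> S B \<longleftrightarrow>
     (\<forall>x1. ((x1, \<epsilon>) \<in> S \<longrightarrow> B (x1, \<epsilon>) = fp x1) \<and> ((x1, -\<epsilon>) \<in> S \<longrightarrow> B (x1, -\<epsilon>) = fm x1))"

definition Omega_R :: "real \<Rightarrow> real \<Rightarrow> real \<Rightarrow> (real \<times> real) set" where
  "Omega_R \<epsilon> a b = {(x1, x2). a \<le> x1 - x2 \<and> x1 - x2 \<le> b \<and> \<bar>x2\<bar> \<le> \<epsilon>}"

definition right_simple_candidate ::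
  "(real \<Rightarrow> real) \<Rightarrow> (real \<Rightarrow> real) \<Rightarrow> real \<Rightarrow> real \<Rightarrow> real \<Rightarrow> (real \<times> real \<Rightarrow> real) \<Rightarrow> bool" where
  "right_simple_candidate fp fm \<epsilon> a b B \<longleftrightarrow>
     (\<forall>(x1, x2) \<in> Omega_R \<epsilon> a b.
        B (x1, x2) = (\<epsilon> + x2) / (2 * \<epsilon>) * fp (x1 - x2 + \<epsilon>)
                   + (\<epsilon> - x2) / (2 * \<epsilon>) * fm (x1 - x2 - \<epsilon>)) \<and>
     diag_concave_on (Omega_R \<epsilon> a b) B"

definition herringbone_field ::
  "(real \<Rightarrow> real) \<Rightarrow> (real \<Rightarrow> real) \<Rightarrow> real \<Rightarrow> real \<times> real \<Rightarrow> real \<times> real" where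
  "herringbone_field fp fm \<epsilon> = (\<lambda>(x1, x2).
     (\<epsilon> * (deriv fp (x1 + x2) - deriv fm (x1 - x2))
        - x2 * (\<epsilon> - x2) * (deriv ^^ 2) fm (x1 - x2)
        - x2 * (\<epsilon> + x2) * (deriv ^^ 2) fp (x1 + x2),
      x2 * (deriv fm (x1 - x2) - deriv fp (x1 + x2))
        - x2 * (\<epsilon> - x2) * (deriv ^^ 2) fm (x1 - x2)
        + x2 * (\<epsilon> + x2) * (deriv ^^ 2) fp (x1 + x2)))"

text \<open>A curve, as a set of points, is an integral curve if it is traced out by a solution of the
  autonomous system on some open time interval, which may be unbounded.\<close>

definition integral_curve ::
  "(real \<times> real \<Rightarrow> real \<times> real) \<Rightarrow> (real \<times> real) set \<Rightarrow> bool" where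
  "integral_curve X C \<longleftrightarrow>
     (\<exists>I \<gamma>. open I \<and> is_interval I \<and>
        (\<forall>t\<in>I. (\<gamma> has_vector_derivative X (\<gamma> t)) (at t)) \<and> \<gamma> ` I = C)"

text \<open>The integral curve is taken over the open interval: a spine may end at stationary points of
  the field, which a solution reaches only in infinite time.\<close>

definition left_spine ::
  "(real \<Rightarrow> real) \<Rightarrow> (real \<Rightarrow> real) \<Rightarrow> real \<Rightarrow> real \<Rightarrow> real \<Rightarrow> (real \<Rightarrow> real) \<Rightarrow> bool" where
  "left_spine fp fm \<epsilon> p q T \<longleftrightarrow>
     p < q \<and> continuous_on {p..q} T \<and> T C1_differentiable_on {p<..<q} \<and>
     (\<forall>u\<in>{p<..<q}. \<bar>T u\<bar> < \<epsilon> \<and> \<bar>deriv T u\<bar> < 1) \<and>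
     integral_curve (herringbone_field fp fm \<epsilon>) ((\<lambda>u. (u - \<epsilon>, T u)) ` {p<..<q})"

definition upper_end :: "real \<Rightarrow> (real \<Rightarrow> real) \<Rightarrow> real \<Rightarrow> real \<times> real" where
  "upper_end \<epsilon> T u = (u + T u - \<epsilon>, \<epsilon>)"

definition lower_end :: "real \<Rightarrow> (real \<Rightarrow> real) \<Rightarrow> real \<Rightarrow> real \<times> real" where
  "lower_end \<epsilon> T u = (u - T u - \<epsilon>, -\<epsilon>)"

definition herringbone_domain :: "real \<Rightarrow> real \<Rightarrow> real \<Rightarrow> (real \<Rightarrow> real) \<Rightarrow> (real \<times> real) set" where
  "herringbone_domain \<epsilon> p q T =
     (\<Union>u\<in>{p..q}. closed_segment (u, T u) (upper_end \<epsilon> T u)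
                \<union> closed_segment (u, T u) (lower_end \<epsilon> T u))"

definition spine_value ::
  "(real \<Rightarrow> real) \<Rightarrow> (real \<Rightarrow> real) \<Rightarrow> real \<Rightarrow> real \<Rightarrow> real \<Rightarrow> real" where
  "spine_value fp fm \<epsilon> u \<tau> =
     (\<epsilon>\<^sup>2 - \<tau>\<^sup>2) / (2 * \<epsilon> * \<tau>)
       * ((\<epsilon> + \<tau>) * deriv fp (u + \<tau> - \<epsilon>) - (\<epsilon> - \<tau>) * deriv fm (u - \<tau> - \<epsilon>))
     + ((\<epsilon> + \<tau>) * fp (u + \<tau> - \<epsilon>) + (\<epsilon> - \<tau>) * fm (u - \<tau> - \<epsilon>)) / (2 * \<epsilon>)"

text \<open>The formula for the spine value is imposed only where \<open>T u \<noteq> 0\<close>; where \<open>T u = 0\<close>, the value is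
  its limit along the spine.\<close>

definition left_herringbone_candidate ::
  "(real \<Rightarrow> real) \<Rightarrow> (real \<Rightarrow> real) \<Rightarrow> real \<Rightarrow> real \<Rightarrow> real \<Rightarrow> (real \<Rightarrow> real)
     \<Rightarrow> (real \<times> real \<Rightarrow> real) \<Rightarrow> bool" where
  "left_herringbone_candidate fp fm \<epsilon> p q T B \<longleftrightarrow>
     left_spine fp fm \<epsilon> p q T \<and>
     C1_smooth_on (herringbone_domain \<epsilon> p q T) B \<and>
     diag_concave_on (herringbone_domain \<epsilon> p q T) B \<and>
     boundary_values fp fm \<epsilon> (herringbone_domain \<epsilon> p q T) B \<and>
     (\<forall>u\<in>{p..q}.
        affine_on_segment (u, T u) (upper_end \<epsilon> T u) B \<and>
        affine_on_segment (u, T u) (lower_end \<epsilon> T u) B \<and>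
        (if T u \<noteq> 0 then B (u, T u) = spine_value fp fm \<epsilon> u (T u)
         else ((\<lambda>v. spine_value fp fm \<epsilon> v (T v)) \<longlongrightarrow> B (u, T u))
                (at u within {v\<in>{p..q}. T v \<noteq> 0})))"

end

theory Submission
  imports Defs "HOL-Complex_Analysis.Great_Picard"
begin

text \<open>In the coordinates $r = x_1 + x_2 - \varepsilon$ and
  $b = x_1 - x_2 - \varepsilon$ both families of diagonals become coordinate lines, a lower rib is a
  line $b = $ const that meets the lower boundary where $f_-$ is evaluated at $b$, and an upper rib is
  a line $r = $ const that meets the upper boundary where $f_+$ is evaluated at $r$. With the
  difference quotient $s(r, b) = (f_+'(r) - f_-'(b)) / (r - b)$ one has $D_+ = s - f_+''(r)$,
  $D_- = s - f_-''(b)$, and moreover $\partial_b s = D_- / (r - b)$, $\partial_r s = - D_+ / (r - b)$.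
  Everything else follows from these identities.

  A spine determines the function. Let the shifted spine be $(x, \tau(x))$, put
  $\alpha = x + \tau$ and $\beta = x - \tau$. Its differential equation says
  $(\varepsilon + \tau) D_+ \alpha' = (\varepsilon - \tau) D_- \beta'$. This is exactly the condition
  under which the slopes of the candidate along the lower and upper ribs have derivative $s$ as
  functions of $b$ and of $r$ (\<open>m_n_deriv\<close>), and then the two pieces agree on the spine
  together with their gradients (\<open>lower_upper_match\<close>). Differentiating $s$ along the spine gives
  $D_- / (\varepsilon + \tau)$ and $D_+ / (\varepsilon - \tau)$, so the second derivative transversal to
  a rib is $- D_\pm$ times a factor that decreases from one at the boundary to zero at the spine:
  the function is diagonally concave because $D_\pm \ge 0$ (\<open>concave_in_b\<close>, \<open>concave_in_r\<close>).
  If $\tau$ is continued by $\varepsilon$ outside the herringbone, the formula of the lower ribs becomes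
  the formula of the right simple candidate. Thus a single function covers the whole strip, and its
  smoothness across the lines $x_1 - x_2 = u^l$ and $x_1 - x_2 = u^r$ comes for free.

  The spine is a singular orbit (\<open>spine_exists\<close>). For $y = \varepsilon - \tau$ the equation reads
  $y' = (P - Q) / (P + Q)$ with $P = (2 \varepsilon - y) D_+$ and $Q = y D_-$, and $P = Q = 0$ at both
  end points. At $(u_0, \varepsilon_0)$ the $x_1$-derivative of $D_+$ vanishes, so its
  $x_2$-derivative is $- k$ with $k = D_- / \varepsilon_0$. Hence nearby
  $D_+(x, \varepsilon - y) \approx g(x) + k y$ with $g(x) = D_+(x, \varepsilon)$, and
  $P / Q \approx 2 (1 + g / (k y))$. On the curve $y = - 5 g / (4 k)$ this ratio is about $2/5$, on
  $y = - 4 g / k$ about $3/2$, whereas the slopes of the two curves are tiny. Followed from $u^r$ to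
  the left, a solution can therefore leave the region between the curves nowhere, and since both curves
  pass through zero at $u^l$, it ends there. The solution itself comes from Peano's theorem for the
  field clamped between the two curves, which is bounded by one (\<open>peano_bounded_field\<close>).

  The two roots appear by convexity (\<open>bifurcation\<close>). Close to $u_0$ the function $g$ is convex and, for
  $\varepsilon > \varepsilon_0$, negative at $u_0$; away from $u_0$ it is positive by compactness.\<close>

section \<open>Functions of one variable\<close>

text \<open>A continuous derivative has no jumps: by the fundamental theorem of calculus with exceptional
  points, the function is an integral of \<open>g\<close>. This gives smoothness across the lines where two
  foliations meet.\<close>

lemma derivative_off_finite_set:
  fixes f g :: "real \<Rightarrow> real"
  assumes f: "continuous_on UNIV f" and g: "continuous_on UNIV g" and S: "finite S"
    and der: "\<And>x. x \<notin> S \<Longrightarrow> (f has_real_derivative g x) (at x)"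
  shows "(f has_real_derivative g x) (at x)"
proof -
  have int: "(g has_integral (f y - f (x - 1))) {x - 1..y}" if "x - 1 \<le> y" for y
    using der that
    by (intro fundamental_theorem_of_calculus_interior_strong[OF S])
      (auto simp: has_real_derivative_iff_has_vector_derivative
        intro: continuous_on_subset[OF f])
  have "((\<lambda>y. integral {x - 1..y} g) has_real_derivative g x) (at x within {x - 1..x + 1})"
    by (intro integral_has_real_derivative continuous_on_subset[OF g]) auto
  hence "((\<lambda>y. integral {x - 1..y} g) has_real_derivative g x) (at x)"
    by (subst (asm) at_within_interior) auto
  hence "((\<lambda>y. f y - f (x - 1)) has_real_derivative g x) (at x)"
    by (rule DERIV_cong_ev[OF refl _ refl, THEN iffD1, rotated])
      (auto intro!: eventually_mono[OF order_tendstoD(1)[OF tendsto_ident_at, of "x - 1" x UNIV]]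
        integral_unique int simp: eventually_at_filter eventually_nhds_metric dist_real_def
        intro: exI[of _ 1])
  from DERIV_add[OF this DERIV_const[of "f (x - 1)"]] show ?thesis by simp
qed

lemma extend_antiderivative:
  fixes f g :: "real \<Rightarrow> real"
  assumes "a \<le> b" and f: "continuous_on {a..b} f" and g: "continuous_on {a..b} g"
    and der: "\<And>x. x \<in> {a<..<b} \<Longrightarrow> (f has_real_derivative g x) (at x)"
  obtains F where "\<And>x. (F has_real_derivative g (max a (min b x))) (at x)"
    "\<And>x. x \<in> {a..b} \<Longrightarrow> F x = f x"
proof -
  \<comment> \<open>Continued by its tangents. The derivative of the result is known except at \<open>a\<close> and \<open>b\<close>.\<close>
  define F where
    "F = (\<lambda>x. f (max a (min b x)) + g a * min (x - a) 0 + g b * max (x - b) 0)"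
  have "(F has_real_derivative g (max a (min b x))) (at x)" for x
  proof (rule derivative_off_finite_set[where S = "{a, b}" and g = "\<lambda>x. g (max a (min b x))"])
    show "continuous_on UNIV F"
      unfolding F_def using \<open>a \<le> b\<close>
      by (intro continuous_intros continuous_on_compose2[OF f]) auto
    show "continuous_on UNIV (\<lambda>x. g (max a (min b x)))"
      using \<open>a \<le> b\<close> by (intro continuous_intros continuous_on_compose2[OF g]) auto
    fix x assume "x \<notin> {a, b}"
    then consider "x < a" | "a < x" "x < b" | "b < x" by force
    thus "(F has_real_derivative g (max a (min b x))) (at x)"
    proof cases
      case 1
      have "((\<lambda>x. f a + g a * (x - a)) has_real_derivative g a) (at x)"
        by (auto intro!: derivative_eq_intros)
      hence "(F has_real_derivative g a) (at x)"
        by (rule has_field_derivative_transform_within_open[of _ _ _ "{..<a}"])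
          (use 1 \<open>a \<le> b\<close> in \<open>auto simp: F_def\<close>)
      thus ?thesis using 1 \<open>a \<le> b\<close> by simp
    next
      case 2
      have "(F has_real_derivative g x) (at x)"
        by (rule has_field_derivative_transform_within_open[OF der, of _ "{a<..<b}"])
          (use 2 in \<open>auto simp: F_def\<close>)
      thus ?thesis using 2 by simp
    next
      case 3
      have "((\<lambda>x. f b + g b * (x - b)) has_real_derivative g b) (at x)"
        by (auto intro!: derivative_eq_intros)
      hence "(F has_real_derivative g b) (at x)"
        by (rule has_field_derivative_transform_within_open[of _ _ _ "{b<..}"])
          (use 3 \<open>a \<le> b\<close> in \<open>auto simp: F_def\<close>)
      thus ?thesis using 3 \<open>a \<le> b\<close> by simp
    qed
  qed auto
  moreover have "F x = f x" if "x \<in> {a..b}" for x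
    using that by (auto simp: F_def)
  ultimately show thesis using that by blast
qed

lemma nonincreasing_off_finite_set:
  fixes f :: "real \<Rightarrow> real"
  assumes "a \<le> b" and f: "continuous_on {a..b} f" and S: "finite S"
    and der: "\<And>x. x \<in> {a<..<b} - S \<Longrightarrow> \<exists>y\<le>0. (f has_real_derivative y) (at x)"
  shows "f b \<le> f a"
proof -
  define d where "d x = (if x \<in> {a<..<b} - S then deriv f x else 0)" for x
  have d: "(f has_real_derivative d x) (at x) \<and> d x \<le> 0" if "x \<in> {a<..<b} - S" for x
    using der[OF that] that by (auto simp: d_def dest: DERIV_imp_deriv)
  have "(d has_integral (f b - f a)) {a..b}"
    using d by (intro fundamental_theorem_of_calculus_interior_strong[OF S \<open>a \<le> b\<close> _ f])
      (auto simp: has_real_derivative_iff_has_vector_derivative)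
  hence "f b - f a \<le> 0"
    by (rule has_integral_le[OF _ has_integral_0]) (use d in \<open>auto simp: d_def\<close>)
  thus ?thesis by simp
qed

text \<open>The derivative may fail to be differentiable where the foliation changes; such points do not
  spoil its monotonicity.\<close>

lemma concave_on_interval:
  fixes c d :: "real \<Rightarrow> real"
  assumes c: "\<And>x. x \<in> {a..b} \<Longrightarrow> (c has_real_derivative d x) (at x within {a..b})"
    and d: "continuous_on {a..b} d" and S: "finite S"
    and der: "\<And>x. x \<in> {a<..<b} - S \<Longrightarrow> \<exists>y\<le>0. (d has_real_derivative y) (at x)"
  shows "concave_on {a..b} c"
  unfolding concave_on_def
proof (rule convex_on_linorderI)
  fix t x y :: real
  assume t: "0 < t" "t < 1" and xy: "x \<in> {a..b}" "y \<in> {a..b}" "x < y"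
  define z where "z = (1 - t) * x + t * y"
  have zx: "z - x = t * (y - x)" and yz: "y - z = (1 - t) * (y - x)"
    by (simp_all add: z_def algebra_simps)
  have "z - x > 0" "y - z > 0" using t xy by (simp_all add: zx yz)
  hence z: "x < z" "z < y" by simp_all
  have mvt: "\<exists>\<xi>\<in>{s<..<t}. c t - c s = (t - s) * d \<xi>" if "s < t" "a \<le> s" "t \<le> b" for s t
  proof -
    have "\<exists>\<xi>\<in>{s<..<t}. c t - c s = (\<lambda>h. h * d \<xi>) (t - s)"
    proof (rule mvt_simple[OF \<open>s < t\<close>])
      fix u assume "s \<le> u" "u \<le> t"
      hence "(c has_real_derivative d u) (at u within {s..t})"
        using that by (intro DERIV_subset[OF c[of u]]) auto
      thus "(c has_derivative (\<lambda>h. h * d u)) (at u within {s..t})"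
        unfolding has_field_derivative_def by (simp add: mult_commute_abs)
    qed
    thus ?thesis by simp
  qed
  have "\<exists>\<xi>\<in>{x<..<z}. c z - c x = (z - x) * d \<xi>" "\<exists>\<xi>\<in>{z<..<y}. c y - c z = (y - z) * d \<xi>"
    by (rule mvt; use z xy in simp)+
  then obtain \<xi>1 \<xi>2 where \<xi>1: "\<xi>1 \<in> {x<..<z}" "c z - c x = (z - x) * d \<xi>1"
    and \<xi>2: "\<xi>2 \<in> {z<..<y}" "c y - c z = (y - z) * d \<xi>2" by blast
  have "d \<xi>2 \<le> d \<xi>1"
  proof (rule nonincreasing_off_finite_set[where f = d, OF _ _ S])
    show "\<xi>1 \<le> \<xi>2" using \<xi>1(1) \<xi>2(1) by simp
    show "continuous_on {\<xi>1..\<xi>2} d"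
      using \<xi>1(1) \<xi>2(1) xy by (intro continuous_on_subset[OF d]) auto
    show "\<exists>y\<le>0. (d has_real_derivative y) (at x)" if "x \<in> {\<xi>1<..<\<xi>2} - S" for x
      using der[of x] that \<xi>1(1) \<xi>2(1) xy by auto
  qed
  hence "0 \<le> (t * (1 - t) * (y - x)) * (d \<xi>1 - d \<xi>2)"
    using t xy by simp
  also have "\<dots> = (1 - t) * ((z - x) * d \<xi>1) - t * ((y - z) * d \<xi>2)"
    unfolding zx yz by (simp add: algebra_simps)
  also have "\<dots> = (1 - t) * (c z - c x) - t * (c y - c z)"
    using \<xi>1 \<xi>2 by simp
  finally show "- c ((1 - t) *\<^sub>R x + t *\<^sub>R y) \<le> (1 - t) * - c x + t * - c y"
    by (simp add: z_def algebra_simps)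
qed simp

lemma homeomorphism_inverse:
  fixes f f' :: "real \<Rightarrow> real"
  assumes "strict_mono f" "continuous_on UNIV f" "surj f"
  shows "continuous_on UNIV (inv f)"
    and "(f has_real_derivative d) (at (inv f y)) \<Longrightarrow> d \<noteq> 0 \<Longrightarrow> (inv f has_real_derivative 1 / d) (at y)"
proof -
  have inj: "inj f" using assms(1) by (simp add: strict_mono_imp_inj_on)
  have c: "isCont (inv f) y" for y
  proof -
    have "isCont (inv f) (f (inv f y))"
      by (rule isCont_inverse_function[of 1]) (use assms inj in \<open>auto simp: continuous_on_eq_continuous_at\<close>)
    thus ?thesis using assms(3) by (simp add: surj_f_inv_f)
  qed
  thus "continuous_on UNIV (inv f)" by (simp add: continuous_at_imp_continuous_on)
  show "(inv f has_real_derivative 1 / d) (at y)"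
    if "(f has_real_derivative d) (at (inv f y))" "d \<noteq> 0"
    using DERIV_inverse_function[where f = f and g = "inv f", OF that, of "y - 1" "y + 1"] c assms(3)
    by (simp add: surj_f_inv_f inverse_eq_divide)
qed

lemma strict_mono_off_finite_set:
  fixes f :: "real \<Rightarrow> real"
  assumes f: "continuous_on UNIV f" and S: "finite S"
    and der: "\<And>x. x \<notin> S \<Longrightarrow> \<exists>y>0. (f has_real_derivative y) (at x)"
  shows "strict_mono f"
proof (rule strict_monoI)
  fix x y :: real assume "x < y"
  have le: "f s \<le> f t" if "s \<le> t" for s t
  proof -
    have "- f t \<le> - f s"
    proof (rule nonincreasing_off_finite_set[where f = "\<lambda>x. - f x", OF that _ S])
      show "continuous_on {s..t} (\<lambda>x. - f x)"
        by (intro continuous_intros continuous_on_subset[OF f]) auto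
      fix u assume "u \<in> {s<..<t} - S"
      then obtain d where "d > 0" "(f has_real_derivative d) (at u)" using der by auto
      thus "\<exists>y\<le>0. ((\<lambda>x. - f x) has_real_derivative y) (at u)"
        by (intro exI[of _ "- d"]) (auto intro: DERIV_minus)
    qed
    thus ?thesis by simp
  qed
  \<comment> \<open>A monotone function with equal values at \<open>x\<close> and \<open>y\<close> is constant in between,
    which contradicts the positive derivative.\<close>
  have "f x \<noteq> f y"
  proof
    assume eq: "f x = f y"
    have "infinite ({x<..<y} - S)" using \<open>x < y\<close> S by simp
    then obtain u where u: "u \<in> {x<..<y}" "u \<notin> S" by (metis Diff_iff ex_in_conv finite.emptyI)
    then obtain d where d: "d > 0" "(f has_real_derivative d) (at u)" using der by blast
    have "((\<lambda>_. f x) has_real_derivative d) (at u)"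
    proof (rule has_field_derivative_transform_within_open[OF d(2), of "{x<..<y}"])
      fix t assume "t \<in> {x<..<y}"
      thus "f t = f x" using le[of x t] le[of t y] eq by simp
    qed (use u in auto)
    hence "d = 0" using DERIV_const DERIV_unique by blast
    thus False using d by simp
  qed
  thus "f x < f y" using le[of x y] \<open>x < y\<close> by simp
qed

lemma surj_of_translation_outside:
  fixes f :: "real \<Rightarrow> real"
  assumes f: "continuous_on UNIV f" and "a \<le> b" and out: "\<And>x. x \<notin> {a<..<b} \<Longrightarrow> f x = x + c"
  shows "surj f"
proof -
  have "\<exists>x. f x = y" for y
  proof (cases "y - c \<in> {a<..<b}")
    case True
    have "\<exists>x\<ge>a. x \<le> b \<and> f x = y"
      using True out[of a] out[of b] \<open>a \<le> b\<close>
      by (intro IVT') (auto intro: continuous_on_subset[OF f])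
    thus ?thesis by blast
  next
    case False
    thus ?thesis using out[of "y - c"] by (intro exI[of _ "y - c"]) simp
  qed
  thus ?thesis unfolding surj_def by metis
qed

lemma has_derivative_closed_Un:
  assumes "closed L" "closed U" "z \<in> L \<union> U"
    and L: "z \<in> L \<Longrightarrow> (f has_derivative f') (at z within L)"
    and U: "z \<in> U \<Longrightarrow> (f has_derivative f') (at z within U)"
  shows "(f has_derivative f') (at z within L \<union> U)"
proof -
  have bot: "at z within T = bot" if "closed T" "z \<notin> T" for T
    using that by (metis Diff_empty Diff_insert0 at_within_def closed_def ComplI
      at_within_eq_bot_iff closure_closed)
  have bl: "bounded_linear f'" using assms has_derivative_bounded_linear by blast
  have "(f has_derivative f') (at z within L) \<and> (f has_derivative f') (at z within U)"
  proof (intro conjI)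
    show "(f has_derivative f') (at z within L)"
      using L bot[OF \<open>closed L\<close>] bl by (cases "z \<in> L") (simp_all add: has_derivative_def)
    show "(f has_derivative f') (at z within U)"
      using U bot[OF \<open>closed U\<close>] bl by (cases "z \<in> U") (simp_all add: has_derivative_def)
  qed
  thus ?thesis
    unfolding has_derivative_within by (simp add: at_within_union filterlim_sup)
qed

text \<open>The barrier principle: followed from right to left, a function that decreases wherever it is
  negative cannot become negative.\<close>

lemma nonneg_backward:
  fixes f :: "real \<Rightarrow> real"
  assumes f: "continuous_on {a..b} f" and "0 \<le> f b"
    and der: "\<And>x. x \<in> {a<..<b} \<Longrightarrow> f x < 0 \<Longrightarrow> \<exists>y\<le>0. (f has_real_derivative y) (at x)"
    and x: "x \<in> {a..b}"
  shows "0 \<le> f x"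
proof (rule ccontr)
  assume neg: "\<not> 0 \<le> f x"
  define Z where "Z = {t \<in> {x..b}. 0 \<le> f t}"
  have Z_ne: "b \<in> Z" using assms by (auto simp: Z_def)
  have Z_bdd: "bdd_below Z" by (auto simp: Z_def intro: bdd_belowI[of _ x])
  have "closed Z"
  proof -
    have "continuous_on {x..b} f" using x by (intro continuous_on_subset[OF f]) auto
    hence "closed ({x..b} \<inter> f -` {0..})" by (rule continuous_closed_preimage) auto
    moreover have "Z = {x..b} \<inter> f -` {0..}" by (auto simp: Z_def)
    ultimately show ?thesis by simp
  qed
  define t where "t = Inf Z"
  have t: "t \<in> Z" unfolding t_def using closed_contains_Inf[OF _ Z_bdd \<open>closed Z\<close>] Z_ne by blast
  have lt: "f s < 0" if "x \<le> s" "s < t" for s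
  proof (rule ccontr)
    assume "\<not> f s < 0"
    hence "s \<in> Z" using that t by (auto simp: Z_def)
    hence "t \<le> s" unfolding t_def by (rule cInf_lower[OF _ Z_bdd])
    thus False using that by simp
  qed
  have "f t \<le> f x"
  proof (rule nonincreasing_off_finite_set[where f = f and S = "{}"])
    show "x \<le> t" using t by (simp add: Z_def)
    show "continuous_on {x..t} f" using t x by (intro continuous_on_subset[OF f]) (auto simp: Z_def)
    show "\<exists>y\<le>0. (f has_real_derivative y) (at s)" if "s \<in> {x<..<t} - {}" for s
      using that t x lt[of s] by (intro der) (auto simp: Z_def)
  qed simp
  thus False using neg t by (simp add: Z_def)
qed

section \<open>Peano existence for a bounded field\<close>

text \<open>Tonelli's approximation: with a delay, the right-hand side only involves values that are
  already known.\<close>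

lemma delayed_equation:
  fixes H :: "real \<times> real \<Rightarrow> real"
  assumes H: "continuous_on UNIV H" and "\<delta> > 0" "a < b"
  shows "\<exists>Y. continuous_on UNIV Y \<and> (\<forall>x\<le>a. Y x = y0) \<and>
    (\<forall>x\<in>{a..b}. (Y has_real_derivative H (x, Y (x - \<delta>))) (at x within {a..b}))"
proof -
  \<comment> \<open>Iterating the integral operator gains one delay per step, so that finitely many steps
    reach the right end.\<close>
  define step where
    "step Z = (\<lambda>x. y0 + integral {a..max a (min b x)} (\<lambda>s. H (s, Z (s - \<delta>))))" for Z
  define Z where "Z k = (step ^^ k) (\<lambda>_. y0)" for k
  have Z_0: "Z 0 = (\<lambda>_. y0)" by (simp add: Z_def)
  have Z_Suc: "Z (Suc k) = step (Z k)" for k by (simp add: Z_def)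
  have cH: "continuous_on UNIV (\<lambda>s. H (s, W (s - \<delta>)))" if "continuous_on UNIV W" for W
    by (intro continuous_on_compose2[OF H] continuous_intros continuous_on_compose2[OF that]) auto
  have "continuous_on UNIV (step W)" if "continuous_on UNIV W" for W
  proof -
    have "continuous_on {a..b} (\<lambda>x. integral {a..x} (\<lambda>s. H (s, W (s - \<delta>))))"
      by (intro indefinite_integral_continuous_1 integrable_continuous_real
          continuous_on_subset[OF cH[OF that]]) auto
    hence "continuous_on UNIV
        (\<lambda>x. integral {a..max a (min b x)} (\<lambda>s. H (s, W (s - \<delta>))))"
      by (rule continuous_on_compose2) (use \<open>a < b\<close> in \<open>auto intro!: continuous_intros\<close>)
    thus ?thesis unfolding step_def by (intro continuous_intros)
  qed
  hence cZ: "continuous_on UNIV (Z k)" for k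
    by (induction k) (auto simp: Z_Suc Z_0)
  have eq: "Z (Suc k) x = Z k x" if "x \<le> a + k * \<delta>" for k x
    using that
  proof (induction k arbitrary: x)
    case 0
    then show ?case by (auto simp: Z_0 Z_Suc step_def)
  next
    case (Suc k)
    have "integral {a..max a (min b x)} (\<lambda>s. H (s, Z (Suc k) (s - \<delta>)))
        = integral {a..max a (min b x)} (\<lambda>s. H (s, Z k (s - \<delta>)))"
    proof (rule Henstock_Kurzweil_Integration.integral_cong)
      fix s assume s: "s \<in> {a..max a (min b x)}"
      have "s - \<delta> \<le> a + k * \<delta>"
      proof (cases "x \<le> a")
        case True
        hence "s \<le> a" using s by auto
        moreover have "0 \<le> k * \<delta>" using \<open>\<delta> > 0\<close> by simp
        ultimately show ?thesis using \<open>\<delta> > 0\<close> by linarith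
      next
        case False
        hence "s \<le> x" using s by auto
        thus ?thesis using Suc.prems by (simp add: algebra_simps)
      qed
      thus "H (s, Z (Suc k) (s - \<delta>)) = H (s, Z k (s - \<delta>))" by (simp add: Suc.IH)
    qed
    thus ?case by (simp add: Z_Suc[of "Suc k"] Z_Suc[of k] step_def)
  qed
  obtain K :: nat where K: "(b - a) / \<delta> \<le> K" using real_arch_simple by blast
  hence "b \<le> a + K * \<delta>" using \<open>\<delta> > 0\<close> by (simp add: field_simps)
  show ?thesis
  proof (intro exI[of _ "Z K"] conjI allI impI ballI)
    show "continuous_on UNIV (Z K)" by (rule cZ)
    show "Z K x = y0" if "x \<le> a" for x
      using that by (cases K) (auto simp: Z_0 Z_Suc step_def)
    fix x assume x: "x \<in> {a..b}"
    have "((\<lambda>x. y0 + integral {a..x} (\<lambda>s. H (s, Z K (s - \<delta>))))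
        has_real_derivative 0 + H (x, Z K (x - \<delta>))) (at x within {a..b})"
      using x by (intro DERIV_add DERIV_const integral_has_real_derivative
          continuous_on_subset[OF cH[OF cZ]]) auto
    hence "((\<lambda>x. y0 + integral {a..x} (\<lambda>s. H (s, Z K (s - \<delta>))))
        has_real_derivative H (x, Z K (x - \<delta>))) (at x within {a..b})" by simp
    thus "(Z K has_real_derivative H (x, Z K (x - \<delta>))) (at x within {a..b})"
    proof (rule has_field_derivative_transform_within[OF _ zero_less_one x])
      fix w assume "w \<in> {a..b}"
      hence "Z K w = Z (Suc K) w" using \<open>b \<le> a + K * \<delta>\<close> by (intro eq[symmetric]) auto
      thus "y0 + integral {a..w} (\<lambda>s. H (s, Z K (s - \<delta>))) = Z K w"
        using \<open>w \<in> {a..b}\<close> by (simp add: Z_Suc step_def)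
    qed
  qed
qed

text \<open>The field need not extend continuously to the end points of the interval, as happens at the ends of
  a spine. The bound alone makes the approximate solutions equicontinuous up to the end points, so a
  subsequence converges uniformly by the Arzela-Ascoli theorem; the limit solves the equation in the
  interior.\<close>

lemma peano_bounded_field:
  fixes F :: "real \<times> real \<Rightarrow> real"
  assumes "a < b" and F: "continuous_on ({a<..<b} \<times> UNIV) F"
    and bound: "\<And>x y. x \<in> {a<..<b} \<Longrightarrow> \<bar>F (x, y)\<bar> \<le> 1"
  obtains Y where "continuous_on {a..b} Y" "Y a = y0"
    "\<And>x. x \<in> {a<..<b} \<Longrightarrow> (Y has_real_derivative F (x, Y x)) (at x)"
proof -
  define \<delta> where "\<delta> n = (b - a) / real (n + 3)" for n
  have \<delta>: "0 < \<delta> n" "2 * \<delta> n < b - a" for n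
  proof -
    show "0 < \<delta> n" using \<open>a < b\<close> by (simp add: \<delta>_def)
    have "(b - a) * 2 < (b - a) * real (n + 3)"
      using \<open>a < b\<close> by (intro mult_strict_left_mono) auto
    thus "2 * \<delta> n < b - a" by (simp add: \<delta>_def pos_divide_less_eq mult.commute)
  qed
  have \<delta>_lim: "\<delta> \<longlonglongrightarrow> 0"
    unfolding \<delta>_def by (rule LIMSEQ_ignore_initial_segment[OF lim_const_over_n])
  \<comment> \<open>The field is frozen near the ends of the interval, where it need not extend continuously.\<close>
  define H where "H n = (\<lambda>(x, y). F (max (a + \<delta> n) (min (b - \<delta> n) x), y))" for n
  have H: "continuous_on UNIV (H n)" for n
    unfolding H_def split_def using \<delta>[of n]
    by (intro continuous_on_compose2[OF F] continuous_intros) auto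
  have H_bound: "\<bar>H n p\<bar> \<le> 1" for n p
    unfolding H_def split_def using \<delta>[of n] by (intro bound) auto
  have "\<forall>n. \<exists>Y. continuous_on UNIV Y \<and> (\<forall>x\<le>a. Y x = y0) \<and>
    (\<forall>x\<in>{a..b}. (Y has_real_derivative H n (x, Y (x - \<delta> n))) (at x within {a..b}))"
    by (intro allI delayed_equation H \<delta> \<open>a < b\<close>)
  from choice[OF this] obtain Y where Y_all: "\<forall>n. continuous_on UNIV (Y n) \<and> (\<forall>x\<le>a. Y n x = y0) \<and>
    (\<forall>x\<in>{a..b}. (Y n has_real_derivative H n (x, Y n (x - \<delta> n))) (at x within {a..b}))"
    by (rule exE)
  have Y: "continuous_on UNIV (Y n)" "x \<le> a \<Longrightarrow> Y n x = y0"
    "x \<in> {a..b} \<Longrightarrow>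
      (Y n has_real_derivative H n (x, Y n (x - \<delta> n))) (at x within {a..b})" for n x
    using Y_all by simp_all
  have lip: "\<bar>Y n x - Y n y\<bar> \<le> \<bar>x - y\<bar>" if "x \<in> {a..b}" "y \<in> {a..b}" for n x y
    using field_differentiable_bound[of "{a..b}" "Y n" "\<lambda>x. H n (x, Y n (x - \<delta> n))" 1, OF _ Y(3)]
      that H_bound by simp
  have lip': "\<bar>Y n (x - \<delta> n) - Y n x\<bar> \<le> \<delta> n" if x: "x \<in> {a..b}" for n x
  proof (cases "x - \<delta> n \<le> a")
    case True
    hence "Y n (x - \<delta> n) = Y n a" by (simp add: Y(2))
    moreover have "\<bar>Y n a - Y n x\<bar> \<le> \<bar>a - x\<bar>" using x by (intro lip) auto
    ultimately show ?thesis using x True by auto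
  next
    case False
    hence "\<bar>Y n (x - \<delta> n) - Y n x\<bar> \<le> \<bar>x - \<delta> n - x\<bar>" using x \<delta>[of n] by (intro lip) auto
    thus ?thesis using \<delta>[of n] by simp
  qed
  have bd: "\<bar>Y n x\<bar> \<le> \<bar>y0\<bar> + (b - a)" if "x \<in> {a..b}" for n x
    using lip[OF that, of a n] that Y(2)[OF order_refl, of n] by auto
  obtain g k where g: "continuous_on {a..b} g" and k: "strict_mono (k :: nat \<Rightarrow> nat)"
    and lim: "\<And>e. 0 < e \<Longrightarrow> \<exists>N. \<forall>n x. n \<ge> N \<and> x \<in> {a..b} \<longrightarrow> norm (Y (k n) x - g x) < e"
  proof (rule Arzela_Ascoli[of "{a..b}" Y "\<bar>y0\<bar> + (b - a)"])
    show "\<exists>d>0. \<forall>n y. y \<in> {a..b} \<and> norm (x - y) < d \<longrightarrow> norm (Y n x - Y n y) < e"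
      if "x \<in> {a..b}" "0 < e" for x e
    proof (intro exI conjI allI impI)
      fix n y assume "y \<in> {a..b} \<and> norm (x - y) < e"
      thus "norm (Y n x - Y n y) < e" using lip[OF that(1), of y n] by simp
    qed (rule that(2))
  qed (use bd in auto)
  have unif: "uniform_limit {a..b} (\<lambda>n. Y (k n)) g sequentially"
    unfolding uniform_limit_sequentially_iff dist_norm using lim by blast
  have \<delta>k: "(\<lambda>n. \<delta> (k n)) \<longlonglongrightarrow> 0"
    using LIMSEQ_subseq_LIMSEQ[OF \<delta>_lim k] by (simp add: o_def)
  have unif': "uniform_limit {a..b} (\<lambda>n x. Y (k n) (x - \<delta> (k n))) g sequentially"
  proof (rule uniform_limitI)
    fix e :: real assume "e > 0"
    have "\<forall>\<^sub>F n in sequentially. \<delta> (k n) < e / 2"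
      using order_tendstoD(2)[OF \<delta>k, of "e / 2"] \<open>e > 0\<close> by simp
    moreover have "\<forall>\<^sub>F n in sequentially. \<forall>x\<in>{a..b}. dist (Y (k n) x) (g x) < e / 2"
      using uniform_limitD[OF unif, of "e / 2"] \<open>e > 0\<close> by simp
    ultimately show "\<forall>\<^sub>F n in sequentially. \<forall>x\<in>{a..b}. dist (Y (k n) (x - \<delta> (k n))) (g x) < e"
    proof eventually_elim
      case (elim n)
      show ?case
      proof
        fix x assume x: "x \<in> {a..b}"
        have "dist (Y (k n) x) (g x) < e / 2" using elim x by blast
        thus "dist (Y (k n) (x - \<delta> (k n))) (g x) < e"
          using lip'[OF x, of "k n"] elim(1) unfolding dist_real_def by linarith
      qed
    qed
  qed
  have ga: "Y (k n) a = y0" for n by (simp add: Y)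
  have "(\<lambda>n. Y (k n) a) \<longlonglongrightarrow> g a"
    using tendsto_uniform_limitI[OF unif] \<open>a < b\<close> by simp
  hence "g a = y0" by (simp add: ga LIMSEQ_const_iff)
  moreover have "(g has_real_derivative F (x, g x)) (at x)" if x: "x \<in> {a<..<b}" for x
  proof -
    define c d where "c = (a + x) / 2" and "d = (x + b) / 2"
    have cd: "a < c" "c < x" "x < d" "d < b" using x by (auto simp: c_def d_def)
    define B where "B = \<bar>y0\<bar> + (b - a) + 1"
    have ucF: "uniformly_continuous_on ({c..d} \<times> {-B..B}) F"
      using cd by (intro compact_uniformly_continuous continuous_on_subset[OF F] compact_Times) auto
    have ev: "\<forall>\<^sub>F n in sequentially. \<delta> (k n) < min 1 (min (c - a) (b - d))"
      using order_tendstoD(2)[OF \<delta>k, of "min 1 (min (c - a) (b - d))"] cd by simp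
    have u1: "uniform_limit {c..d} (\<lambda>n x. Y (k n) (x - \<delta> (k n))) g sequentially"
      by (rule uniform_limit_on_subset[OF unif']) (use cd in auto)
    have u2: "uniform_limit {c..d} (\<lambda>n x. (x, Y (k n) (x - \<delta> (k n)))) (\<lambda>x. (x, g x)) sequentially"
      by (rule uniform_limitI, use uniform_limitD[OF u1] in \<open>auto simp: dist_Pair_Pair\<close>)
    have "uniform_limit {c..d} (\<lambda>n x. F (x, Y (k n) (x - \<delta> (k n)))) (\<lambda>x. F (x, g x)) sequentially"
    proof (rule uniform_limit_compose_uniformly_continuous_on[OF u2 ucF])
      show "\<forall>\<^sub>F n in sequentially. \<forall>y\<in>{c..d}. (y, Y (k n) (y - \<delta> (k n))) \<in> {c..d} \<times> {-B..B}"
        using ev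
      proof eventually_elim
        case (elim n)
        have "\<bar>Y (k n) (y - \<delta> (k n))\<bar> \<le> B" if "y \<in> {c..d}" for y
          using lip'[of y "k n"] bd[of y "k n"] elim that cd unfolding B_def by auto
        thus ?case by (auto simp: abs_le_iff minus_le_iff)
      qed
    qed (auto intro: closed_Times)
    moreover have "\<forall>\<^sub>F n in sequentially. \<forall>x\<in>{c..d}.
        F (x, Y (k n) (x - \<delta> (k n))) = H (k n) (x, Y (k n) (x - \<delta> (k n)))"
      using ev
    proof eventually_elim
      case (elim n)
      thus ?case by (auto simp: H_def)
    qed
    ultimately have uH: "uniform_limit {c..d} (\<lambda>n x. H (k n) (x, Y (k n) (x - \<delta> (k n))))
        (\<lambda>x. F (x, g x)) sequentially"
      by (subst (asm) uniform_limit_cong) auto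
    have gint: "g y - g c = integral {c..y} (\<lambda>x. F (x, g x))" if y: "y \<in> {c..d}" for y
    proof -
      have uHy: "uniform_limit {c..y} (\<lambda>n x. H (k n) (x, Y (k n) (x - \<delta> (k n))))
          (\<lambda>x. F (x, g x)) sequentially"
        by (rule uniform_limit_on_subset[OF uH]) (use y in auto)
      have "continuous_on {c..y} (\<lambda>x. H (k n) (x, Y (k n) (x - \<delta> (k n))))" for n
        by (intro continuous_on_compose2[OF H] continuous_intros continuous_on_compose2[OF Y(1)]) auto
      from uniform_limit_integral[OF uHy this] obtain I J where
        I: "\<And>n. ((\<lambda>x. H (k n) (x, Y (k n) (x - \<delta> (k n)))) has_integral I n) {c..y}"
        and J: "((\<lambda>x. F (x, g x)) has_integral J) {c..y}" and IJ: "I \<longlonglongrightarrow> J" by auto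
      have "((\<lambda>x. H (k n) (x, Y (k n) (x - \<delta> (k n)))) has_integral Y (k n) y - Y (k n) c) {c..y}" for n
      proof (rule fundamental_theorem_of_calculus)
        show "(Y (k n) has_vector_derivative H (k n) (x, Y (k n) (x - \<delta> (k n)))) (at x within {c..y})"
          if "x \<in> {c..y}" for x
          using Y(3)[of x "k n"] that y cd
          by (auto simp: has_real_derivative_iff_has_vector_derivative
              intro: has_vector_derivative_within_subset)
      qed (use y in auto)
      hence "I = (\<lambda>n. Y (k n) y - Y (k n) c)" by (intro ext has_integral_unique[OF I])
      moreover have "(\<lambda>n. Y (k n) y - Y (k n) c) \<longlonglongrightarrow> g y - g c"
        using y cd by (intro tendsto_diff tendsto_uniform_limitI[OF unif]) auto
      ultimately have "J = g y - g c" using IJ by (metis LIMSEQ_unique)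
      thus ?thesis using integral_unique[OF J] by simp
    qed
    have "continuous_on {c..d} (\<lambda>x. F (x, g x))"
      by (intro continuous_on_compose2[OF F] continuous_intros continuous_on_subset[OF g]) (use cd in auto)
    hence "((\<lambda>y. integral {c..y} (\<lambda>x. F (x, g x))) has_real_derivative F (x, g x)) (at x within {c..d})"
      by (rule integral_has_real_derivative) (use cd in auto)
    hence "((\<lambda>y. integral {c..y} (\<lambda>x. F (x, g x))) has_real_derivative F (x, g x)) (at x)"
      by (subst (asm) at_within_interior) (use cd in auto)
    hence "((\<lambda>y. g y - g c) has_real_derivative F (x, g x)) (at x)"
      by (rule has_field_derivative_transform_within_open[of _ _ _ "{c<..<d}"])
        (use cd gint in \<open>auto\<close>)
    from DERIV_add[OF this DERIV_const[of "g c"]] show ?thesis by simp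
  qed
  ultimately show thesis using that g by blast
qed

lemma peano_backward:
  fixes F :: "real \<times> real \<Rightarrow> real"
  assumes "a < b" and F: "continuous_on ({a<..<b} \<times> UNIV) F"
    and bound: "\<And>x y. x \<in> {a<..<b} \<Longrightarrow> \<bar>F (x, y)\<bar> \<le> 1"
  obtains Y where "continuous_on {a..b} Y" "Y b = y0"
    "\<And>x. x \<in> {a<..<b} \<Longrightarrow> (Y has_real_derivative F (x, Y x)) (at x)"
proof -
  have "continuous_on ({-b<..<-a} \<times> UNIV) (\<lambda>z. - F (- fst z, snd z))"
    by (intro continuous_intros continuous_on_compose2[OF F]) auto
  moreover have "\<bar>- F (- fst (x, y), snd (x, y))\<bar> \<le> 1" if "x \<in> {-b<..<-a}" for x y
    using bound[of "-x" y] that by auto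
  ultimately obtain W where W: "continuous_on {-b..-a} W" "W (-b) = y0"
    "\<And>x. x \<in> {-b<..<-a} \<Longrightarrow> (W has_real_derivative - F (- fst (x, W x), snd (x, W x))) (at x)"
    using \<open>a < b\<close> peano_bounded_field[of "-b" "-a" "\<lambda>z. - F (- fst z, snd z)" y0] by auto
  show thesis
  proof (rule that[of "\<lambda>x. W (- x)"])
    show "continuous_on {a..b} (\<lambda>x. W (- x))"
      by (intro continuous_on_compose2[OF W(1)] continuous_intros) auto
    fix x assume "x \<in> {a<..<b}"
    hence "(W has_real_derivative - F (x, W (- x))) (at (- x))" using W(3)[of "- x"] by auto
    from DERIV_chain2[where f = W and g = uminus, OF this DERIV_minus[OF DERIV_ident]]
    show "((\<lambda>x. W (- x)) has_real_derivative F (x, W (- x))) (at x)" by simp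
  qed (use W in auto)
qed

section \<open>Graphs as integral curves\<close>

lemma open_interval_antiderivative:
  fixes h :: "real \<Rightarrow> real"
  assumes h: "continuous_on {a<..<b} h"
  obtains \<phi> where "\<And>x. x \<in> {a<..<b} \<Longrightarrow> (\<phi> has_real_derivative h x) (at x)"
proof -
  define c where "c = (a + b) / 2"
  have "((\<lambda>u. LBINT y=c..u. h y) has_real_derivative h x) (at x)" if x: "x \<in> {a<..<b}" for x
  proof -
    define s t where "s = (a + min c x) / 2" and "t = (max c x + b) / 2"
    have st: "a < s" "s < c" "s < x" "c < t" "x < t" "t < b" using x by (auto simp: s_def t_def c_def)
    have "((\<lambda>u. LBINT y=c..u. h y) has_vector_derivative h x) (at x within {s..t})"
      by (rule interval_integral_FTC2) (use st in \<open>auto intro!: continuous_on_subset[OF h]\<close>)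
    thus ?thesis
      by (subst (asm) at_within_interior) (use st in \<open>auto simp: has_real_derivative_iff_has_vector_derivative\<close>)
  qed
  thus thesis using that by blast
qed

text \<open>A solution of the scalar equation $dx_2 / dx_1 = X_2 / X_1$ becomes an integral curve after a
  change of time. The end points, where the field may vanish, are not included, so the time interval
  may be unbounded.\<close>

lemma integral_curve_graph:
  fixes X :: "real \<times> real \<Rightarrow> real \<times> real" and f g :: "real \<Rightarrow> real"
  assumes "a < b"
    and f: "\<And>x. x \<in> {a<..<b} \<Longrightarrow> (f has_real_derivative g x) (at x)"
    and cont: "continuous_on {a<..<b} (\<lambda>x. fst (X (x, f x)))"
    and pos: "\<And>x. x \<in> {a<..<b} \<Longrightarrow> 0 < fst (X (x, f x))"
    and slope: "\<And>x. x \<in> {a<..<b} \<Longrightarrow> snd (X (x, f x)) = g x * fst (X (x, f x))"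
  shows "integral_curve X ((\<lambda>x. (x, f x)) ` {a<..<b})"
proof -
  \<comment> \<open>Along the graph the time satisfies $dt = dx / X_1$.\<close>
  define h where "h = (\<lambda>x. fst (X (x, f x)))"
  have h: "continuous_on {a<..<b} (\<lambda>x. 1 / h x)" "\<And>x. x \<in> {a<..<b} \<Longrightarrow> 0 < h x"
    using cont pos less_irrefl[of 0] unfolding h_def
    by (auto intro!: continuous_intros) (metis greaterThanLessThan_iff less_irrefl)
  obtain \<phi> where \<phi>: "\<And>x. x \<in> {a<..<b} \<Longrightarrow> (\<phi> has_real_derivative 1 / h x) (at x)"
    using open_interval_antiderivative[OF h(1)] by blast
  have \<phi>_less: "\<phi> x < \<phi> y" if "x < y" "x \<in> {a<..<b}" "y \<in> {a<..<b}" for x y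
  proof (rule DERIV_pos_imp_increasing[OF that(1)])
    fix z assume "x \<le> z" "z \<le> y"
    hence z: "z \<in> {a<..<b}" using that by auto
    show "\<exists>d. (\<phi> has_real_derivative d) (at z) \<and> 0 < d"
      using \<phi>[OF z] h(2)[OF z] by (intro exI[of _ "1 / h z"]) simp
  qed
  have inj: "inj_on \<phi> {a<..<b}"
  proof (rule inj_onI)
    fix x y assume "x \<in> {a<..<b}" "y \<in> {a<..<b}" "\<phi> x = \<phi> y"
    thus "x = y" using \<phi>_less[of x y] \<phi>_less[of y x] by (metis less_irrefl linorder_neqE_linordered_idom)
  qed
  have \<phi>_cont: "continuous_on {a<..<b} \<phi>"
    using \<phi> by (meson DERIV_isCont continuous_at_imp_continuous_on)
  define I where "I = \<phi> ` {a<..<b}"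
  have "open I" unfolding I_def
    by (rule injective_into_1d_imp_open_map_UNIV[OF _ \<phi>_cont inj]) auto
  moreover have "is_interval I" unfolding I_def is_interval_connected_1
    by (intro connected_continuous_image \<phi>_cont) auto
  moreover define \<psi> where "\<psi> = the_inv_into {a<..<b} \<phi>"
  have \<psi>: "\<psi> (\<phi> x) = x" if "x \<in> {a<..<b}" for x
    unfolding \<psi>_def by (rule the_inv_into_f_f[OF inj that])
  have \<psi>': "(\<psi> has_real_derivative h x) (at (\<phi> x))" if x: "x \<in> {a<..<b}" for x
  proof -
    define c d where "c = (a + x) / 2" and "d = (x + b) / 2"
    have cd: "a < c" "c < x" "x < d" "d < b" using x by (auto simp: c_def d_def)
    have "isCont \<psi> (\<phi> x)"
    proof (rule isCont_inverse_function2[of c x d])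
      fix z assume "c \<le> z" "z \<le> d"
      hence "z \<in> {a<..<b}" using cd by auto
      thus "\<psi> (\<phi> z) = z" "isCont \<phi> z" using \<psi> \<phi> DERIV_isCont by blast+
    qed (use cd in auto)
    moreover have "\<phi> (\<psi> y) = y" if y: "\<phi> c < y" "y < \<phi> d" for y
    proof -
      have "\<exists>z\<ge>c. z \<le> d \<and> \<phi> z = y"
        using y cd by (intro IVT') (auto intro!: continuous_on_subset[OF \<phi>_cont])
      then obtain z where "c \<le> z" "z \<le> d" "\<phi> z = y" by blast
      thus ?thesis using \<psi>[of z] cd by auto
    qed
    moreover have "\<phi> c < \<phi> x" "\<phi> x < \<phi> d" using \<phi>_less cd by auto
    moreover have "(\<phi> has_real_derivative 1 / h x) (at (\<psi> (\<phi> x)))" using \<phi>[OF x] \<psi>[OF x] by simp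
    moreover have "1 / h x \<noteq> 0" using h(2)[OF x] by simp
    ultimately have "(\<psi> has_real_derivative inverse (1 / h x)) (at (\<phi> x))"
      by (intro DERIV_inverse_function[where f = \<phi> and g = \<psi> and a = "\<phi> c" and b = "\<phi> d"]) auto
    thus ?thesis by simp
  qed
  define \<gamma> where "\<gamma> t = (\<psi> t, f (\<psi> t))" for t
  have "(\<gamma> has_vector_derivative X (\<gamma> t)) (at t)" if t: "t \<in> I" for t
  proof -
    obtain x where x: "x \<in> {a<..<b}" "t = \<phi> x" using t unfolding I_def by blast
    have \<psi>t: "\<psi> t = x" using x \<psi> by simp
    have d1: "(\<psi> has_real_derivative h x) (at t)" using \<psi>'[OF x(1)] x by simp
    have d2: "((\<lambda>t. f (\<psi> t)) has_real_derivative g x * h x) (at t)"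
      by (rule DERIV_chain2[where f = f and g = \<psi>, OF _ d1]) (use f[OF x(1)] \<psi>t in simp)
    have "X (\<gamma> t) = (h x, g x * h x)"
      using slope[OF x(1)] by (simp add: \<gamma>_def \<psi>t h_def prod_eq_iff)
    thus ?thesis unfolding \<gamma>_def[abs_def]
      using has_vector_derivative_Pair[OF d1[unfolded has_real_derivative_iff_has_vector_derivative]
          d2[unfolded has_real_derivative_iff_has_vector_derivative]] by simp
  qed
  moreover have "\<gamma> ` I = (\<lambda>x. (x, f x)) ` {a<..<b}"
    unfolding I_def image_image by (rule image_cong) (auto simp: \<gamma>_def \<psi>)
  ultimately show ?thesis unfolding integral_curve_def by blast
qed

section \<open>The candidate determined by a spine\<close>

lemma concave_on_segment:
  fixes c l :: "_ \<Rightarrow> real" and x y :: "'v :: real_vector"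
  assumes l: "\<And>u v z w. u + v = 1 \<Longrightarrow> l (u *\<^sub>R z + v *\<^sub>R w) = u * l z + v * l w"
    and c: "concave_on {min (l x) (l y)..max (l x) (l y)} c"
    and B: "\<And>z. z \<in> closed_segment x y \<Longrightarrow> B z = c (l z)"
  shows "concave_on (closed_segment x y) B"
  unfolding concave_on_iff
proof (intro conjI ballI allI impI)
  have l_in: "l z \<in> {min (l x) (l y)..max (l x) (l y)}" if z: "z \<in> closed_segment x y" for z
  proof -
    obtain t where t: "0 \<le> t" "t \<le> 1" "z = (1 - t) *\<^sub>R x + t *\<^sub>R y"
      using z by (auto simp: in_segment)
    have lz: "l z = (1 - t) * l x + t * l y" unfolding t(3) by (rule l) simp
    have "(1 - t) * min (l x) (l y) + t * min (l x) (l y) \<le> l z"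
      unfolding lz using t by (intro add_mono mult_left_mono) auto
    moreover have "l z \<le> (1 - t) * max (l x) (l y) + t * max (l x) (l y)"
      unfolding lz using t by (intro add_mono mult_left_mono) auto
    ultimately show ?thesis by (simp add: algebra_simps)
  qed
  fix z w and u v :: real
  assume zw: "z \<in> closed_segment x y" "w \<in> closed_segment x y" and uv: "0 \<le> u" "0 \<le> v" "u + v = 1"
  have "u *\<^sub>R z + v *\<^sub>R w \<in> closed_segment x y"
    using convex_closed_segment zw uv unfolding convex_def by blast
  hence "B (u *\<^sub>R z + v *\<^sub>R w) = c (u * l z + v * l w)" using B l[OF uv(3)] by simp
  moreover have "u * c (l z) + v * c (l w) \<le> c (u * l z + v * l w)"
    using c l_in[OF zw(1)] l_in[OF zw(2)] uv unfolding concave_on_iff real_scaleR_def by blast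
  ultimately show "u * B z + v * B w \<le> B (u *\<^sub>R z + v *\<^sub>R w)" using B zw by simp
qed simp

lemma convex_Omega_R: "convex (Omega_R \<epsilon> a b)"
proof -
  have "Omega_R \<epsilon> a b = {z. inner (1, -1) z \<ge> a} \<inter> {z. inner (1, -1) z \<le> b}
      \<inter> {z. inner (0, 1) z \<le> \<epsilon>} \<inter> {z. inner (0, 1) z \<ge> -\<epsilon>}"
    by (auto simp: Omega_R_def abs_le_iff)
  thus ?thesis by (auto intro!: convex_Int convex_halfspace_le convex_halfspace_ge)
qed

definition slope :: "(real \<Rightarrow> real) \<Rightarrow> (real \<Rightarrow> real) \<Rightarrow> real \<Rightarrow> real \<Rightarrow> real" where
  "slope p1 q1 r b = (p1 r - q1 b) / (r - b)"

text \<open>The abscissa is shifted by \<open>\<epsilon>\<close>, so that \<open>(x, \<tau> x)\<close> runs along the integral curve of the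
  herringbone field. Setting \<open>\<tau>\<close> equal to \<open>\<epsilon>\<close> outside \<open>{ul<..<ur}\<close> makes the right simple foliations on both
  sides part of the same picture. The equation \<open>ode\<close> is
  $(\varepsilon + \tau) D_+ \alpha' = (\varepsilon - \tau) D_- \beta'$ for the functions
  $\alpha = x + \tau$ and $\beta = x - \tau$.\<close>

locale herringbone_spine =
  fixes p q p1 q1 p2 q2 :: "real \<Rightarrow> real" and \<epsilon> u1 u2 ul ur :: real and \<tau> \<tau>' :: "real \<Rightarrow> real"
  assumes \<epsilon>_pos: "0 < \<epsilon>" and u1_ul: "u1 \<le> ul" and ul_ur: "ul < ur" and ur_u2: "ur \<le> u2"
    and p: "\<And>x. (p has_real_derivative p1 x) (at x)" and p1: "\<And>x. (p1 has_real_derivative p2 x) (at x)"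
    and q: "\<And>x. (q has_real_derivative q1 x) (at x)" and q1: "\<And>x. (q1 has_real_derivative q2 x) (at x)"
    and \<tau>_cont: "continuous_on UNIV \<tau>"
    and \<tau>_out: "\<And>x. x \<notin> {ul<..<ur} \<Longrightarrow> \<tau> x = \<epsilon>"
    and \<tau>_in: "\<And>x. x \<in> {ul<..<ur} \<Longrightarrow> 0 < \<tau> x \<and> \<tau> x < \<epsilon>"
    and \<tau>_der: "\<And>x. x \<in> {ul<..<ur} \<Longrightarrow> (\<tau> has_real_derivative \<tau>' x) (at x)"
    and \<tau>'_lt: "\<And>x. x \<in> {ul<..<ur} \<Longrightarrow> \<bar>\<tau>' x\<bar> < 1"
    and p2_cont: "continuous_on UNIV p2" and q2_cont: "continuous_on UNIV q2"
    and \<tau>'_cont: "continuous_on {ul<..<ur} \<tau>'"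
    and D_pos: "\<And>x. x \<in> {ul<..<ur} \<Longrightarrow> 0 < slope p1 q1 (x + \<tau> x) (x - \<tau> x) - p2 (x + \<tau> x)"
    and ode: "\<And>x. x \<in> {ul<..<ur} \<Longrightarrow>
      (1 + \<tau>' x) * (\<epsilon> + \<tau> x) * (slope p1 q1 (x + \<tau> x) (x - \<tau> x) - p2 (x + \<tau> x))
      = (1 - \<tau>' x) * (\<epsilon> - \<tau> x) * (slope p1 q1 (x + \<tau> x) (x - \<tau> x) - q2 (x - \<tau> x))"
    and D_nonneg: "\<And>x. x \<in> {u1..u2} \<Longrightarrow>
        0 \<le> slope p1 q1 (x + \<tau> x) (x - \<tau> x) - p2 (x + \<tau> x) \<and>
        0 \<le> slope p1 q1 (x + \<tau> x) (x - \<tau> x) - q2 (x - \<tau> x)"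
begin

definition "Dp r b = slope p1 q1 r b - p2 r"
definition "Dm r b = slope p1 q1 r b - q2 b"
definition "\<alpha> x = x + \<tau> x"
definition "\<beta> x = x - \<tau> x"
definition "d\<tau> x = (if x \<in> {ul<..<ur} then \<tau>' x else 0)"

lemma ode': "x \<in> {ul<..<ur} \<Longrightarrow>
    (1 + d\<tau> x) * (\<epsilon> + \<tau> x) * Dp (\<alpha> x) (\<beta> x) = (1 - d\<tau> x) * (\<epsilon> - \<tau> x) * Dm (\<alpha> x) (\<beta> x)"
  using ode[of x] by (simp add: Dp_def Dm_def \<alpha>_def \<beta>_def d\<tau>_def)

lemma D_nonneg': "x \<in> {u1..u2} \<Longrightarrow> 0 \<le> Dp (\<alpha> x) (\<beta> x) \<and> 0 \<le> Dm (\<alpha> x) (\<beta> x)"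
  using D_nonneg[of x] by (simp add: Dp_def Dm_def \<alpha>_def \<beta>_def)

lemma \<tau>_bounds: "0 < \<tau> x" "\<tau> x \<le> \<epsilon>"
  using \<tau>_out[of x] \<tau>_in[of x] \<epsilon>_pos by (cases "x \<in> {ul<..<ur}"; force)+

lemma \<tau>_ne: "\<tau> x \<noteq> 0"
  using \<tau>_bounds(1)[of x] by simp

lemma \<alpha>_\<beta>: "\<alpha> x - \<beta> x = 2 * \<tau> x"
  by (simp add: \<alpha>_def \<beta>_def)

lemma \<tau>_deriv:
  assumes "x \<notin> {ul, ur}"
  shows "(\<tau> has_real_derivative d\<tau> x) (at x)"
proof (cases "x \<in> {ul<..<ur}")
  case False
  have "open ({..<ul} \<union> {ur<..})" by (intro open_Un) auto
  hence "(\<tau> has_real_derivative 0) (at x)"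
    by (rule has_field_derivative_transform_within_open[OF DERIV_const[of \<epsilon>]])
      (use assms False in \<open>auto simp: \<tau>_out\<close>)
  moreover have "d\<tau> x = 0" using False by (auto simp: d\<tau>_def)
  ultimately show ?thesis by simp
qed (use \<tau>_der d\<tau>_def in simp)

lemma d\<tau>_lt: "\<bar>d\<tau> x\<bar> < 1"
  using \<tau>'_lt by (simp add: d\<tau>_def)

lemma d\<tau>_pos: "0 < 1 + d\<tau> x" "0 < 1 - d\<tau> x"
  using d\<tau>_lt[of x] by (simp_all add: abs_less_iff)

lemma \<alpha>_deriv: "x \<notin> {ul, ur} \<Longrightarrow> (\<alpha> has_real_derivative 1 + d\<tau> x) (at x)"
  unfolding \<alpha>_def[abs_def] by (intro DERIV_add DERIV_ident \<tau>_deriv)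

lemma \<beta>_deriv: "x \<notin> {ul, ur} \<Longrightarrow> (\<beta> has_real_derivative 1 - d\<tau> x) (at x)"
  unfolding \<beta>_def[abs_def] by (intro DERIV_diff DERIV_ident \<tau>_deriv)

lemma \<alpha>_cont: "continuous_on UNIV \<alpha>" and \<beta>_cont: "continuous_on UNIV \<beta>"
  unfolding \<alpha>_def[abs_def] \<beta>_def[abs_def] by (intro continuous_intros \<tau>_cont)+

lemma \<alpha>_mono: "strict_mono \<alpha>" and \<beta>_mono: "strict_mono \<beta>"
proof -
  show "strict_mono \<alpha>"
    using \<alpha>_deriv d\<tau>_pos by (intro strict_mono_off_finite_set[OF \<alpha>_cont, of "{ul, ur}"]) blast+
  show "strict_mono \<beta>"
    using \<beta>_deriv d\<tau>_pos by (intro strict_mono_off_finite_set[OF \<beta>_cont, of "{ul, ur}"]) blast+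
qed

lemma \<alpha>_surj: "surj \<alpha>" and \<beta>_surj: "surj \<beta>"
proof -
  show "surj \<alpha>"
    by (rule surj_of_translation_outside[OF \<alpha>_cont, of ul ur \<epsilon>])
      (use ul_ur \<tau>_out in \<open>simp_all add: \<alpha>_def\<close>)
  show "surj \<beta>"
    by (rule surj_of_translation_outside[OF \<beta>_cont, of ul ur "-\<epsilon>"])
      (use ul_ur \<tau>_out in \<open>simp_all add: \<beta>_def\<close>)
qed

definition "ainv = inv \<alpha>"
definition "binv = inv \<beta>"

lemma ainv: "\<alpha> (ainv r) = r" "ainv (\<alpha> x) = x" and binv: "\<beta> (binv b) = b" "binv (\<beta> x) = x"
  using \<alpha>_surj \<beta>_surj \<alpha>_mono \<beta>_mono
  by (simp_all add: ainv_def binv_def surj_f_inv_f strict_mono_imp_inj_on)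

lemmas ainv_cont = homeomorphism_inverse(1)[OF \<alpha>_mono \<alpha>_cont \<alpha>_surj, folded ainv_def]
lemmas binv_cont = homeomorphism_inverse(1)[OF \<beta>_mono \<beta>_cont \<beta>_surj, folded binv_def]

lemma ainv_deriv:
  "ainv r \<notin> {ul, ur} \<Longrightarrow> (ainv has_real_derivative 1 / (1 + d\<tau> (ainv r))) (at r)"
  unfolding ainv_def using \<alpha>_deriv d\<tau>_lt[of "inv \<alpha> r"]
  by (intro homeomorphism_inverse(2)[OF \<alpha>_mono \<alpha>_cont \<alpha>_surj]) auto

lemma binv_deriv:
  "binv b \<notin> {ul, ur} \<Longrightarrow> (binv has_real_derivative 1 / (1 - d\<tau> (binv b))) (at b)"
  unfolding binv_def using \<beta>_deriv d\<tau>_lt[of "inv \<beta> b"]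
  by (intro homeomorphism_inverse(2)[OF \<beta>_mono \<beta>_cont \<beta>_surj]) auto

text \<open>The quotient rule, arranged so that the second derivatives of the boundary data only enter through
  $D_+$ and $D_-$; this makes the differential equation of the spine applicable.\<close>

lemma slope_deriv:
  assumes a: "(a has_real_derivative a') (at t)" and b: "(b has_real_derivative b') (at t)"
    and ne: "a t \<noteq> b t"
  shows "((\<lambda>t. slope p1 q1 (a t) (b t)) has_real_derivative
    (Dm (a t) (b t) * b' - Dp (a t) (b t) * a') / (a t - b t)) (at t)"
proof -
  have "((\<lambda>t. slope p1 q1 (a t) (b t)) has_real_derivative
    ((p2 (a t) * a' - q2 (b t) * b') * (a t - b t) - (p1 (a t) - q1 (b t)) * (a' - b'))
      / ((a t - b t) * (a t - b t))) (at t)"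
    unfolding slope_def
    by (intro DERIV_divide DERIV_diff DERIV_chain2[OF p1] DERIV_chain2[OF q1] a b) (use ne in simp)
  also have "p1 (a t) - q1 (b t) = slope p1 q1 (a t) (b t) * (a t - b t)"
    using ne by (simp add: slope_def)
  also have "(p2 (a t) * a' - q2 (b t) * b') * (a t - b t)
      - slope p1 q1 (a t) (b t) * (a t - b t) * (a' - b')
    = (Dm (a t) (b t) * b' - Dp (a t) (b t) * a') * (a t - b t)"
    unfolding Dm_def Dp_def by (simp add: algebra_simps)
  finally have "((\<lambda>t. slope p1 q1 (a t) (b t)) has_real_derivative
    ((Dm (a t) (b t) * b' - Dp (a t) (b t) * a') * (a t - b t))
      / ((a t - b t) * (a t - b t))) (at t)" .
  also have "((Dm (a t) (b t) * b' - Dp (a t) (b t) * a') * (a t - b t)) / ((a t - b t) * (a t - b t))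
    = (Dm (a t) (b t) * b' - Dp (a t) (b t) * a') / (a t - b t)"
    using ne by simp
  finally show ?thesis .
qed

text \<open>The slopes \<open>m\<close> and \<open>n\<close> of the candidate along the two ribs at a spine point, with respect to
  the distance from the boundary in the second coordinate. Their values are dictated by \<open>spine_value\<close>.\<close>

definition "E x = (\<epsilon> + \<tau> x) * p1 (\<alpha> x) - (\<epsilon> - \<tau> x) * q1 (\<beta> x)"
definition "m x = (1 / (2 * \<tau> x) - 1 / (2 * \<epsilon>)) * E x + (p (\<alpha> x) - q (\<beta> x)) / (2 * \<epsilon>)"
definition "n x = (1 / (2 * \<tau> x) + 1 / (2 * \<epsilon>)) * E x - (p (\<alpha> x) - q (\<beta> x)) / (2 * \<epsilon>)"

lemma E_deriv:
  assumes "x \<in> {ul<..<ur}"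
  shows "(E has_real_derivative
    d\<tau> x * (p1 (\<alpha> x) + q1 (\<beta> x)) + 2 * slope p1 q1 (\<alpha> x) (\<beta> x) * (\<tau> x + \<epsilon> * d\<tau> x)) (at x)"
proof -
  have "x \<notin> {ul, ur}" using assms by auto
  note D = \<tau>_deriv[OF this] \<alpha>_deriv[OF this] \<beta>_deriv[OF this]
  have "(E has_real_derivative
    (0 + d\<tau> x) * p1 (\<alpha> x) + (p2 (\<alpha> x) * (1 + d\<tau> x)) * (\<epsilon> + \<tau> x)
    - ((0 - d\<tau> x) * q1 (\<beta> x) + (q2 (\<beta> x) * (1 - d\<tau> x)) * (\<epsilon> - \<tau> x))) (at x)"
    unfolding E_def[abs_def]
    by (intro DERIV_diff DERIV_mult DERIV_add DERIV_const DERIV_chain2[OF p1] DERIV_chain2[OF q1] D)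
  moreover have "(\<epsilon> + \<tau> x) * (1 + d\<tau> x) * p2 (\<alpha> x) - (\<epsilon> - \<tau> x) * (1 - d\<tau> x) * q2 (\<beta> x)
    = slope p1 q1 (\<alpha> x) (\<beta> x) * ((\<epsilon> + \<tau> x) * (1 + d\<tau> x) - (\<epsilon> - \<tau> x) * (1 - d\<tau> x))"
    using ode'[OF assms] unfolding Dp_def Dm_def by (simp add: algebra_simps)
  hence "(0 + d\<tau> x) * p1 (\<alpha> x) + (p2 (\<alpha> x) * (1 + d\<tau> x)) * (\<epsilon> + \<tau> x)
    - ((0 - d\<tau> x) * q1 (\<beta> x) + (q2 (\<beta> x) * (1 - d\<tau> x)) * (\<epsilon> - \<tau> x))
    = d\<tau> x * (p1 (\<alpha> x) + q1 (\<beta> x)) + 2 * slope p1 q1 (\<alpha> x) (\<beta> x) * (\<tau> x + \<epsilon> * d\<tau> x)"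
    by (simp add: algebra_simps)
  ultimately show ?thesis by simp
qed

lemma p1_q1: "p1 (\<alpha> x) - q1 (\<beta> x) = 2 * slope p1 q1 (\<alpha> x) (\<beta> x) * \<tau> x"
  using \<alpha>_\<beta>[of x] \<tau>_bounds[of x] by (simp add: slope_def)

lemma E_eq: "E x = \<tau> x * (2 * \<epsilon> * slope p1 q1 (\<alpha> x) (\<beta> x) + p1 (\<alpha> x) + q1 (\<beta> x))"
proof -
  have "E x = \<epsilon> * (p1 (\<alpha> x) - q1 (\<beta> x)) + \<tau> x * (p1 (\<alpha> x) + q1 (\<beta> x))"
    by (simp add: E_def algebra_simps)
  thus ?thesis unfolding p1_q1 by (simp add: algebra_simps)
qed

text \<open>In the derivative of the prescribed slopes, the differential equation of the spine eliminates the
  second derivatives of the boundary data; what remains is the difference quotient.\<close>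

lemma m_n_deriv:
  assumes "x \<in> {ul<..<ur}"
  shows "(m has_real_derivative slope p1 q1 (\<alpha> x) (\<beta> x) * (1 - d\<tau> x)) (at x)"
    and "(n has_real_derivative slope p1 q1 (\<alpha> x) (\<beta> x) * (1 + d\<tau> x)) (at x)"
proof -
  have x: "x \<notin> {ul, ur}" using assms by auto
  define s P where "s = slope p1 q1 (\<alpha> x) (\<beta> x)" and "P = p1 (\<alpha> x) + q1 (\<beta> x)"
  define e where "e = d\<tau> x * P + 2 * s * (\<tau> x + \<epsilon> * d\<tau> x)"
  have nz: "\<tau> x \<noteq> 0" "\<epsilon> \<noteq> 0" using \<tau>_bounds[of x] \<epsilon>_pos by auto
  have E': "(E has_real_derivative e) (at x)"
    unfolding e_def s_def P_def by (rule E_deriv[OF assms])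
  have Ex: "E x = \<tau> x * (2 * \<epsilon> * s + P)" unfolding E_eq s_def P_def by (simp add: algebra_simps)
  have k': "((\<lambda>x. 1 / (2 * \<tau> x) + c) has_real_derivative - d\<tau> x / (2 * (\<tau> x)\<^sup>2)) (at x)" for c
    using nz by (auto intro!: derivative_eq_intros \<tau>_deriv[OF x] simp: power2_eq_square field_simps)
  have pq: "((\<lambda>x. (p (\<alpha> x) - q (\<beta> x)) / (2 * \<epsilon>)) has_real_derivative
      (2 * s * \<tau> x + d\<tau> x * P) / (2 * \<epsilon>)) (at x)"
  proof -
    have "((\<lambda>x. (p (\<alpha> x) - q (\<beta> x)) / (2 * \<epsilon>)) has_real_derivative
      (p1 (\<alpha> x) * (1 + d\<tau> x) - q1 (\<beta> x) * (1 - d\<tau> x)) / (2 * \<epsilon>)) (at x)"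
      by (intro DERIV_cdivide DERIV_diff DERIV_chain2[OF p] DERIV_chain2[OF q] \<alpha>_deriv[OF x] \<beta>_deriv[OF x])
    also have "p1 (\<alpha> x) * (1 + d\<tau> x) - q1 (\<beta> x) * (1 - d\<tau> x)
        = (p1 (\<alpha> x) - q1 (\<beta> x)) + d\<tau> x * P"
      by (simp add: P_def algebra_simps)
    finally show ?thesis unfolding p1_q1 s_def .
  qed
  have "(m has_real_derivative - d\<tau> x / (2 * (\<tau> x)\<^sup>2) * E x + e * (1 / (2 * \<tau> x) + - (1 / (2 * \<epsilon>)))
      + (2 * s * \<tau> x + d\<tau> x * P) / (2 * \<epsilon>)) (at x)"
    using DERIV_add[OF DERIV_mult[OF k'[of "- (1 / (2 * \<epsilon>))"] E'] pq] unfolding m_def[abs_def] by simp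
  also have "- d\<tau> x / (2 * (\<tau> x)\<^sup>2) * E x + e * (1 / (2 * \<tau> x) + - (1 / (2 * \<epsilon>)))
      + (2 * s * \<tau> x + d\<tau> x * P) / (2 * \<epsilon>) = s * (1 - d\<tau> x)"
    unfolding Ex e_def using nz by (simp add: field_simps power2_eq_square)
  finally show "(m has_real_derivative slope p1 q1 (\<alpha> x) (\<beta> x) * (1 - d\<tau> x)) (at x)"
    by (simp add: s_def)
  have "(n has_real_derivative - d\<tau> x / (2 * (\<tau> x)\<^sup>2) * E x + e * (1 / (2 * \<tau> x) + 1 / (2 * \<epsilon>))
      - (2 * s * \<tau> x + d\<tau> x * P) / (2 * \<epsilon>)) (at x)"
    unfolding n_def[abs_def] by (rule DERIV_diff[OF DERIV_mult[OF k' E'] pq])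
  also have "- d\<tau> x / (2 * (\<tau> x)\<^sup>2) * E x + e * (1 / (2 * \<tau> x) + 1 / (2 * \<epsilon>))
      - (2 * s * \<tau> x + d\<tau> x * P) / (2 * \<epsilon>) = s * (1 + d\<tau> x)"
    unfolding Ex e_def using nz by (simp add: field_simps power2_eq_square)
  finally show "(n has_real_derivative slope p1 q1 (\<alpha> x) (\<beta> x) * (1 + d\<tau> x)) (at x)"
    by (simp add: s_def)
qed

text \<open>Outside the herringbone, where \<open>\<tau> = \<epsilon>\<close>, the slope is that of the right simple candidate and
  satisfies the same equation. This fails for the upper ribs, which degenerate to points there.\<close>

lemma m_deriv:
  assumes "x \<notin> {ul, ur}"
  shows "(m has_real_derivative slope p1 q1 (\<alpha> x) (\<beta> x) * (1 - d\<tau> x)) (at x)"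
proof (cases "x \<in> {ul<..<ur}")
  case False
  define U where "U = {..<ul} \<union> {ur<..}"
  have U: "open U" "x \<in> U" using assms False by (auto simp: U_def)
  have "((\<lambda>x. (p (x + \<epsilon>) - q (x - \<epsilon>)) / (2 * \<epsilon>)) has_real_derivative
      (p1 (x + \<epsilon>) * 1 - q1 (x - \<epsilon>) * 1) / (2 * \<epsilon>)) (at x)"
    by (intro DERIV_cdivide DERIV_diff DERIV_chain2[OF p] DERIV_chain2[OF q])
      (auto intro!: derivative_eq_intros)
  hence "(m has_real_derivative (p1 (x + \<epsilon>) * 1 - q1 (x - \<epsilon>) * 1) / (2 * \<epsilon>)) (at x)"
    by (rule has_field_derivative_transform_within_open[OF _ U])
      (auto simp: U_def m_def \<alpha>_def \<beta>_def \<tau>_out)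
  moreover have "d\<tau> x = 0" "\<tau> x = \<epsilon>" using False by (auto simp: d\<tau>_def intro: \<tau>_out)
  ultimately show ?thesis by (simp add: slope_def \<alpha>_def \<beta>_def)
qed (rule m_n_deriv)

lemma m_cont: "continuous_on UNIV m" and n_cont: "continuous_on UNIV n"
proof -
  have "continuous_on UNIV p" "continuous_on UNIV p1" "continuous_on UNIV q" "continuous_on UNIV q1"
    using p p1 q q1 by (meson DERIV_continuous_on DERIV_subset subset_UNIV)+
  note [continuous_intros] = this[THEN continuous_on_compose2] \<alpha>_cont \<beta>_cont \<tau>_cont
  have "\<tau> x \<noteq> 0" "\<epsilon> \<noteq> 0" for x using \<tau>_bounds[of x] \<epsilon>_pos by auto
  thus "continuous_on UNIV m" "continuous_on UNIV n"
    unfolding m_def[abs_def] n_def[abs_def] E_def[abs_def] by (intro continuous_intros; simp)+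
qed

text \<open>From now on the ribs are labelled by their end points on the boundary: \<open>A b\<close> is the upper
  label of the spine point with the lower label \<open>b\<close>.\<close>

definition "A b = \<alpha> (binv b)"
definition "\<rho> b = slope p1 q1 (A b) b"
definition "M b = m (binv b)"
definition "al = ul + \<epsilon>"
definition "ar = ur + \<epsilon>"
definition "bl = ul - \<epsilon>"
definition "br = ur - \<epsilon>"

lemma ends: "\<alpha> ul = al" "\<alpha> ur = ar" "\<beta> ul = bl" "\<beta> ur = br"
  by (simp_all add: \<alpha>_def \<beta>_def \<tau>_out al_def ar_def bl_def br_def)

lemma binv_less: "binv b < x \<longleftrightarrow> b < \<beta> x" "x < binv b \<longleftrightarrow> \<beta> x < b"
  "binv b \<le> x \<longleftrightarrow> b \<le> \<beta> x" "x \<le> binv b \<longleftrightarrow> \<beta> x \<le> b" "binv b = x \<longleftrightarrow> b = \<beta> x"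
  using strict_mono_less[OF \<beta>_mono, of "binv b" x] strict_mono_less[OF \<beta>_mono, of x "binv b"]
    strict_mono_less_eq[OF \<beta>_mono, of "binv b" x] strict_mono_less_eq[OF \<beta>_mono, of x "binv b"]
    strict_mono_eq[OF \<beta>_mono, of "binv b" x]
  by (simp_all add: binv)

lemma ainv_less: "ainv b < x \<longleftrightarrow> b < \<alpha> x" "x < ainv b \<longleftrightarrow> \<alpha> x < b"
  "ainv b \<le> x \<longleftrightarrow> b \<le> \<alpha> x" "x \<le> ainv b \<longleftrightarrow> \<alpha> x \<le> b" "ainv b = x \<longleftrightarrow> b = \<alpha> x"
  using strict_mono_less[OF \<alpha>_mono, of "ainv b" x] strict_mono_less[OF \<alpha>_mono, of x "ainv b"]
    strict_mono_less_eq[OF \<alpha>_mono, of "ainv b" x] strict_mono_less_eq[OF \<alpha>_mono, of x "ainv b"]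
    strict_mono_eq[OF \<alpha>_mono, of "ainv b" x]
  by (simp_all add: ainv)

lemma A_cont: "continuous_on UNIV A"
  unfolding A_def[abs_def] by (intro continuous_on_compose2[OF \<alpha>_cont] binv_cont) auto

lemma A_minus: "A b - b = 2 * \<tau> (binv b)"
  using \<alpha>_\<beta>[of "binv b"] by (simp add: A_def binv)

lemma A_gt: "b < A b" using A_minus[of b] \<tau>_bounds[of "binv b"] by simp

lemma A_ne: "A b \<noteq> b" "A b - b \<noteq> 0" using A_gt[of b] by simp_all

lemma A_out: "b \<notin> {bl<..<br} \<Longrightarrow> A b = b + 2 * \<epsilon>"
  using A_minus[of b] \<tau>_out[of "binv b"] by (auto simp: binv_less ends)

lemma A_le: "A b \<le> b + 2 * \<epsilon>"
  using A_minus[of b] \<tau>_bounds[of "binv b"] by simp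

lemma p1_cont: "continuous_on S p1" and q1_cont: "continuous_on S q1"
  using p1 q1 by (meson DERIV_continuous_on DERIV_subset subset_UNIV)+

lemma \<rho>_cont: "continuous_on UNIV \<rho>"
  unfolding \<rho>_def[abs_def] slope_def
  by (intro continuous_intros continuous_on_compose2[OF p1_cont[of UNIV] A_cont] q1_cont A_cont)
    (use A_ne in auto)

lemma M_cont: "continuous_on UNIV M"
  unfolding M_def[abs_def] by (intro continuous_on_compose2[OF m_cont] binv_cont) auto

text \<open>The two exceptional points are the lower ends of the ribs that bound the herringbone.\<close>

lemma M_deriv: "(M has_real_derivative \<rho> b) (at b)"
proof (rule derivative_off_finite_set[where f = M and g = \<rho>, OF M_cont \<rho>_cont, of "{bl, br}"])
  fix b assume "b \<notin> {bl, br}"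
  hence x: "binv b \<notin> {ul, ur}" by (auto simp: binv_less ends)
  have "(M has_real_derivative slope p1 q1 (\<alpha> (binv b)) (\<beta> (binv b)) * (1 - d\<tau> (binv b))
      * (1 / (1 - d\<tau> (binv b)))) (at b)"
    unfolding M_def[abs_def] by (intro DERIV_chain2[where f = m and g = binv, OF m_deriv[OF x]] binv_deriv[OF x])
  thus "(M has_real_derivative \<rho> b) (at b)"
    using d\<tau>_pos[of "binv b"] by (simp add: \<rho>_def A_def binv)
qed simp

text \<open>The inequality is the source of concavity across the lower ribs. Inside the herringbone it is an
  equality, outside it there is the surplus $D_+ \ge 0$.\<close>

lemma \<rho>_deriv:
  assumes b: "b \<notin> {bl, br}" and "binv b \<in> {u1..u2}"
  obtains d where "(\<rho> has_real_derivative d) (at b)"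
    "d * (\<epsilon> + \<tau> (binv b)) \<le> Dm (A b) b"
proof -
  define x where "x = binv b"
  have x: "x \<notin> {ul, ur}" using b by (auto simp: binv_less ends x_def)
  have b_x: "b = \<beta> x" by (simp add: x_def binv)
  have A': "(A has_real_derivative (1 + d\<tau> x) * (1 / (1 - d\<tau> x))) (at b)"
    unfolding A_def[abs_def] x_def
    by (intro DERIV_chain2[OF \<alpha>_deriv] binv_deriv) (use x in \<open>simp_all add: x_def\<close>)
  define d where "d = (Dm (A b) b * 1 - Dp (A b) b * ((1 + d\<tau> x) * (1 / (1 - d\<tau> x)))) / (A b - b)"
  have "(\<rho> has_real_derivative d) (at b)"
    unfolding \<rho>_def[abs_def] d_def using A_ne(1)[of b]
    by (intro slope_deriv[where b = "\<lambda>b. b"] A' DERIV_ident) auto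
  moreover have "d * (\<epsilon> + \<tau> x) \<le> Dm (A b) b"
  proof -
    have A: "A b - b = 2 * \<tau> x" "A b = \<alpha> x"
      using A_minus[of b] by (simp_all add: x_def A_def)
    have nz: "0 < \<tau> x" "0 < 1 - d\<tau> x" using \<tau>_bounds d\<tau>_pos by auto
    show ?thesis
    proof (cases "x \<in> {ul<..<ur}")
      case True
      have "Dp (\<alpha> x) b * ((1 + d\<tau> x) * (1 / (1 - d\<tau> x))) * (\<epsilon> + \<tau> x)
          = ((1 + d\<tau> x) * (\<epsilon> + \<tau> x) * Dp (\<alpha> x) b) / (1 - d\<tau> x)" by simp
      also have "\<dots> = (\<epsilon> - \<tau> x) * Dm (\<alpha> x) b"
        using ode'[OF True] nz by (simp add: b_x)
      finally have Z: "Dp (\<alpha> x) b * ((1 + d\<tau> x) * (1 / (1 - d\<tau> x))) * (\<epsilon> + \<tau> x)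
          = (\<epsilon> - \<tau> x) * Dm (\<alpha> x) b" .
      have "(Dm (A b) b * 1 - Dp (A b) b * ((1 + d\<tau> x) * (1 / (1 - d\<tau> x)))) * (\<epsilon> + \<tau> x)
          = Dm (A b) b * (A b - b)"
        unfolding A(1) unfolding A(2) left_diff_distrib Z by (simp add: algebra_simps)
      hence "d * (\<epsilon> + \<tau> x) = Dm (A b) b"
        unfolding d_def times_divide_eq_left using A_ne[of b] by simp
      thus ?thesis by simp
    next
      case False
      hence eqs: "d\<tau> x = 0" "\<tau> x = \<epsilon>" by (auto simp: d\<tau>_def intro: \<tau>_out)
      have "d * (\<epsilon> + \<tau> x) = (Dm (A b) b - Dp (A b) b) / (2 * \<epsilon>) * (\<epsilon> + \<epsilon>)"
        unfolding d_def A(1) eqs by simp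
      hence "d * (\<epsilon> + \<tau> x) = Dm (A b) b - Dp (A b) b"
        using \<epsilon>_pos by (simp only: times_divide_eq_left mult_2[symmetric]) simp
      moreover have "0 \<le> Dp (A b) b"
      proof -
        have "x \<in> {u1..u2}" using assms(2) by (simp add: x_def)
        thus ?thesis using D_nonneg'[of x] unfolding A(2) b_x[symmetric] by blast
      qed
      ultimately show ?thesis by simp
    qed
  qed
  ultimately show thesis using that by (simp add: x_def)
qed

text \<open>The labels are clamped because the upper ribs only exist for \<open>r\<close> between \<open>al\<close> and \<open>ar\<close>.\<close>

definition "\<sigma> r = slope p1 q1 (max al (min ar r)) (\<beta> (ainv (max al (min ar r))))"

lemma \<beta>_ainv: "r - \<beta> (ainv r) = 2 * \<tau> (ainv r)"
  using \<alpha>_\<beta>[of "ainv r"] by (simp add: ainv)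

lemma \<sigma>_cont: "continuous_on S \<sigma>"
proof -
  have "continuous_on UNIV (\<lambda>r. slope p1 q1 r (\<beta> (ainv r)))"
    unfolding slope_def
    by (intro continuous_intros continuous_on_compose2[OF q1_cont[of UNIV]]
        continuous_on_compose2[OF \<beta>_cont] ainv_cont p1_cont) (auto simp: \<beta>_ainv \<tau>_ne)
  thus ?thesis unfolding \<sigma>_def[abs_def]
    by (rule continuous_on_compose2) (auto intro!: continuous_intros)
qed

lemma ex_N:
  "\<exists>N. (\<forall>r. (N has_real_derivative \<sigma> r) (at r)) \<and> (\<forall>r\<in>{al..ar}. N r = n (ainv r))"
proof -
  have nd: "((\<lambda>r. n (ainv r)) has_real_derivative \<sigma> r) (at r)" if r: "r \<in> {al<..<ar}" for r
  proof -
    have x: "ainv r \<in> {ul<..<ur}" using r by (auto simp: ainv_less ends)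
    have "((\<lambda>r. n (ainv r)) has_real_derivative
      slope p1 q1 (\<alpha> (ainv r)) (\<beta> (ainv r)) * (1 + d\<tau> (ainv r)) * (1 / (1 + d\<tau> (ainv r)))) (at r)"
      by (intro DERIV_chain2[where f = n and g = ainv, OF m_n_deriv(2)[OF x]] ainv_deriv) (use x in auto)
    thus ?thesis using d\<tau>_pos[of "ainv r"] r by (simp add: \<sigma>_def ainv)
  qed
  have "al \<le> ar" using ul_ur by (simp add: al_def ar_def)
  obtain F where F: "\<And>r. (F has_real_derivative \<sigma> (max al (min ar r))) (at r)"
    "\<And>r. r \<in> {al..ar} \<Longrightarrow> F r = n (ainv r)"
    using extend_antiderivative[OF \<open>al \<le> ar\<close> _ \<sigma>_cont nd]
      continuous_on_subset[OF continuous_on_compose2[OF n_cont ainv_cont subset_UNIV] subset_UNIV, of "{al..ar}"]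
    by blast
  have "\<sigma> (max al (min ar r)) = \<sigma> r" for r using \<open>al \<le> ar\<close> by (simp add: \<sigma>_def)
  thus ?thesis using F by (intro exI[of _ F]) simp
qed

text \<open>The slope on the upper ribs, continued to the whole line so that the function \<open>C_up\<close> is
  smooth on the whole plane.\<close>

definition "N = (SOME N. (\<forall>r. (N has_real_derivative \<sigma> r) (at r)) \<and> (\<forall>r\<in>{al..ar}. N r = n (ainv r)))"

lemma N_deriv: "(N has_real_derivative \<sigma> r) (at r)" and N_eq: "r \<in> {al..ar} \<Longrightarrow> N r = n (ainv r)"
  using someI_ex[OF ex_N] unfolding N_def[symmetric] by auto

lemma \<sigma>_deriv:
  assumes r: "r \<in> {al<..<ar}"
  obtains d where "(\<sigma> has_real_derivative d) (at r)"
    "d * (\<epsilon> - \<tau> (ainv r)) = Dp r (\<beta> (ainv r))" "0 \<le> Dp r (\<beta> (ainv r))" "\<sigma> r = slope p1 q1 r (\<beta> (ainv r))"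
proof -
  define x where "x = ainv r"
  have x: "x \<in> {ul<..<ur}" using r by (auto simp: x_def ainv_less ends)
  have r_x: "r = \<alpha> x" by (simp add: x_def ainv)
  have B': "((\<lambda>r. \<beta> (ainv r)) has_real_derivative (1 - d\<tau> x) * (1 / (1 + d\<tau> x))) (at r)"
    unfolding x_def by (intro DERIV_chain2[OF \<beta>_deriv] ainv_deriv) (use x in \<open>auto simp: x_def\<close>)
  define d where "d = (Dm r (\<beta> x) * ((1 - d\<tau> x) * (1 / (1 + d\<tau> x))) - Dp r (\<beta> x) * 1) / (r - \<beta> x)"
  have ne: "0 < \<tau> x" "r - \<beta> x = 2 * \<tau> x" "0 < 1 + d\<tau> x"
    using \<tau>_bounds d\<tau>_pos \<beta>_ainv by (auto simp: x_def)
  have "((\<lambda>r. slope p1 q1 r (\<beta> (ainv r))) has_real_derivative d) (at r)"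
    unfolding d_def x_def
    by (intro slope_deriv[where a = "\<lambda>r. r"] B'[unfolded x_def] DERIV_ident) (use ne in \<open>auto simp: x_def\<close>)
  hence "(\<sigma> has_real_derivative d) (at r)"
    by (rule has_field_derivative_transform_within_open[of _ _ _ "{al<..<ar}"])
      (use r in \<open>auto simp: \<sigma>_def\<close>)
  moreover have "d * (\<epsilon> - \<tau> x) = Dp r (\<beta> x)"
  proof -
    have "Dm r (\<beta> x) * ((1 - d\<tau> x) * (1 / (1 + d\<tau> x))) * (\<epsilon> - \<tau> x)
        = ((1 - d\<tau> x) * (\<epsilon> - \<tau> x) * Dm r (\<beta> x)) / (1 + d\<tau> x)" by simp
    also have "\<dots> = (\<epsilon> + \<tau> x) * Dp r (\<beta> x)"
      using ode'[OF x, symmetric] ne by (simp add: r_x)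
    finally have "(Dm r (\<beta> x) * ((1 - d\<tau> x) * (1 / (1 + d\<tau> x))) - Dp r (\<beta> x) * 1) * (\<epsilon> - \<tau> x)
        = Dp r (\<beta> x) * (r - \<beta> x)" unfolding ne by (simp add: algebra_simps)
    thus ?thesis unfolding d_def times_divide_eq_left using ne by simp
  qed
  moreover have "0 \<le> Dp r (\<beta> x)"
    using D_nonneg'[of x] x u1_ul ur_u2 by (simp add: r_x)
  ultimately show thesis using that r by (simp add: x_def \<sigma>_def)
qed

text \<open>The functions that are affine on the lower and on the upper ribs, and their gradients, in the
  coordinates \<open>(r, b)\<close>.\<close>

definition "C_lo z = q (snd z) + M (snd z) * ((fst z - snd z + 2 * \<epsilon>) / 2)"
definition "C_up z = p (fst z) + N (fst z) * ((2 * \<epsilon> - fst z + snd z) / 2)"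
definition "G_lo z = (M (snd z) / 2,
  q1 (snd z) + \<rho> (snd z) * ((fst z - snd z + 2 * \<epsilon>) / 2) - M (snd z) / 2)"
definition "G_up z = (p1 (fst z) + \<sigma> (fst z) * ((2 * \<epsilon> - fst z + snd z) / 2) - N (fst z) / 2,
  N (fst z) / 2)"

lemma C_lo_deriv: "(C_lo has_derivative (\<lambda>h. G_lo z \<bullet> h)) (at z within T)"
proof -
  have "(C_lo has_derivative (\<lambda>h. snd h * q1 (snd z) + (M (snd z) * ((fst h - snd h + 0) / 2)
      + (snd h * \<rho> (snd z)) * ((fst z - snd z + 2 * \<epsilon>) / 2)))) (at z within T)"
    unfolding C_lo_def[abs_def]
    by (intro has_derivative_add has_derivative_mult bounded_linear.has_derivative[OF bounded_linear_divide[of 2]] has_derivative_diff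
        DERIV_compose_FDERIV[OF q] DERIV_compose_FDERIV[OF M_deriv] has_derivative_const
        has_derivative_fst has_derivative_snd has_derivative_ident)
  thus ?thesis
    by (rule has_derivative_eq_rhs)
      (auto simp: G_lo_def inner_prod_def fun_eq_iff algebra_simps add_divide_distrib diff_divide_distrib)
qed

lemma C_up_deriv: "(C_up has_derivative (\<lambda>h. G_up z \<bullet> h)) (at z within T)"
proof -
  have "(C_up has_derivative (\<lambda>h. fst h * p1 (fst z) + (N (fst z) * ((0 - fst h + snd h) / 2)
      + (fst h * \<sigma> (fst z)) * ((2 * \<epsilon> - fst z + snd z) / 2)))) (at z within T)"
    unfolding C_up_def[abs_def]
    by (intro has_derivative_add has_derivative_mult bounded_linear.has_derivative[OF bounded_linear_divide[of 2]] has_derivative_diff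
        DERIV_compose_FDERIV[OF p] DERIV_compose_FDERIV[OF N_deriv] has_derivative_const
        has_derivative_fst has_derivative_snd has_derivative_ident)
  thus ?thesis
    by (rule has_derivative_eq_rhs)
      (auto simp: G_up_def inner_prod_def fun_eq_iff algebra_simps add_divide_distrib diff_divide_distrib)
qed

lemma N_cont: "continuous_on UNIV N"
  using N_deriv by (meson DERIV_continuous_on DERIV_subset subset_UNIV)

lemma G_lo_cont: "continuous_on T G_lo"
  unfolding G_lo_def[abs_def]
  by (intro continuous_intros continuous_on_compose2[OF M_cont] continuous_on_compose2[OF \<rho>_cont]
      continuous_on_compose2[OF q1_cont[of UNIV]]) auto

lemma G_up_cont: "continuous_on T G_up"
  unfolding G_up_def[abs_def]
  by (intro continuous_intros continuous_on_compose2[OF N_cont] continuous_on_compose2[OF \<sigma>_cont[of UNIV]]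
      continuous_on_compose2[OF p1_cont[of UNIV]]) auto

text \<open>This identity matches the gradients on the spine, the next one the values.\<close>

lemma m_n_sum: "m x + n x = 2 * \<epsilon> * slope p1 q1 (\<alpha> x) (\<beta> x) + p1 (\<alpha> x) + q1 (\<beta> x)"
proof -
  have "m x + n x = E x / \<tau> x" by (simp add: m_def n_def algebra_simps)
  thus ?thesis using \<tau>_ne[of x] by (simp add: E_eq)
qed

lemma m_n_diff: "q (\<beta> x) + m x * (\<epsilon> + \<tau> x) = p (\<alpha> x) + n x * (\<epsilon> - \<tau> x)"
proof -
  have "m x * (\<epsilon> + \<tau> x) - n x * (\<epsilon> - \<tau> x) = p (\<alpha> x) - q (\<beta> x)"
    unfolding m_def n_def using \<tau>_ne[of x] \<epsilon>_pos by (simp add: field_simps)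
  thus ?thesis by simp
qed

lemma lower_upper_match:
  assumes "x \<in> {ul..ur}"
  shows "C_lo (\<alpha> x, \<beta> x) = C_up (\<alpha> x, \<beta> x)" "G_lo (\<alpha> x, \<beta> x) = G_up (\<alpha> x, \<beta> x)"
proof -
  have r: "\<alpha> x \<in> {al..ar}" using assms strict_mono_less_eq[OF \<alpha>_mono] by (auto simp: ends[symmetric])
  have N: "N (\<alpha> x) = n x" using N_eq[OF r] by (simp add: ainv)
  have M: "M (\<beta> x) = m x" by (simp add: M_def binv)
  have \<rho>: "\<rho> (\<beta> x) = slope p1 q1 (\<alpha> x) (\<beta> x)" by (simp add: \<rho>_def A_def binv)
  have \<sigma>: "\<sigma> (\<alpha> x) = slope p1 q1 (\<alpha> x) (\<beta> x)" using r by (simp add: \<sigma>_def ainv)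
  have w: "(\<alpha> x - \<beta> x + 2 * \<epsilon>) / 2 = \<epsilon> + \<tau> x" "(2 * \<epsilon> - \<alpha> x + \<beta> x) / 2 = \<epsilon> - \<tau> x"
    using \<alpha>_\<beta>[of x] by (simp_all add: field_simps)
  show "C_lo (\<alpha> x, \<beta> x) = C_up (\<alpha> x, \<beta> x)"
    unfolding C_lo_def C_up_def fst_conv snd_conv w M N by (rule m_n_diff)
  show "G_lo (\<alpha> x, \<beta> x) = G_up (\<alpha> x, \<beta> x)"
    unfolding G_lo_def G_up_def fst_conv snd_conv w M N \<rho> \<sigma>
    using m_n_sum[of x] p1_q1[of x] by (simp add: algebra_simps)
qed

definition "C z = (if fst z \<le> A (snd z) then C_lo z else C_up z)"
definition "G z = (if fst z \<le> A (snd z) then G_lo z else G_up z)"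
text \<open>The parallelogram between the lines $x_1 - x_2 = u_1$ and $x_1 - x_2 = u_2$ in the coordinates
  \<open>(r, b)\<close>. Outside the herringbone the region above the spine is only a boundary segment, which
  belongs to \<open>S_lo\<close> already; \<open>S_up\<close> leaves it out because the gradient of \<open>C_up\<close> is wrong there.\<close>

definition "S = {z. u1 - \<epsilon> \<le> snd z \<and> snd z \<le> u2 - \<epsilon> \<and> \<bar>fst z - snd z\<bar> \<le> 2 * \<epsilon>}"
definition "S_lo = {z \<in> S. fst z \<le> A (snd z)}"
definition "S_up = {z \<in> S. A (snd z) \<le> fst z \<and> snd z \<in> {bl..br}}"

lemma S_closed: "closed S"
  unfolding S_def by (intro closed_Collect_conj closed_Collect_le continuous_intros)

lemma S_lo_closed: "closed S_lo" and S_up_closed: "closed S_up"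
proof -
  have A: "continuous_on UNIV (\<lambda>z. A (snd z))"
    by (intro continuous_on_compose2[OF A_cont] continuous_intros) auto
  have "S_lo = S \<inter> {z. fst z \<le> A (snd z)}" by (auto simp: S_lo_def)
  thus "closed S_lo" using S_closed by (auto intro!: closed_Int closed_Collect_le continuous_intros A)
  have "S_up = S \<inter> {z. A (snd z) \<le> fst z} \<inter> {z. bl \<le> snd z} \<inter> {z. snd z \<le> br}"
    by (auto simp: S_up_def)
  thus "closed S_up" using S_closed by (auto intro!: closed_Int closed_Collect_le continuous_intros A)
qed

lemma S_upper: "z \<in> S \<Longrightarrow> A (snd z) < fst z \<Longrightarrow> snd z \<in> {bl<..<br}"
  using A_out[of "snd z"] by (fastforce simp: S_def)

lemma S_Un: "S = S_lo \<union> S_up"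
  using S_upper by (force simp: S_lo_def S_up_def)

lemma on_S_lo: "z \<in> S_lo \<Longrightarrow> C z = C_lo z \<and> G z = G_lo z"
  by (simp add: S_lo_def C_def G_def)

lemma on_S_up: assumes "z \<in> S_up" shows "C z = C_up z \<and> G z = G_up z"
proof (cases "fst z = A (snd z)")
  case True
  define x where "x = binv (snd z)"
  have "x \<in> {ul..ur}" using assms by (auto simp: S_up_def x_def binv_less ends)
  moreover have "z = (\<alpha> x, \<beta> x)" using True by (simp add: prod_eq_iff x_def A_def binv)
  ultimately show ?thesis using lower_upper_match[of x] True by (simp add: C_def G_def)
qed (use assms in \<open>auto simp: S_up_def C_def G_def\<close>)

lemma C_deriv:
  assumes "z \<in> S"
  shows "(C has_derivative (\<lambda>h. G z \<bullet> h)) (at z within S)"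
  unfolding S_Un
proof (rule has_derivative_closed_Un[OF S_lo_closed S_up_closed])
  show "z \<in> S_lo \<union> S_up" using assms S_Un by simp
  show "(C has_derivative (\<lambda>h. G z \<bullet> h)) (at z within S_lo)" if "z \<in> S_lo"
    using C_lo_deriv[of z S_lo] on_S_lo[OF that]
    by (auto intro: has_derivative_transform[OF that] simp: on_S_lo)
  show "(C has_derivative (\<lambda>h. G z \<bullet> h)) (at z within S_up)" if "z \<in> S_up"
    using C_up_deriv[of z S_up] on_S_up[OF that]
    by (auto intro: has_derivative_transform[OF that] simp: on_S_up)
qed

lemma G_cont: "continuous_on S G"
  unfolding S_Un
  by (intro continuous_on_closed_Un S_lo_closed S_up_closed)
    (auto intro: continuous_on_eq[OF G_lo_cont] continuous_on_eq[OF G_up_cont] simp: on_S_lo on_S_up)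

lemma S_D: "(r, b) \<in> S \<Longrightarrow> u1 - \<epsilon> \<le> b \<and> b \<le> u2 - \<epsilon> \<and> b - 2 * \<epsilon> \<le> r \<and> r \<le> b + 2 * \<epsilon>"
  by (auto simp: S_def)

text \<open>Moving to larger \<open>b\<close> along a line $r = $ const one follows an upper rib, where the function is
  affine, crosses the spine and then traverses lower ribs. There the second derivative is
  $d w - D_-$ with $w = (r - b + 2 \varepsilon) / 2$, which is at most $\varepsilon + \tau$ because the point
  lies below the spine; the bound on $d$ from \<open>\<rho>_deriv\<close> finishes the proof.\<close>

lemma concave_in_b:
  assumes S: "\<And>b. b \<in> {b1..b2} \<Longrightarrow> (r, b) \<in> S"
  shows "concave_on {b1..b2} (\<lambda>b. C (r, b))"
proof (rule concave_on_interval[where d = "\<lambda>b. snd (G (r, b))" and S = "{bl, br, \<beta> (ainv r)}"])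
  fix b assume b: "b \<in> {b1..b2}"
  have "((\<lambda>b. C (r, b)) has_derivative (\<lambda>h. G (r, b) \<bullet> (0, h))) (at b within {b1..b2})"
    by (rule has_derivative_in_compose2[OF C_deriv])
      (use S b in \<open>auto intro!: derivative_eq_intros\<close>)
  thus "((\<lambda>b. C (r, b)) has_real_derivative snd (G (r, b))) (at b within {b1..b2})"
    unfolding has_field_derivative_def by (simp add: inner_prod_def mult_commute_abs)
next
  show "continuous_on {b1..b2} (\<lambda>b. snd (G (r, b)))"
    using S by (intro continuous_on_snd continuous_on_compose2[OF G_cont] continuous_intros) auto
next
  fix b assume b: "b \<in> {b1<..<b2} - {bl, br, \<beta> (ainv r)}"
  have bb: "u1 - \<epsilon> \<le> b" "b \<le> u2 - \<epsilon>" "b - 2 * \<epsilon> \<le> r" "r \<le> b + 2 * \<epsilon>"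
    using S_D[OF S[of b]] b by auto
  have "r \<noteq> A b"
  proof
    assume "r = A b"
    hence "ainv r = binv b" by (simp add: A_def ainv)
    thus False using b by (simp add: binv)
  qed
  then consider "A b < r" | "r < A b" by force
  thus "\<exists>y\<le>0. ((\<lambda>b. snd (G (r, b))) has_real_derivative y) (at b)"
  proof cases
    case 1
    have "open {b. A b < r}" by (intro open_Collect_less A_cont continuous_intros)
    hence "((\<lambda>b. snd (G (r, b))) has_real_derivative 0) (at b)"
      by (rule has_field_derivative_transform_within_open[OF DERIV_const[of "N r / 2"]])
        (use 1 in \<open>auto simp: G_def G_up_def\<close>)
    thus ?thesis by blast
  next
    case 2
    define x where "x = binv b"
    have bx: "b = \<beta> x" "A b = \<alpha> x" by (simp_all add: x_def binv A_def)
    have x: "x \<in> {u1..u2}"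
    proof -
      have "u1 - \<epsilon> = \<beta> u1" "u2 - \<epsilon> = \<beta> u2" using u1_ul ur_u2 by (auto simp: \<beta>_def \<tau>_out)
      thus ?thesis using bb by (simp add: x_def binv_less)
    qed
    obtain d where d: "(\<rho> has_real_derivative d) (at b)" "d * (\<epsilon> + \<tau> x) \<le> Dm (A b) b"
      using \<rho>_deriv[of b] b x unfolding x_def by blast
    define w where "w = (r - b + 2 * \<epsilon>) / 2"
    have w: "0 \<le> w" "w \<le> \<epsilon> + \<tau> x"
      using bb 2 A_minus[of b] by (auto simp: w_def x_def)
    have "((\<lambda>b. snd (G_lo (r, b))) has_real_derivative
        (q2 b + (d * w + (0 - 1 + 0) / 2 * \<rho> b)) - \<rho> b / 2) (at b)"
      unfolding G_lo_def w_def snd_conv fst_conv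
      by (intro DERIV_add DERIV_diff DERIV_mult DERIV_cdivide d(1) q1 M_deriv DERIV_const DERIV_ident)
    also have "(q2 b + (d * w + (0 - 1 + 0) / 2 * \<rho> b)) - \<rho> b / 2 = d * w - Dm (A b) b"
      by (simp add: \<rho>_def Dm_def)
    finally have "((\<lambda>b. snd (G_lo (r, b))) has_real_derivative d * w - Dm (A b) b) (at b)" .
    moreover have "open {b. r < A b}" by (intro open_Collect_less A_cont continuous_intros)
    ultimately have "((\<lambda>b. snd (G (r, b))) has_real_derivative d * w - Dm (A b) b) (at b)"
      by (rule has_field_derivative_transform_within_open) (use 2 in \<open>auto simp: G_def\<close>)
    moreover have "d * w \<le> Dm (A b) b"
    proof (cases "d \<le> 0")
      case True
      hence "d * w \<le> 0" using w by (simp add: mult_nonpos_nonneg)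
      moreover have "0 \<le> Dm (A b) b"
        using D_nonneg'[OF x] unfolding bx(1)[symmetric] bx(2)[symmetric] by blast
      ultimately show ?thesis by linarith
    next
      case False
      hence "d * w \<le> d * (\<epsilon> + \<tau> x)" using w by (intro mult_left_mono) auto
      thus ?thesis using d by simp
    qed
    ultimately show ?thesis by (intro exI[of _ "d * w - Dm (A b) b"]) simp
  qed
qed simp

text \<open>The mirror image: a lower rib up to the spine, upper ribs beyond it.\<close>

lemma concave_in_r:
  assumes S: "\<And>r. r \<in> {r1..r2} \<Longrightarrow> (r, b) \<in> S"
  shows "concave_on {r1..r2} (\<lambda>r. C (r, b))"
proof (rule concave_on_interval[where d = "\<lambda>r. fst (G (r, b))" and S = "{A b}"])
  fix r assume r: "r \<in> {r1..r2}"
  have "((\<lambda>r. C (r, b)) has_derivative (\<lambda>h. G (r, b) \<bullet> (h, 0))) (at r within {r1..r2})"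
    by (rule has_derivative_in_compose2[OF C_deriv])
      (use S r in \<open>auto intro!: derivative_eq_intros\<close>)
  thus "((\<lambda>r. C (r, b)) has_real_derivative fst (G (r, b))) (at r within {r1..r2})"
    unfolding has_field_derivative_def by (simp add: inner_prod_def mult_commute_abs)
next
  show "continuous_on {r1..r2} (\<lambda>r. fst (G (r, b)))"
    using S by (intro continuous_on_fst continuous_on_compose2[OF G_cont] continuous_intros) auto
next
  fix r assume r: "r \<in> {r1<..<r2} - {A b}"
  then consider "r < A b" | "A b < r" by force
  thus "\<exists>y\<le>0. ((\<lambda>r. fst (G (r, b))) has_real_derivative y) (at r)"
  proof cases
    case 1
    have "((\<lambda>r. fst (G (r, b))) has_real_derivative 0) (at r)"
      by (rule has_field_derivative_transform_within_open[OF DERIV_const[of "M b / 2"], of "{..<A b}"])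
        (use 1 in \<open>auto simp: G_def G_lo_def\<close>)
    thus ?thesis by blast
  next
    case 2
    have rb: "r < b + 2 * \<epsilon>" "(r, b) \<in> S" using S_D[OF S[of r2]] S[of r] r by auto
    have b: "b \<in> {bl<..<br}" using S_upper[OF rb(2)] 2 by simp
    have "al \<le> A b" using b strict_mono_less_eq[OF \<alpha>_mono, of ul "binv b"]
      by (simp add: ends[symmetric] A_def binv_less)
    hence r': "r \<in> {al<..<ar}" using 2 rb b by (auto simp: al_def ar_def bl_def br_def)
    define x where "x = ainv r"
    obtain d where d: "(\<sigma> has_real_derivative d) (at r)"
      "d * (\<epsilon> - \<tau> x) = Dp r (\<beta> x)" "0 \<le> Dp r (\<beta> x)" "\<sigma> r = slope p1 q1 r (\<beta> x)"
      using \<sigma>_deriv[OF r'] unfolding x_def by blast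
    have "x \<in> {ul<..<ur}" using r' by (auto simp: x_def ainv_less ends)
    hence \<tau>x: "\<tau> x < \<epsilon>" using \<tau>_in by blast
    have "binv b < x" using 2 by (simp add: x_def ainv_less A_def)
    hence b_x: "b < \<beta> x" by (simp add: binv_less)
    define w where "w = (2 * \<epsilon> - r + b) / 2"
    have w: "0 \<le> w" "w \<le> \<epsilon> - \<tau> x"
      using rb b_x \<beta>_ainv[of r] by (auto simp: w_def x_def)
    have "((\<lambda>r. fst (G_up (r, b))) has_real_derivative
        (p2 r + (d * w + (0 - 1 + 0) / 2 * \<sigma> r)) - \<sigma> r / 2) (at r)"
      unfolding G_up_def w_def snd_conv fst_conv
      by (intro DERIV_add DERIV_diff DERIV_mult DERIV_cdivide d(1) p1 N_deriv DERIV_const DERIV_ident)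
    also have "(p2 r + (d * w + (0 - 1 + 0) / 2 * \<sigma> r)) - \<sigma> r / 2 = d * w - Dp r (\<beta> x)"
      by (simp add: d(4) Dp_def)
    finally have "((\<lambda>r. fst (G_up (r, b))) has_real_derivative d * w - Dp r (\<beta> x)) (at r)" .
    hence "((\<lambda>r. fst (G (r, b))) has_real_derivative d * w - Dp r (\<beta> x)) (at r)"
      by (rule has_field_derivative_transform_within_open[of _ _ _ "{A b<..}"])
        (use 2 in \<open>auto simp: G_def\<close>)
    moreover have "d * w \<le> Dp r (\<beta> x)"
    proof -
      have "0 \<le> d" using d \<tau>x by (metis diff_gt_0_iff_gt zero_le_mult_iff not_le)
      hence "d * w \<le> d * (\<epsilon> - \<tau> x)" using w by (intro mult_left_mono) auto
      thus ?thesis using d by simp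
    qed
    ultimately show ?thesis by (intro exI[of _ "d * w - Dp r (\<beta> x)"]) simp
  qed
qed simp

lemma deriv_eqs: "deriv p = p1" "deriv q = q1" "(deriv ^^ 2) p = p2" "(deriv ^^ 2) q = q2"
proof -
  show *: "deriv p = p1" "deriv q = q1" using p q by (auto intro: DERIV_imp_deriv)
  have "deriv p1 = p2" "deriv q1 = q2" using p1 q1 by (auto intro: DERIV_imp_deriv)
  thus "(deriv ^^ 2) p = p2" "(deriv ^^ 2) q = q2" by (simp_all add: numeral_2_eq_2 *)
qed

text \<open>The second derivatives of the boundary data in the field are replaced by $s - D_+$ and $s - D_-$,
  after which the difference quotient $s$ cancels.\<close>

lemma field_eq:
  "herringbone_field p q \<epsilon> (x, \<tau> x) =
    (\<tau> x * ((\<epsilon> - \<tau> x) * Dm (\<alpha> x) (\<beta> x) + (\<epsilon> + \<tau> x) * Dp (\<alpha> x) (\<beta> x)),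
     \<tau> x * ((\<epsilon> - \<tau> x) * Dm (\<alpha> x) (\<beta> x) - (\<epsilon> + \<tau> x) * Dp (\<alpha> x) (\<beta> x)))"
proof -
  have pq: "p1 (\<alpha> x) = q1 (\<beta> x) + 2 * slope p1 q1 (\<alpha> x) (\<beta> x) * \<tau> x" using p1_q1[of x] by simp
  show ?thesis
    unfolding herringbone_field_def deriv_eqs case_prod_conv \<alpha>_def[symmetric] \<beta>_def[symmetric] pq Dm_def Dp_def
    by (simp add: algebra_simps)
qed

definition "T u = \<tau> (u - \<epsilon>)"

lemma spine_integral_curve:
  "integral_curve (herringbone_field p q \<epsilon>) ((\<lambda>u. (u - \<epsilon>, T u)) ` {ul + \<epsilon><..<ur + \<epsilon>})"
proof -
  have "integral_curve (herringbone_field p q \<epsilon>) ((\<lambda>x. (x, \<tau> x)) ` {ul<..<ur})"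
  proof (rule integral_curve_graph[OF ul_ur \<tau>_der])
    show "continuous_on {ul<..<ur} (\<lambda>x. fst (herringbone_field p q \<epsilon> (x, \<tau> x)))"
      unfolding field_eq fst_conv Dm_def Dp_def slope_def
      using \<alpha>_\<beta> \<tau>_ne
      by (intro continuous_intros continuous_on_subset[OF \<tau>_cont] continuous_on_compose2[OF p1_cont[of UNIV]]
          continuous_on_compose2[OF q1_cont[of UNIV]] continuous_on_compose2[OF p2_cont]
          continuous_on_compose2[OF q2_cont] continuous_on_subset[OF \<alpha>_cont] continuous_on_subset[OF \<beta>_cont]) auto
    fix x assume x: "x \<in> {ul<..<ur}"
    have "0 < Dp (\<alpha> x) (\<beta> x)" using D_pos[OF x] by (simp add: Dp_def \<alpha>_def \<beta>_def)
    moreover have "0 \<le> Dm (\<alpha> x) (\<beta> x)" using D_nonneg'[of x] x u1_ul ur_u2 by auto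
    ultimately show "0 < fst (herringbone_field p q \<epsilon> (x, \<tau> x))"
      unfolding field_eq fst_conv using \<tau>_bounds[of x] \<epsilon>_pos
      by (intro mult_pos_pos add_nonneg_pos mult_nonneg_nonneg) auto
    have "d\<tau> x = \<tau>' x" using x by (simp add: d\<tau>_def)
    hence "(\<epsilon> - \<tau> x) * Dm (\<alpha> x) (\<beta> x) - (\<epsilon> + \<tau> x) * Dp (\<alpha> x) (\<beta> x)
        = \<tau>' x * ((\<epsilon> - \<tau> x) * Dm (\<alpha> x) (\<beta> x) + (\<epsilon> + \<tau> x) * Dp (\<alpha> x) (\<beta> x))"
      using ode'[OF x] by (simp add: algebra_simps)
    thus "snd (herringbone_field p q \<epsilon> (x, \<tau> x)) = \<tau>' x * fst (herringbone_field p q \<epsilon> (x, \<tau> x))"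
      unfolding field_eq fst_conv snd_conv by simp
  qed
  moreover have "(\<lambda>u. (u - \<epsilon>, T u)) ` {ul + \<epsilon><..<ur + \<epsilon>} = (\<lambda>x. (x, \<tau> x)) ` {ul<..<ur}"
  proof -
    have "{ul + \<epsilon><..<ur + \<epsilon>} = (\<lambda>x. x + \<epsilon>) ` {ul<..<ur}"
      by (auto intro!: image_eqI[of _ _ "_ - \<epsilon>"])
    thus ?thesis by (simp add: T_def image_image)
  qed
  ultimately show ?thesis by simp
qed

lemma T_der: "u \<in> {ul + \<epsilon><..<ur + \<epsilon>} \<Longrightarrow> (T has_real_derivative \<tau>' (u - \<epsilon>)) (at u)"
  unfolding T_def[abs_def]
  using DERIV_chain2[where f = \<tau> and g = "\<lambda>u. u - \<epsilon>", OF \<tau>_der DERIV_diff[OF DERIV_ident DERIV_const]] by simp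

lemma left_spine: "left_spine p q \<epsilon> (ul + \<epsilon>) (ur + \<epsilon>) T"
  unfolding left_spine_def
proof (intro conjI ballI spine_integral_curve)
  show "ul + \<epsilon> < ur + \<epsilon>" using ul_ur by simp
  show "continuous_on {ul + \<epsilon>..ur + \<epsilon>} T"
    unfolding T_def[abs_def] by (intro continuous_on_compose2[OF \<tau>_cont] continuous_intros) auto
  show "T C1_differentiable_on {ul + \<epsilon><..<ur + \<epsilon>}"
    unfolding C1_differentiable_on_def
  proof (intro exI[of _ "\<lambda>u. \<tau>' (u - \<epsilon>)"] conjI ballI)
    show "continuous_on {ul + \<epsilon><..<ur + \<epsilon>} (\<lambda>u. \<tau>' (u - \<epsilon>))"
      by (intro continuous_on_compose2[OF \<tau>'_cont] continuous_intros) auto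
  qed (use T_der in \<open>auto simp: has_real_derivative_iff_has_vector_derivative\<close>)
  fix u assume u: "u \<in> {ul + \<epsilon><..<ur + \<epsilon>}"
  hence x: "u - \<epsilon> \<in> {ul<..<ur}" by auto
  show "\<bar>T u\<bar> < \<epsilon>" using \<tau>_in[OF x] by (simp add: T_def)
  show "\<bar>deriv T u\<bar> < 1" using DERIV_imp_deriv[OF T_der[OF u]] \<tau>'_lt[OF x] by simp
qed

definition "\<Phi> z = (fst z + snd z - \<epsilon>, fst z - snd z - \<epsilon>)"
definition "B z = C (\<Phi> z)"

lemma \<Phi>_S: "\<Phi> z \<in> S \<longleftrightarrow> z \<in> Omega_R \<epsilon> u1 u2"
  by (cases z) (auto simp: \<Phi>_def S_def Omega_R_def abs_le_iff)

lemma B_C1: "C1_smooth_on (Omega_R \<epsilon> u1 u2) B"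
  unfolding C1_smooth_on_def
proof (intro exI conjI ballI)
  let ?G = "\<lambda>z. (fst (G (\<Phi> z)) + snd (G (\<Phi> z)), fst (G (\<Phi> z)) - snd (G (\<Phi> z)))"
  have "continuous_on (Omega_R \<epsilon> u1 u2) (\<lambda>z. G (\<Phi> z))"
    by (intro continuous_on_compose2[OF G_cont]) (auto simp: \<Phi>_S, auto simp: \<Phi>_def intro!: continuous_intros)
  thus "continuous_on (Omega_R \<epsilon> u1 u2) ?G" by (intro continuous_intros)
  fix z assume z: "z \<in> Omega_R \<epsilon> u1 u2"
  have "((\<lambda>z. C (\<Phi> z)) has_derivative (\<lambda>h. G (\<Phi> z) \<bullet> (fst h + snd h - 0, fst h - snd h - 0)))
      (at z within Omega_R \<epsilon> u1 u2)"
  proof (rule has_derivative_in_compose2[OF C_deriv])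
    show "(\<Phi> has_derivative (\<lambda>h. (fst h + snd h - 0, fst h - snd h - 0))) (at z within Omega_R \<epsilon> u1 u2)"
      unfolding \<Phi>_def[abs_def]
      by (intro has_derivative_Pair has_derivative_diff has_derivative_add has_derivative_fst
          has_derivative_snd has_derivative_ident has_derivative_const)
  qed (use z in \<open>auto simp: \<Phi>_S\<close>)
  thus "(B has_derivative (\<lambda>h. ?G z \<bullet> h)) (at z within Omega_R \<epsilon> u1 u2)"
    unfolding B_def[abs_def]
    by (rule has_derivative_eq_rhs) (auto simp: inner_prod_def fun_eq_iff algebra_simps)
qed

lemma S_convex_b:
  assumes "(r, b1) \<in> S" "(r, b2) \<in> S" "b \<in> {min b1 b2..max b1 b2}"
  shows "(r, b) \<in> S"
  using assms by (auto simp: S_def abs_le_iff min_def max_def split: if_splits)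

lemma S_convex_r:
  assumes "(r1, b) \<in> S" "(r2, b) \<in> S" "r \<in> {min r1 r2..max r1 r2}"
  shows "(r, b) \<in> S"
  using assms by (auto simp: S_def abs_le_iff min_def max_def split: if_splits)

lemma B_diag: "diag_concave_on (Omega_R \<epsilon> u1 u2) B"
  unfolding diag_concave_on_def
proof (intro allI impI, elim conjE)
  fix x y :: "real \<times> real"
  assume seg: "closed_segment x y \<subseteq> Omega_R \<epsilon> u1 u2"
    and "\<exists>t. y - x = t *\<^sub>R (1, 1) \<or> y - x = t *\<^sub>R (1, - 1)"
  then obtain t where t: "y - x = t *\<^sub>R (1, 1) \<or> y - x = t *\<^sub>R (1, - 1)" by blast
  have xy: "\<Phi> x \<in> S" "\<Phi> y \<in> S" using seg by (auto simp: \<Phi>_S)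
  have aff: "fst (\<Phi> (u *\<^sub>R z + v *\<^sub>R w)) = u * fst (\<Phi> z) + v * fst (\<Phi> w)"
    "snd (\<Phi> (u *\<^sub>R z + v *\<^sub>R w)) = u * snd (\<Phi> z) + v * snd (\<Phi> w)" if "u + v = 1" for u v z w
  proof -
    have e: "u * \<epsilon> + v * \<epsilon> = \<epsilon>" using that by (metis distrib_right mult_1)
    show "fst (\<Phi> (u *\<^sub>R z + v *\<^sub>R w)) = u * fst (\<Phi> z) + v * fst (\<Phi> w)"
      "snd (\<Phi> (u *\<^sub>R z + v *\<^sub>R w)) = u * snd (\<Phi> z) + v * snd (\<Phi> w)"
      using e by (simp_all add: \<Phi>_def algebra_simps)
  qed
  show "concave_on (closed_segment x y) B"
    using t
  proof
    assume "y - x = t *\<^sub>R (1, 1)"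
    hence eq: "snd (\<Phi> y) = snd (\<Phi> x)" by (auto simp: \<Phi>_def prod_eq_iff)
    show ?thesis
    proof (rule concave_on_segment[where l = "\<lambda>z. fst (\<Phi> z)" and c = "\<lambda>r. C (r, snd (\<Phi> x))"])
      show "concave_on {min (fst (\<Phi> x)) (fst (\<Phi> y))..max (fst (\<Phi> x)) (fst (\<Phi> y))}
          (\<lambda>r. C (r, snd (\<Phi> x)))"
        by (rule concave_in_r, rule S_convex_r[of "fst (\<Phi> x)" _ "fst (\<Phi> y)"])
          (use xy eq in \<open>auto simp: prod_eq_iff\<close>, metis eq prod.collapse)
      fix z assume "z \<in> closed_segment x y"
      then obtain s where "z = (1 - s) *\<^sub>R x + s *\<^sub>R y" by (auto simp: in_segment)
      hence "snd (\<Phi> z) = (1 - s) * snd (\<Phi> x) + s * snd (\<Phi> y)" by (simp add: aff)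
      hence "snd (\<Phi> z) = snd (\<Phi> x)" unfolding eq by (simp add: algebra_simps)
      thus "B z = C (fst (\<Phi> z), snd (\<Phi> x))" by (metis B_def prod.collapse)
    qed (simp add: aff)
  next
    assume "y - x = t *\<^sub>R (1, - 1)"
    hence eq: "fst (\<Phi> y) = fst (\<Phi> x)" by (auto simp: \<Phi>_def prod_eq_iff)
    show ?thesis
    proof (rule concave_on_segment[where l = "\<lambda>z. snd (\<Phi> z)" and c = "\<lambda>b. C (fst (\<Phi> x), b)"])
      show "concave_on {min (snd (\<Phi> x)) (snd (\<Phi> y))..max (snd (\<Phi> x)) (snd (\<Phi> y))}
          (\<lambda>b. C (fst (\<Phi> x), b))"
        by (rule concave_in_b, rule S_convex_b[of _ "snd (\<Phi> x)" "snd (\<Phi> y)"])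
          (use xy eq in \<open>auto simp: prod_eq_iff\<close>, metis eq prod.collapse)
      fix z assume "z \<in> closed_segment x y"
      then obtain s where "z = (1 - s) *\<^sub>R x + s *\<^sub>R y" by (auto simp: in_segment)
      hence "fst (\<Phi> z) = (1 - s) * fst (\<Phi> x) + s * fst (\<Phi> y)" by (simp add: aff)
      hence "fst (\<Phi> z) = fst (\<Phi> x)" unfolding eq by (simp add: algebra_simps)
      thus "B z = C (fst (\<Phi> x), snd (\<Phi> z))" by (metis B_def prod.collapse)
    qed (simp add: aff)
  qed
qed

lemma M_out:
  assumes "A b = b + 2 * \<epsilon>"
  shows "M b = (p (b + 2 * \<epsilon>) - q b) / (2 * \<epsilon>)"
proof -
  have "\<tau> (binv b) = \<epsilon>" using A_minus[of b] assms by simp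
  moreover have "\<alpha> (binv b) = b + 2 * \<epsilon>" using assms by (simp add: A_def)
  ultimately show ?thesis by (simp add: M_def m_def binv)
qed

lemma B_boundary: "boundary_values p q \<epsilon> (Omega_R \<epsilon> u1 u2) B"
  unfolding boundary_values_def
proof (intro allI conjI impI)
  fix x
  have "C (x, x - 2 * \<epsilon>) = p x"
  proof (cases "x \<le> A (x - 2 * \<epsilon>)")
    case True
    hence "A (x - 2 * \<epsilon>) = x - 2 * \<epsilon> + 2 * \<epsilon>" using A_le[of "x - 2 * \<epsilon>"] by simp
    from M_out[OF this] show ?thesis using True \<epsilon>_pos by (simp add: C_def C_lo_def)
  qed (simp add: C_def C_up_def)
  thus "B (x, \<epsilon>) = p x" by (simp add: B_def \<Phi>_def)
  have "x - 2 * \<epsilon> \<le> A x" using A_gt[of x] \<epsilon>_pos by simp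
  thus "B (x, -\<epsilon>) = q x" by (simp add: B_def \<Phi>_def C_def C_lo_def)
qed

lemma subset_Omega: "u1 \<le> a \<Longrightarrow> b \<le> u2 \<Longrightarrow> Omega_R \<epsilon> a b \<subseteq> Omega_R \<epsilon> u1 u2"
  by (auto simp: Omega_R_def)

lemma diag_subset: "diag_concave_on V f \<Longrightarrow> U \<subseteq> V \<Longrightarrow> diag_concave_on U f"
  unfolding diag_concave_on_def by blast

lemma B_right_simple:
  assumes "u1 \<le> a" "b \<le> u2" and out: "b \<le> ul \<or> ur \<le> a"
  shows "right_simple_candidate p q \<epsilon> a b B"
  unfolding right_simple_candidate_def
proof (intro conjI ballI)
  show "diag_concave_on (Omega_R \<epsilon> a b) B"
    by (rule diag_subset[OF B_diag subset_Omega[OF assms(1,2)]])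
  fix z assume z: "z \<in> Omega_R \<epsilon> a b"
  obtain x1 x2 where [simp]: "z = (x1, x2)" by (cases z)
  define s where "s = x1 - x2 - \<epsilon>"
  have "A s = s + 2 * \<epsilon>" by (rule A_out) (use z out in \<open>auto simp: Omega_R_def s_def bl_def br_def\<close>)
  moreover have "x1 + x2 - \<epsilon> \<le> s + 2 * \<epsilon>" using z by (auto simp: Omega_R_def s_def)
  ultimately have "B z = q s + M s * ((x1 + x2 - \<epsilon> - s + 2 * \<epsilon>) / 2)" "M s = (p (s + 2 * \<epsilon>) - q s) / (2 * \<epsilon>)"
    using M_out by (simp_all add: B_def \<Phi>_def C_def C_lo_def s_def)
  moreover have "(x1 + x2 - \<epsilon> - s + 2 * \<epsilon>) / 2 = \<epsilon> + x2" by (simp add: s_def)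
  ultimately have "B z = q s + (p (s + 2 * \<epsilon>) - q s) / (2 * \<epsilon>) * (\<epsilon> + x2)"
    by (simp only:)
  also have "\<dots> = (\<epsilon> + x2) / (2 * \<epsilon>) * p (s + 2 * \<epsilon>) + (\<epsilon> - x2) / (2 * \<epsilon>) * q s"
    using \<epsilon>_pos by (simp add: field_simps)
  also have "s + 2 * \<epsilon> = x1 - x2 + \<epsilon>" by (simp add: s_def)
  finally show "case z of (x1, x2) \<Rightarrow> B (x1, x2) = (\<epsilon> + x2) / (2 * \<epsilon>) * p (x1 - x2 + \<epsilon>)
      + (\<epsilon> - x2) / (2 * \<epsilon>) * q (x1 - x2 - \<epsilon>)" by (simp add: s_def)
qed

lemma C_lower: "r \<le> \<alpha> x \<Longrightarrow> C (r, \<beta> x) = C_lo (r, \<beta> x)"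
  by (simp add: C_def A_def binv)

lemma C_upper:
  assumes "x \<in> {ul..ur}" "b \<le> \<beta> x"
  shows "C (\<alpha> x, b) = C_up (\<alpha> x, b)"
proof (cases "b = \<beta> x")
  case True
  thus ?thesis using lower_upper_match[OF assms(1)] by (simp add: C_def)
next
  case False
  hence "binv b < x" using assms by (simp add: binv_less)
  hence "A b < \<alpha> x" unfolding A_def using \<alpha>_mono by (simp add: strict_mono_less)
  thus ?thesis by (simp add: C_def)
qed

lemma \<Phi>_spine: "\<Phi> (x + \<epsilon>, T (x + \<epsilon>)) = (\<alpha> x, \<beta> x)"
  and \<Phi>_upper_end: "\<Phi> (upper_end \<epsilon> T (x + \<epsilon>)) = (\<alpha> x, \<alpha> x - 2 * \<epsilon>)"
  and \<Phi>_lower_end: "\<Phi> (lower_end \<epsilon> T (x + \<epsilon>)) = (\<beta> x - 2 * \<epsilon>, \<beta> x)"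
  by (simp_all add: \<Phi>_def T_def upper_end_def lower_end_def \<alpha>_def \<beta>_def)

lemma \<Phi>_aff: "\<Phi> ((1 - t) *\<^sub>R z + t *\<^sub>R w) =
    ((1 - t) * fst (\<Phi> z) + t * fst (\<Phi> w), (1 - t) * snd (\<Phi> z) + t * snd (\<Phi> w))"
  by (simp add: \<Phi>_def algebra_simps)

lemma affine_upper:
  assumes "x \<in> {ul..ur}"
  shows "affine_on_segment (x + \<epsilon>, T (x + \<epsilon>)) (upper_end \<epsilon> T (x + \<epsilon>)) B"
  unfolding affine_on_segment_def
proof
  fix t :: real assume t: "t \<in> {0..1}"
  have le: "\<alpha> x - 2 * \<epsilon> \<le> \<beta> x" using \<alpha>_\<beta>[of x] \<tau>_bounds[of x] by simp
  hence "(1 - t) * \<beta> x + t * (\<alpha> x - 2 * \<epsilon>) \<le> (1 - t) * \<beta> x + t * \<beta> x"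
    using t by (intro add_left_mono mult_left_mono) auto
  hence le': "(1 - t) * \<beta> x + t * (\<alpha> x - 2 * \<epsilon>) \<le> \<beta> x" by (simp add: algebra_simps)
  have \<alpha>: "(1 - t) * \<alpha> x + t * \<alpha> x = \<alpha> x" by (simp add: algebra_simps)
  show "B ((1 - t) *\<^sub>R (x + \<epsilon>, T (x + \<epsilon>)) + t *\<^sub>R upper_end \<epsilon> T (x + \<epsilon>)) =
    (1 - t) * B (x + \<epsilon>, T (x + \<epsilon>)) + t * B (upper_end \<epsilon> T (x + \<epsilon>))"
    unfolding B_def \<Phi>_aff \<Phi>_spine \<Phi>_upper_end fst_conv snd_conv \<alpha>
      C_upper[OF assms le] C_upper[OF assms le'] C_upper[OF assms order_refl] C_up_def
    by (simp add: algebra_simps add_divide_distrib diff_divide_distrib)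
qed

lemma affine_lower: "affine_on_segment (x + \<epsilon>, T (x + \<epsilon>)) (lower_end \<epsilon> T (x + \<epsilon>)) B"
  unfolding affine_on_segment_def
proof
  fix t :: real assume t: "t \<in> {0..1}"
  have le: "\<beta> x - 2 * \<epsilon> \<le> \<alpha> x" using \<alpha>_\<beta>[of x] \<tau>_bounds[of x] by simp
  hence "(1 - t) * \<alpha> x + t * (\<beta> x - 2 * \<epsilon>) \<le> (1 - t) * \<alpha> x + t * \<alpha> x"
    using t by (intro add_left_mono mult_left_mono) auto
  hence le': "(1 - t) * \<alpha> x + t * (\<beta> x - 2 * \<epsilon>) \<le> \<alpha> x" by (simp add: algebra_simps)
  have \<beta>: "(1 - t) * \<beta> x + t * \<beta> x = \<beta> x" by (simp add: algebra_simps)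
  show "B ((1 - t) *\<^sub>R (x + \<epsilon>, T (x + \<epsilon>)) + t *\<^sub>R lower_end \<epsilon> T (x + \<epsilon>)) =
    (1 - t) * B (x + \<epsilon>, T (x + \<epsilon>)) + t * B (lower_end \<epsilon> T (x + \<epsilon>))"
    unfolding B_def \<Phi>_aff \<Phi>_spine \<Phi>_lower_end fst_conv snd_conv \<beta>
      C_lower[OF le] C_lower[OF le'] C_lower[OF order_refl] C_lo_def
    by (simp add: algebra_simps add_divide_distrib diff_divide_distrib)
qed

lemma spine_value_eq: "B (x + \<epsilon>, T (x + \<epsilon>)) = spine_value p q \<epsilon> (x + \<epsilon>) (T (x + \<epsilon>))"
proof -
  have w: "(\<alpha> x - \<beta> x + 2 * \<epsilon>) / 2 = \<epsilon> + \<tau> x" using \<alpha>_\<beta>[of x] by simp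
  have ab: "x + \<tau> x = \<alpha> x" "x - \<tau> x = \<beta> x" by (simp_all add: \<alpha>_def \<beta>_def)
  have "spine_value p q \<epsilon> (x + \<epsilon>) (T (x + \<epsilon>))
      = (\<epsilon>\<^sup>2 - (\<tau> x)\<^sup>2) / (2 * \<epsilon> * \<tau> x) * E x + ((\<epsilon> + \<tau> x) * p (\<alpha> x) + (\<epsilon> - \<tau> x) * q (\<beta> x)) / (2 * \<epsilon>)"
    unfolding spine_value_def deriv_eqs T_def E_def by (simp add: ab)
  also have "\<dots> = q (\<beta> x) + m x * (\<epsilon> + \<tau> x)"
    unfolding m_def using \<tau>_ne[of x] \<epsilon>_pos by (simp add: field_simps power2_eq_square)
  also have "\<dots> = B (x + \<epsilon>, T (x + \<epsilon>))"
    by (simp add: B_def \<Phi>_spine C_lower C_lo_def w M_def binv)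
  finally show ?thesis by simp
qed

lemma \<Phi>_inj: "\<Phi> z = \<Phi> w \<Longrightarrow> z = w"
  by (auto simp: \<Phi>_def prod_eq_iff)

text \<open>A point of the parallelogram lies on the lower rib with its label \<open>b\<close> if it is below the spine,
  and on the upper rib with its label \<open>r\<close> otherwise.\<close>

lemma domain_eq: "herringbone_domain \<epsilon> (ul + \<epsilon>) (ur + \<epsilon>) T = Omega_R \<epsilon> ul ur"
proof -
  have Om: "z \<in> Omega_R \<epsilon> ul ur \<longleftrightarrow> snd (\<Phi> z) \<in> {bl..br} \<and> \<bar>fst (\<Phi> z) - snd (\<Phi> z)\<bar> \<le> 2 * \<epsilon>" for z
    by (cases z) (auto simp: \<Phi>_def Omega_R_def bl_def br_def abs_le_iff)
  have dom: "herringbone_domain \<epsilon> (ul + \<epsilon>) (ur + \<epsilon>) T =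
    (\<Union>x\<in>{ul..ur}. closed_segment (x + \<epsilon>, T (x + \<epsilon>)) (upper_end \<epsilon> T (x + \<epsilon>))
      \<union> closed_segment (x + \<epsilon>, T (x + \<epsilon>)) (lower_end \<epsilon> T (x + \<epsilon>)))"
  proof -
    have "{ul + \<epsilon>..ur + \<epsilon>} = (\<lambda>x. x + \<epsilon>) ` {ul..ur}" by simp
    thus ?thesis unfolding herringbone_domain_def by (simp only: UN_simps(10))
  qed
  show ?thesis
  proof (intro subset_antisym subsetI)
    fix z assume "z \<in> herringbone_domain \<epsilon> (ul + \<epsilon>) (ur + \<epsilon>) T"
    then obtain x where x: "x \<in> {ul..ur}" and
      z: "z \<in> closed_segment (x + \<epsilon>, T (x + \<epsilon>)) (upper_end \<epsilon> T (x + \<epsilon>))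
        \<union> closed_segment (x + \<epsilon>, T (x + \<epsilon>)) (lower_end \<epsilon> T (x + \<epsilon>))"
      unfolding dom by blast
    have mono: "bl \<le> \<beta> x" "\<beta> x \<le> br" "al \<le> \<alpha> x"
      using x strict_mono_less_eq[OF \<alpha>_mono] strict_mono_less_eq[OF \<beta>_mono] by (auto simp: ends[symmetric])
    have "(x + \<epsilon>, T (x + \<epsilon>)) \<in> Omega_R \<epsilon> ul ur" "upper_end \<epsilon> T (x + \<epsilon>) \<in> Omega_R \<epsilon> ul ur"
      "lower_end \<epsilon> T (x + \<epsilon>) \<in> Omega_R \<epsilon> ul ur"
      unfolding Om \<Phi>_spine \<Phi>_upper_end \<Phi>_lower_end fst_conv snd_conv
      using mono \<alpha>_\<beta>[of x] \<tau>_bounds[of x] \<epsilon>_pos by (auto simp: al_def bl_def br_def)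
    thus "z \<in> Omega_R \<epsilon> ul ur" using z closed_segment_subset[OF _ _ convex_Omega_R] by blast
  next
    fix z assume "z \<in> Omega_R \<epsilon> ul ur"
    then obtain r b where rb: "\<Phi> z = (r, b)" "b \<in> {bl..br}" "\<bar>r - b\<bar> \<le> 2 * \<epsilon>"
      unfolding Om by (metis prod.collapse)
    show "z \<in> herringbone_domain \<epsilon> (ul + \<epsilon>) (ur + \<epsilon>) T"
    proof (cases "r \<le> A b")
      case True
      define x where "x = binv b"
      have x: "x \<in> {ul..ur}" using rb by (auto simp: x_def binv_less ends)
      have b: "b = \<beta> x" "A b = \<alpha> x" by (simp_all add: x_def binv A_def)
      define t where "t = (\<alpha> x - r) / (\<alpha> x - \<beta> x + 2 * \<epsilon>)"
      have pos: "0 < \<alpha> x - \<beta> x + 2 * \<epsilon>" using \<alpha>_\<beta>[of x] \<tau>_bounds[of x] \<epsilon>_pos by simp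
      have t: "0 \<le> t" "t \<le> 1" "t * (\<alpha> x - \<beta> x + 2 * \<epsilon>) = \<alpha> x - r"
        unfolding t_def using pos True rb b by (auto simp: abs_le_iff divide_le_eq_1)
      have "\<Phi> z = \<Phi> ((1 - t) *\<^sub>R (x + \<epsilon>, T (x + \<epsilon>)) + t *\<^sub>R lower_end \<epsilon> T (x + \<epsilon>))"
        unfolding \<Phi>_aff \<Phi>_spine \<Phi>_lower_end rb(1) using t(3) b by (simp add: algebra_simps)
      hence "z \<in> closed_segment (x + \<epsilon>, T (x + \<epsilon>)) (lower_end \<epsilon> T (x + \<epsilon>))"
        using t \<Phi>_inj unfolding in_segment by blast
      thus ?thesis unfolding dom using x by blast
    next
      case False
      define x where "x = ainv r"
      have r: "r = \<alpha> x" by (simp add: x_def ainv)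
      have "binv b < x" using False by (simp add: x_def ainv_less A_def)
      hence b: "b < \<beta> x" by (simp add: binv_less)
      have "al \<le> A b" using rb strict_mono_less_eq[OF \<alpha>_mono, of ul "binv b"]
        by (simp add: ends[symmetric] A_def binv_less)
      hence x: "x \<in> {ul..ur}" using False rb
        by (auto simp: x_def ainv_less ends al_def ar_def br_def)
      have pos: "0 < \<beta> x - (\<alpha> x - 2 * \<epsilon>)" using b rb r by auto
      define t where "t = (\<beta> x - b) / (\<beta> x - (\<alpha> x - 2 * \<epsilon>))"
      have t: "0 \<le> t" "t \<le> 1" "t * (\<beta> x - (\<alpha> x - 2 * \<epsilon>)) = \<beta> x - b"
        unfolding t_def using pos b rb r by (auto simp: abs_le_iff divide_le_eq_1)
      have "\<Phi> z = \<Phi> ((1 - t) *\<^sub>R (x + \<epsilon>, T (x + \<epsilon>)) + t *\<^sub>R upper_end \<epsilon> T (x + \<epsilon>))"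
        unfolding \<Phi>_aff \<Phi>_spine \<Phi>_upper_end rb(1) using t(3) r by (simp add: algebra_simps)
      hence "z \<in> closed_segment (x + \<epsilon>, T (x + \<epsilon>)) (upper_end \<epsilon> T (x + \<epsilon>))"
        using t \<Phi>_inj unfolding in_segment by blast
      thus ?thesis unfolding dom using x by blast
    qed
  qed
qed

lemma herringbone: "left_herringbone_candidate p q \<epsilon> (ul + \<epsilon>) (ur + \<epsilon>) T B"
  unfolding left_herringbone_candidate_def domain_eq
proof (intro conjI left_spine ballI)
  have sub: "Omega_R \<epsilon> ul ur \<subseteq> Omega_R \<epsilon> u1 u2" by (intro subset_Omega u1_ul ur_u2)
  show "diag_concave_on (Omega_R \<epsilon> ul ur) B" by (rule diag_subset[OF B_diag sub])
  show "C1_smooth_on (Omega_R \<epsilon> ul ur) B"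
    using B_C1 sub unfolding C1_smooth_on_def
    by (meson continuous_on_subset has_derivative_subset subset_eq)
  show "boundary_values p q \<epsilon> (Omega_R \<epsilon> ul ur) B"
    using B_boundary sub unfolding boundary_values_def by blast
  fix u assume "u \<in> {ul + \<epsilon>..ur + \<epsilon>}"
  then obtain x where x: "u = x + \<epsilon>" "x \<in> {ul..ur}" by (auto intro: that[of "u - \<epsilon>"])
  show "affine_on_segment (u, T u) (upper_end \<epsilon> T u) B" "affine_on_segment (u, T u) (lower_end \<epsilon> T u) B"
    unfolding x(1) by (rule affine_upper[OF x(2)] affine_lower)+
  show "if T u \<noteq> 0 then B (u, T u) = spine_value p q \<epsilon> u (T u)
    else ((\<lambda>v. spine_value p q \<epsilon> v (T v)) \<longlongrightarrow> B (u, T u))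
      (at u within {v \<in> {ul + \<epsilon>..ur + \<epsilon>}. T v \<noteq> 0})"
    using spine_value_eq[of x] \<tau>_ne[of x] by (simp add: x(1)) (simp add: T_def)
qed

lemma T_ends: "T (ul + \<epsilon>) = \<epsilon>" "T (ur + \<epsilon>) = \<epsilon>" "T u \<noteq> 0"
  using \<tau>_ne by (simp_all add: T_def \<tau>_out)

end

section \<open>Existence of the spine\<close>

text \<open>The hypotheses say that, in a small box around the bifurcation point, \<open>Dp\<close> is nearly linear in the vertical
  variable and \<open>Dm\<close> is nearly constant, with the relation between their sizes that holds there: the vertical derivative of \<open>Dp\<close> is close to
  \<open>- k\<close> and \<open>Dm\<close> is close to \<open>k * e0\<close>. The box has to reach down to \<open>zl\<close>, below the upper barrier.\<close>

lemma spine_exists: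
  fixes p1 q1 p2 q2 g g' :: "real \<Rightarrow> real" and dz :: "real \<Rightarrow> real \<Rightarrow> real"
    and \<epsilon> e0 zl k ul ur :: real
  defines "Dp \<equiv> \<lambda>x z. slope p1 q1 (x + z) (x - z) - p2 (x + z)"
    and "Dm \<equiv> \<lambda>x z. slope p1 q1 (x + z) (x - z) - q2 (x - z)"
  assumes cont: "continuous_on UNIV p1" "continuous_on UNIV q1" "continuous_on UNIV p2" "continuous_on UNIV q2"
    and ul_ur: "ul < ur" and k: "0 < k" and e0: "0 < e0"
    and zl: "49/50 * e0 \<le> zl" "zl \<le> \<epsilon>" and \<epsilon>: "\<epsilon> \<le> 51/50 * e0"
    and g: "\<And>x. x \<in> {ul..ur} \<Longrightarrow> g x = Dp x \<epsilon>" "g ul = 0" "g ur = 0" "\<And>x. x \<in> {ul<..<ur} \<Longrightarrow> g x < 0"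
    and g_deriv: "\<And>x. x \<in> {ul..ur} \<Longrightarrow> (g has_real_derivative g' x) (at x) \<and> \<bar>g' x\<bar> \<le> k / 50"
    and g_small: "\<And>x. x \<in> {ul..ur} \<Longrightarrow> - (4 / k) * g x \<le> \<epsilon> - zl"
    and dz: "\<And>x z. x \<in> {ul..ur} \<Longrightarrow> z \<in> {zl..\<epsilon>} \<Longrightarrow>
      (Dp x has_real_derivative dz x z) (at z) \<and> \<bar>dz x z + k\<bar> \<le> k / 50"
    and Dm: "\<And>x z. x \<in> {ul..ur} \<Longrightarrow> z \<in> {zl..\<epsilon>} \<Longrightarrow> \<bar>Dm x z - k * e0\<bar> \<le> k * e0 / 50"
  shows "\<exists>\<tau> \<tau>'. continuous_on UNIV \<tau> \<and> continuous_on {ul<..<ur} \<tau>' \<and>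
    (\<forall>x. x \<notin> {ul<..<ur} \<longrightarrow> \<tau> x = \<epsilon>) \<and>
    (\<forall>x\<in>{ul<..<ur}. 0 < \<tau> x \<and> \<tau> x < \<epsilon> \<and> (\<tau> has_real_derivative \<tau>' x) (at x) \<and> \<bar>\<tau>' x\<bar> < 1 \<and>
      0 < Dp x (\<tau> x) \<and> 0 < Dm x (\<tau> x) \<and>
      (1 + \<tau>' x) * (\<epsilon> + \<tau> x) * Dp x (\<tau> x) = (1 - \<tau>' x) * (\<epsilon> - \<tau> x) * Dm x (\<tau> x))"
proof -
  \<comment> \<open>In a small enough box any factors $1 < c_1 < 2 < c_2$ in place of 5/4 and 4 give barriers, since
    the field vanishes approximately on $y = - 2 g / k$ and $D_+$ on $y = - g / k$.\<close>
  define lo where "lo x = - (5 / (4 * k)) * g x" for x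
  define hi where "hi x = - (4 / k) * g x" for x
  have g_lo: "g x = - (4 / 5 * k) * lo x" and g_hi: "g x = - (k / 4) * hi x" for x
    using k by (simp_all add: lo_def hi_def)
  have lo_hi: "0 < lo x" "lo x \<le> hi x" "hi x \<le> \<epsilon> - zl" if x: "x \<in> {ul<..<ur}" for x
  proof -
    have "0 < (5 / (4 * k)) * (- g x)" using g(4)[OF x] k by (intro mult_pos_pos) auto
    thus "0 < lo x" by (simp add: lo_def)
    have "hi x = 16 / 5 * lo x" using k by (simp add: lo_def hi_def)
    thus "lo x \<le> hi x" using \<open>0 < lo x\<close> by simp
    show "hi x \<le> \<epsilon> - zl" using g_small[of x] x by (simp add: hi_def)
  qed
  define P where "P x y = (2 * \<epsilon> - y) * Dp x (\<epsilon> - y)" for x y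
  define Q where "Q x y = y * Dm x (\<epsilon> - y)" for x y
  define F where "F x y = (P x y - Q x y) / (P x y + Q x y)" for x y
  \<comment> \<open>The mean value theorem in the vertical variable, with the derivative in $[-51k/50, -49k/50]$.\<close>
  have Dp_est: "g x + 49/50 * k * y \<le> Dp x (\<epsilon> - y)" "Dp x (\<epsilon> - y) \<le> g x + 51/50 * k * y"
    if x: "x \<in> {ul<..<ur}" and y: "0 < y" "y \<le> \<epsilon> - zl" for x y
  proof -
    have "\<exists>z. \<epsilon> - y < z \<and> z < \<epsilon> \<and> Dp x \<epsilon> - Dp x (\<epsilon> - y) = (\<epsilon> - (\<epsilon> - y)) * dz x z"
      by (rule MVT2) (use dz[of x] x y in auto)
    then obtain z where z': "\<epsilon> - y < z" "z < \<epsilon>"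
      "Dp x \<epsilon> - Dp x (\<epsilon> - y) = (\<epsilon> - (\<epsilon> - y)) * dz x z" by blast
    hence z: "z \<in> {zl..\<epsilon>}" "Dp x \<epsilon> - Dp x (\<epsilon> - y) = y * dz x z" using y by auto
    have "\<bar>dz x z + k\<bar> \<le> k / 50" using dz[of x z] x z(1) by auto
    hence "- (51/50 * k) \<le> dz x z" "dz x z \<le> - (49/50 * k)" unfolding abs_le_iff by linarith+
    hence "y * (- (51/50 * k)) \<le> y * dz x z" "y * dz x z \<le> y * (- (49/50 * k))"
      using y by (intro mult_left_mono; simp)+
    thus "g x + 49/50 * k * y \<le> Dp x (\<epsilon> - y)" "Dp x (\<epsilon> - y) \<le> g x + 51/50 * k * y"
      using z(2) g(1)[of x] x by (simp_all add: algebra_simps)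
  qed
  have Dm_est: "49/50 * (k * e0) \<le> Dm x (\<epsilon> - y)" "Dm x (\<epsilon> - y) \<le> 51/50 * (k * e0)"
    if x: "x \<in> {ul<..<ur}" and y: "0 < y" "y \<le> \<epsilon> - zl" for x y
  proof -
    have "\<bar>Dm x (\<epsilon> - y) - k * e0\<bar> \<le> k * e0 / 50" using x y by (intro Dm) auto
    thus "49/50 * (k * e0) \<le> Dm x (\<epsilon> - y)" "Dm x (\<epsilon> - y) \<le> 51/50 * (k * e0)"
      unfolding abs_le_iff by linarith+
  qed
  have ke: "0 < k * e0" using k e0 by simp
  have Q_pos: "0 < Q x y" if x: "x \<in> {ul<..<ur}" and y: "0 < y" "y \<le> \<epsilon> - zl" for x y
    using Dm_est(1)[OF that] ke y unfolding Q_def by (intro mult_pos_pos) auto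
  have P_pos: "0 < P x y" if x: "x \<in> {ul<..<ur}" and y: "lo x \<le> y" "y \<le> \<epsilon> - zl" for x y
  proof -
    have y0: "0 < y" using lo_hi[OF x] y by simp
    have "0 < 9/50 * k * y" using k y0 by simp
    also have "\<dots> = - (4/5 * k) * y + 49/50 * k * y" by (simp add: algebra_simps)
    also have "\<dots> \<le> g x + 49/50 * k * y" unfolding g_lo using k y by (simp add: mult_left_mono)
    also have "\<dots> \<le> Dp x (\<epsilon> - y)" by (rule Dp_est[OF x y0 y(2)])
    finally have "0 < Dp x (\<epsilon> - y)" .
    moreover have "0 < 2 * \<epsilon> - y" using y zl e0 by simp
    ultimately show ?thesis unfolding P_def by simp
  qed
  have F_lo: "F x (lo x) \<le> - (1/3)" if x: "x \<in> {ul<..<ur}" for x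
  proof -
    define y where "y = lo x"
    have y: "0 < y" "y \<le> \<epsilon> - zl" "lo x \<le> y" using lo_hi[OF x] by (auto simp: y_def)
    have "Dp x (\<epsilon> - y) \<le> - (4/5 * k) * y + 51/50 * k * y" using Dp_est(2)[OF x y(1,2)] g_lo[of x] by (simp add: y_def)
    also have "\<dots> = 11/50 * k * y" by (simp add: algebra_simps)
    finally have "P x y \<le> (2 * \<epsilon> - y) * (11/50 * k * y)" unfolding P_def
      by (rule mult_left_mono) (use y zl e0 in auto)
    also have "\<dots> \<le> (102/50 * e0) * (11/50 * k * y)" by (rule mult_right_mono) (use \<epsilon> y k in auto)
    also have "\<dots> \<le> y * (49/50 * (k * e0)) / 2" using mult_pos_pos[OF y(1) ke] by (simp add: algebra_simps)
    also have "\<dots> \<le> Q x y / 2" unfolding Q_def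
      by (intro divide_right_mono mult_left_mono Dm_est[OF x y(1,2)]) (use y in auto)
    finally have half: "P x y \<le> Q x y / 2" .
    have "0 < P x y + Q x y" using P_pos[OF x y(3,2)] Q_pos[OF x y(1,2)] by simp
    moreover have "- (1/3) * (P x y + Q x y) = - (P x y / 3) - Q x y / 3" by (simp add: field_simps)
    ultimately have "F x y \<le> - (1/3)" unfolding F_def using half by (subst pos_divide_le_eq) linarith+
    thus ?thesis by (simp add: y_def)
  qed
  have F_hi: "1/7 \<le> F x (hi x)" if x: "x \<in> {ul<..<ur}" for x
  proof -
    define y where "y = hi x"
    have y: "0 < y" "y \<le> \<epsilon> - zl" "lo x \<le> y" using lo_hi[OF x] by (auto simp: y_def)
    have "y * (51/50 * (k * e0)) * (4/3) \<le> (98/50 * e0) * (73/100 * k * y)"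
      using mult_pos_pos[OF y(1) ke] by (simp add: algebra_simps)
    also have "\<dots> \<le> (2 * \<epsilon> - y) * (73/100 * k * y)" by (rule mult_right_mono) (use zl y k in auto)
    also have "\<dots> \<le> P x y" unfolding P_def
    proof (rule mult_left_mono)
      have "73/100 * k * y = - (k/4) * y + 49/50 * k * y" by (simp add: algebra_simps)
      also have "\<dots> \<le> Dp x (\<epsilon> - y)" using Dp_est(1)[OF x y(1,2)] g_hi[of x] by (simp add: y_def)
      finally show "73/100 * k * y \<le> Dp x (\<epsilon> - y)" .
    qed (use y zl e0 in auto)
    finally have "y * (51/50 * (k * e0)) * (4/3) \<le> P x y" .
    moreover have "Q x y * (4/3) \<le> y * (51/50 * (k * e0)) * (4/3)"
      using Dm_est(2)[OF x y(1,2)] y(1) unfolding Q_def by (intro mult_right_mono mult_left_mono) auto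
    ultimately have PQ: "Q x y * (4/3) \<le> P x y" by (rule order.trans[rotated])
    have "0 < P x y + Q x y" using P_pos[OF x y(3,2)] Q_pos[OF x y(1,2)] by simp
    moreover have "1/7 * (P x y + Q x y) = P x y / 7 + Q x y / 7" by (simp add: field_simps)
    ultimately have "1/7 \<le> F x y" unfolding F_def using PQ by (subst pos_le_divide_eq) linarith+
    thus ?thesis by (simp add: y_def)
  qed
  \<comment> \<open>The field is only controlled between the barriers, hence it is clamped to that region. This
    makes it bounded and continuous on the whole open strip.\<close>
  define cl where "cl x y = max (lo x) (min (hi x) y)" for x y
  have cl: "lo x \<le> cl x y" "cl x y \<le> hi x" if "x \<in> {ul<..<ur}" for x y
    using lo_hi[OF that] by (auto simp: cl_def)
  have PQ: "0 < P x y" "0 < Q x y" if "x \<in> {ul<..<ur}" "lo x \<le> y" "y \<le> hi x" for x y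
    using P_pos[of x y] Q_pos[of x y] lo_hi[OF that(1)] that by auto
  define R where "R = {z. fst z \<in> {ul<..<ur} \<and> lo (fst z) \<le> snd z \<and> snd z \<le> hi (fst z)}"
  have g_cont: "continuous_on {ul..ur} g" using g_deriv by (meson DERIV_isCont continuous_at_imp_continuous_on)
  have Rz: "0 < \<epsilon> - snd z" if "z \<in> R" for z using that lo_hi[of "fst z"] zl e0 by (auto simp: R_def)
  have slope_cont: "continuous_on R (\<lambda>z. slope p1 q1 (fst z + (\<epsilon> - snd z)) (fst z - (\<epsilon> - snd z)))"
    unfolding slope_def
    by (intro continuous_intros continuous_on_compose2[OF cont(1)] continuous_on_compose2[OF cont(2)])
      (use Rz in fastforce)+
  have PQ_cont: "continuous_on R (\<lambda>z. P (fst z) (snd z))" "continuous_on R (\<lambda>z. Q (fst z) (snd z))"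
    unfolding P_def Q_def Dp_def Dm_def
    by (intro continuous_intros slope_cont continuous_on_compose2[OF cont(3)] continuous_on_compose2[OF cont(4)]; simp)+
  have F_cont: "continuous_on R (\<lambda>z. F (fst z) (snd z))"
    unfolding F_def
  proof (intro continuous_intros PQ_cont ballI)
    fix z assume "z \<in> R"
    thus "P (fst z) (snd z) + Q (fst z) (snd z) \<noteq> 0" using PQ[of "fst z" "snd z"] by (auto simp: R_def)
  qed
  have lo_hi_cont: "continuous_on {ul..ur} lo" "continuous_on {ul..ur} hi"
    unfolding lo_def[abs_def] hi_def[abs_def] by (intro continuous_intros g_cont)+
  have "continuous_on ({ul<..<ur} \<times> UNIV) (\<lambda>z. (fst z, cl (fst z) (snd z)))"
    unfolding cl_def
    by (intro continuous_intros continuous_on_compose2[OF lo_hi_cont(1)] continuous_on_compose2[OF lo_hi_cont(2)]) auto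
  note cl_cont = this
  have Fc_cont: "continuous_on ({ul<..<ur} \<times> UNIV) (\<lambda>z. F (fst z) (cl (fst z) (snd z)))"
  proof -
    have "(\<lambda>z. (fst z, cl (fst z) (snd z))) ` ({ul<..<ur} \<times> UNIV) \<subseteq> R" using cl by (auto simp: R_def)
    from continuous_on_compose2[OF F_cont cl_cont this] show ?thesis by simp
  qed
  have F_abs: "\<bar>F x y\<bar> < 1" if "0 < P x y" "0 < Q x y" for x y
    using that unfolding F_def by (simp add: abs_less_iff pos_divide_less_eq pos_less_divide_eq)
  have F_bound: "\<bar>F x (cl x y)\<bar> \<le> 1" if x: "x \<in> {ul<..<ur}" for x y
    using F_abs[OF PQ[OF x cl[OF x]]] by (simp add: less_imp_le)
  obtain Y where Y: "continuous_on {ul..ur} Y" "Y ur = 0"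
    "\<And>x. x \<in> {ul<..<ur} \<Longrightarrow> (Y has_real_derivative F x (cl x (Y x))) (at x)"
    using peano_backward[OF ul_ur Fc_cont, of 0] F_bound by auto
  have lo': "(lo has_real_derivative - (5 / (4 * k)) * g' x) (at x)"
    and hi': "(hi has_real_derivative - (4 / k) * g' x) (at x)" if "x \<in> {ul<..<ur}" for x
    unfolding lo_def[abs_def] hi_def[abs_def]
    by (intro DERIV_cmult conjunct1[OF g_deriv]; use that in auto)+
  have g'_est: "- (1/3) \<le> - (5 / (4 * k)) * g' x" "- (4 / k) * g' x \<le> 1/7" if "x \<in> {ul<..<ur}" for x
  proof -
    have "\<bar>g' x\<bar> \<le> k / 50" using g_deriv[of x] that by auto
    hence b: "g' x \<le> k / 50" "- (k / 50) \<le> g' x" unfolding abs_le_iff by linarith+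
    have "(5 / (4 * k)) * g' x \<le> (5 / (4 * k)) * (k / 50)" using b k by (intro mult_left_mono) auto
    thus "- (1/3) \<le> - (5 / (4 * k)) * g' x" using k by simp
    have "(4 / k) * (- (k / 50)) \<le> (4 / k) * g' x" using b k by (intro mult_left_mono) auto
    thus "- (4 / k) * g' x \<le> 1/7" using k by simp
  qed
  have Y_lo: "lo x \<le> Y x" if "x \<in> {ul..ur}" for x
  proof -
    have "0 \<le> Y x - lo x"
    proof (rule nonneg_backward[where f = "\<lambda>x. Y x - lo x" and a = ul and b = ur])
      show "continuous_on {ul..ur} (\<lambda>x. Y x - lo x)" by (intro continuous_intros Y lo_hi_cont)
      show "0 \<le> Y ur - lo ur" by (simp add: Y lo_def g)
      fix x assume x: "x \<in> {ul<..<ur}" and "Y x - lo x < 0"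
      hence "cl x (Y x) = lo x" using lo_hi[OF x] by (simp add: cl_def)
      hence "((\<lambda>x. Y x - lo x) has_real_derivative F x (lo x) - (- (5 / (4 * k)) * g' x)) (at x)"
        using DERIV_diff[OF Y(3)[OF x] lo'[OF x]] by simp
      moreover have "F x (lo x) - (- (5 / (4 * k)) * g' x) \<le> 0" using F_lo[OF x] g'_est(1)[OF x] by linarith
      ultimately show "\<exists>y\<le>0. ((\<lambda>x. Y x - lo x) has_real_derivative y) (at x)" by blast
    qed (rule that)
    thus ?thesis by simp
  qed
  have Y_hi: "Y x \<le> hi x" if "x \<in> {ul..ur}" for x
  proof -
    have "0 \<le> hi x - Y x"
    proof (rule nonneg_backward[where f = "\<lambda>x. hi x - Y x" and a = ul and b = ur])
      show "continuous_on {ul..ur} (\<lambda>x. hi x - Y x)" by (intro continuous_intros Y lo_hi_cont)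
      show "0 \<le> hi ur - Y ur" by (simp add: Y hi_def g)
      fix x assume x: "x \<in> {ul<..<ur}" and "hi x - Y x < 0"
      hence "cl x (Y x) = hi x" using lo_hi[OF x] by (simp add: cl_def)
      hence "((\<lambda>x. hi x - Y x) has_real_derivative - (4 / k) * g' x - F x (hi x)) (at x)"
        using DERIV_diff[OF hi'[OF x] Y(3)[OF x]] by simp
      moreover have "- (4 / k) * g' x - F x (hi x) \<le> 0" using F_hi[OF x] g'_est(2)[OF x] by linarith
      ultimately show "\<exists>y\<le>0. ((\<lambda>x. hi x - Y x) has_real_derivative y) (at x)" by blast
    qed (rule that)
    thus ?thesis by simp
  qed
  have "Y ul = 0" using Y_lo[of ul] Y_hi[of ul] ul_ur by (simp add: lo_def hi_def g)
  have Y_in: "lo x \<le> Y x" "Y x \<le> hi x" "0 < Y x" "Y x \<le> \<epsilon> - zl" if x: "x \<in> {ul<..<ur}" for x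
  proof -
    show *: "lo x \<le> Y x" "Y x \<le> hi x" using Y_lo[of x] Y_hi[of x] x by auto
    show "0 < Y x" "Y x \<le> \<epsilon> - zl" using * lo_hi[OF x] by auto
  qed
  define \<tau> where "\<tau> x = \<epsilon> - Y (max ul (min ur x))" for x
  define \<tau>' where "\<tau>' x = - F x (Y x)" for x
  have \<tau>_in: "\<tau> x = \<epsilon> - Y x" if "x \<in> {ul<..<ur}" for x using that by (simp add: \<tau>_def)
  show ?thesis
  proof (rule exI[of _ \<tau>], rule exI[of _ \<tau>'], intro conjI allI impI ballI)
    show "continuous_on UNIV \<tau>" unfolding \<tau>_def[abs_def] using ul_ur
      by (intro continuous_intros continuous_on_compose2[OF Y(1)]) auto
    show "\<tau> x = \<epsilon>" if "x \<notin> {ul<..<ur}" for x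
    proof -
      have "max ul (min ur x) = ul \<or> max ul (min ur x) = ur" using that ul_ur by auto
      thus ?thesis using \<open>Y ul = 0\<close> \<open>Y ur = 0\<close> by (auto simp: \<tau>_def)
    qed
    show "continuous_on {ul<..<ur} \<tau>'"
    proof -
      have "continuous_on {ul<..<ur} (\<lambda>x. (x, Y x))"
        by (intro continuous_intros continuous_on_subset[OF Y(1)]) auto
      moreover have "(\<lambda>x. (x, Y x)) ` {ul<..<ur} \<subseteq> R" using Y_in by (auto simp: R_def)
      ultimately have "continuous_on {ul<..<ur} (\<lambda>x. F (fst (x, Y x)) (snd (x, Y x)))"
        by (rule continuous_on_compose2[OF F_cont])
      hence "continuous_on {ul<..<ur} (\<lambda>x. F x (Y x))" by simp
      thus ?thesis unfolding \<tau>'_def[abs_def] by (intro continuous_intros)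
    qed
    fix x assume x: "x \<in> {ul<..<ur}"
    have pq: "0 < P x (Y x)" "0 < Q x (Y x)" by (rule PQ[OF x Y_in(1,2)[OF x]])+
    show "0 < \<tau> x" "\<tau> x < \<epsilon>" using Y_in[OF x] zl e0 by (simp_all add: \<tau>_in[OF x])
    show "\<bar>\<tau>' x\<bar> < 1" using F_abs[OF pq] by (simp add: \<tau>'_def)
    have "cl x (Y x) = Y x" using Y_in[OF x] by (simp add: cl_def)
    hence "((\<lambda>x. \<epsilon> - Y x) has_real_derivative 0 - F x (Y x)) (at x)"
      using DERIV_diff[OF DERIV_const Y(3)[OF x]] by simp
    hence "((\<lambda>x. \<epsilon> - Y x) has_real_derivative \<tau>' x) (at x)" by (simp add: \<tau>'_def)
    thus "(\<tau> has_real_derivative \<tau>' x) (at x)"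
      by (rule has_field_derivative_transform_within_open[of _ _ _ "{ul<..<ur}"])
        (use x in \<open>auto simp: \<tau>_in\<close>)
    have "0 < Dp x (\<epsilon> - Y x)"
    proof -
      have "0 < 2 * \<epsilon> - Y x" using Y_in[OF x] zl e0 by simp
      thus ?thesis using pq(1) unfolding P_def by (simp add: zero_less_mult_iff)
    qed
    moreover have "0 < Dm x (\<epsilon> - Y x)" using pq(2) Y_in[OF x] unfolding Q_def by (simp add: zero_less_mult_iff)
    ultimately show "0 < Dp x (\<tau> x)" "0 < Dm x (\<tau> x)" by (simp_all add: \<tau>_in[OF x])
    have e: "1 + \<tau>' x = 2 * Q x (Y x) / (P x (Y x) + Q x (Y x))"
      "1 - \<tau>' x = 2 * P x (Y x) / (P x (Y x) + Q x (Y x))"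
      unfolding \<tau>'_def F_def using pq by (simp_all add: field_simps)
    have "(1 + \<tau>' x) * P x (Y x) = (1 - \<tau>' x) * Q x (Y x)" unfolding e by simp
    thus "(1 + \<tau>' x) * (\<epsilon> + \<tau> x) * Dp x (\<tau> x) = (1 - \<tau>' x) * (\<epsilon> - \<tau> x) * Dm x (\<tau> x)"
      unfolding P_def Q_def \<tau>_in[OF x] by (simp add: mult.assoc)
  qed
qed

section \<open>The bifurcation of the roots\<close>

lemma C_k_deriv:
  assumes "C_k k f" "i < k"
  shows "((deriv ^^ i) f has_real_derivative (deriv ^^ Suc i) f x) (at x)"
proof -
  have "(deriv ^^ i) f differentiable (at x)"
    using assms by (auto simp: C_k_def differentiable_on_def)
  thus ?thesis by (simp add: DERIV_deriv_iff_real_differentiable)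
qed

lemma convex_on_between_neg:
  fixes g :: "real \<Rightarrow> real"
  assumes g: "convex_on I g" and I: "x \<in> I" "z \<in> I" and "x < y" "y < z"
    and neg: "g x \<le> 0" "g z \<le> 0" "g x < 0 \<or> g z < 0"
  shows "g y < 0"
proof -
  define t where "t = (y - x) / (z - x)"
  have t: "0 < t" "t < 1" using assms by (auto simp: t_def)
  have "t * (z - x) = y - x" using assms by (simp add: t_def)
  hence "y = (1 - t) *\<^sub>R x + t *\<^sub>R z" by (simp add: algebra_simps)
  hence "g y \<le> (1 - t) * g x + t * g z" using convex_onD[OF g, of t x z] t I by simp
  also have "\<dots> < 0"
  proof (cases "g x < 0")
    case True
    hence "(1 - t) * g x < 0" "t * g z \<le> 0" using t neg by (auto simp: mult_less_0_iff mult_le_0_iff)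
    thus ?thesis by simp
  next
    case False
    hence "(1 - t) * g x \<le> 0" "t * g z < 0" using t neg by (auto simp: mult_less_0_iff mult_le_0_iff)
    thus ?thesis by simp
  qed
  finally show ?thesis .
qed

text \<open>Convexity gives the sign of the function on both sides of its roots, not only their number.\<close>

lemma convex_two_roots:
  fixes g :: "real \<Rightarrow> real"
  assumes g: "convex_on {a..b} g" and cont: "continuous_on {a..b} g"
    and c: "a < c" "c < b" "g c < 0" and ends: "0 < g a" "0 < g b"
  obtains l r where "a < l" "l < c" "c < r" "r < b" "g l = 0" "g r = 0"
    "\<And>x. x \<in> {l<..<r} \<Longrightarrow> g x < 0" "\<And>x. x \<in> {a..b} - {l<..<r} \<Longrightarrow> 0 \<le> g x"
proof -
  have "\<exists>l\<ge>a. l \<le> c \<and> g l = 0"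
    by (rule IVT2') (use c ends in \<open>auto intro!: continuous_on_subset[OF cont]\<close>)
  then obtain l where l: "a \<le> l" "l \<le> c" "g l = 0" by blast
  have "\<exists>r\<ge>c. r \<le> b \<and> g r = 0"
    by (rule IVT') (use c ends in \<open>auto intro!: continuous_on_subset[OF cont]\<close>)
  then obtain r where r: "c \<le> r" "r \<le> b" "g r = 0" by blast
  have lr: "a < l" "l < c" "c < r" "r < b" using l r c ends by (auto simp: less_le)
  show thesis
  proof (rule that[OF lr l(3) r(3)])
    fix x assume x: "x \<in> {l<..<r}"
    show "g x < 0"
    proof (cases x c rule: linorder_cases)
      case less
      thus ?thesis using convex_on_between_neg[OF g, of l c x] lr l c x by auto
    next
      case greater
      thus ?thesis using convex_on_between_neg[OF g, of c r x] lr r c x by auto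
    qed (use c in simp)
  next
    fix x assume x: "x \<in> {a..b} - {l<..<r}"
    show "0 \<le> g x"
    proof (rule ccontr)
      assume n: "\<not> 0 \<le> g x"
      hence "x \<noteq> l" "x \<noteq> r" using l r by auto
      then consider "x < l" | "r < x" using x by force
      thus False
      proof cases
        case 1
        thus False using convex_on_between_neg[OF g, of x c l] lr l c x n by auto
      next
        case 2
        thus False using convex_on_between_neg[OF g, of c x r] lr r c x n by auto
      qed
    qed
  qed
qed

lemma positive_near_compact:
  fixes f :: "real \<times> real \<Rightarrow> real"
  assumes f: "continuous_on (UNIV \<times> {0<..}) f" and K: "compact K" and e: "0 < e"
    and pos: "\<And>x. x \<in> K \<Longrightarrow> 0 < f (x, e)"
  obtains \<delta> where "0 < \<delta>" "\<And>x z. x \<in> K \<Longrightarrow> \<bar>z - e\<bar> < \<delta> \<Longrightarrow> 0 < f (x, z)"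
proof (cases "K = {}")
  case False
  have "continuous_on K (\<lambda>x. f (x, e))"
    by (rule continuous_on_compose2[OF f]) (use e in \<open>auto intro!: continuous_intros\<close>)
  then obtain x0 where x0: "x0 \<in> K" "\<And>x. x \<in> K \<Longrightarrow> f (x0, e) \<le> f (x, e)"
    using continuous_attains_inf[OF K False] by blast
  have "uniformly_continuous_on (K \<times> {e/2..2*e}) f"
    by (rule compact_uniformly_continuous[OF continuous_on_subset[OF f]])
      (use e in \<open>auto intro!: compact_Times K\<close>)
  then obtain d where d: "d > 0" "\<And>z w. z \<in> K \<times> {e/2..2*e} \<Longrightarrow> w \<in> K \<times> {e/2..2*e} \<Longrightarrow>
      dist w z < d \<Longrightarrow> dist (f w) (f z) < f (x0, e)"
    using pos[OF x0(1)] unfolding uniformly_continuous_on_def by metis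
  show thesis
  proof (rule that[of "min d (e/2)"])
    show "0 < min d (e / 2)" using d e by simp
    fix x z assume x: "x \<in> K" and z: "\<bar>z - e\<bar> < min d (e / 2)"
    hence "\<bar>z - e\<bar> < d" "\<bar>z - e\<bar> < e / 2" by simp_all
    hence z': "\<bar>z - e\<bar> < d" "z \<in> {e/2..2*e}" unfolding abs_less_iff atLeastAtMost_iff by linarith+
    have "dist (f (x, z)) (f (x, e)) < f (x0, e)"
      using x z' e by (intro d(2)) (auto simp: dist_Pair_Pair dist_real_def)
    thus "0 < f (x, z)" using x0(2)[OF x] by (simp add: dist_real_def abs_less_iff)
  qed
qed (use that[of 1] in simp)

lemma close_near_point:
  fixes f :: "real \<times> real \<Rightarrow> real"
  assumes f: "continuous_on (UNIV \<times> {0<..}) f" and e: "0 < e" and "0 < \<eta>"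
  shows "\<exists>r>0. \<forall>r'\<le>r. \<forall>x z. \<bar>x - u\<bar> \<le> r' \<longrightarrow> \<bar>z - e\<bar> \<le> r' \<longrightarrow> \<bar>f (x, z) - f (u, e)\<bar> < \<eta>"
proof -
  have op: "open (UNIV \<times> {0<..} :: (real \<times> real) set)" by (intro open_Times) auto
  have "isCont f (u, e)" using f e continuous_on_eq_continuous_at[OF op] by auto
  then obtain d where d: "d > 0" "\<And>w. dist w (u, e) < d \<Longrightarrow> dist (f w) (f (u, e)) < \<eta>"
    unfolding continuous_at_eps_delta using \<open>0 < \<eta>\<close> by metis
  show ?thesis
  proof (intro exI[of _ "d/3"] conjI allI impI)
    fix r' x z assume "r' \<le> d / 3" "\<bar>x - u\<bar> \<le> r'" "\<bar>z - e\<bar> \<le> r'"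
    hence "\<bar>x - u\<bar> + \<bar>z - e\<bar> < d" using d(1) by simp
    moreover have "dist (x, z) (u, e) \<le> \<bar>x - u\<bar> + \<bar>z - e\<bar>"
      unfolding dist_Pair_Pair dist_real_def by (rule order.trans[OF sqrt_sum_squares_le_sum_abs]) simp
    ultimately show "\<bar>f (x, z) - f (u, e)\<bar> < \<eta>" using d(2)[of "(x, z)"] by (simp add: dist_real_def)
  qed (use d in simp)
qed

text \<open>Four orders, because \<open>Dp_xx\<close>, which makes \<open>Dp\<close> convex near the bifurcation point, contains \<open>p4\<close>.\<close>

locale boundary_data =
  fixes p1 q1 p2 q2 p3 q3 p4 q4 :: "real \<Rightarrow> real"
  assumes p: "\<And>x. (p1 has_real_derivative p2 x) (at x)" "\<And>x. (p2 has_real_derivative p3 x) (at x)"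
      "\<And>x. (p3 has_real_derivative p4 x) (at x)" "continuous_on UNIV p4"
    and q: "\<And>x. (q1 has_real_derivative q2 x) (at x)" "\<And>x. (q2 has_real_derivative q3 x) (at x)"
      "\<And>x. (q3 has_real_derivative q4 x) (at x)" "continuous_on UNIV q4"
begin

definition "Dp x z = slope p1 q1 (x + z) (x - z) - p2 (x + z)"
definition "Dm x z = slope p1 q1 (x + z) (x - z) - q2 (x - z)"
text \<open>Derivatives of \<open>Dp\<close>. That the vertical one has this form, which ties it to \<open>Dm\<close>, fixes the
  constant \<open>k\<close> in the construction of the spine.\<close>

definition "Dp_x x z = (p2 (x + z) - q2 (x - z)) / (2 * z) - p3 (x + z)"
definition "Dp_xx x z = (p3 (x + z) - q3 (x - z)) / (2 * z) - p4 (x + z)"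
definition "Dp_z x z = Dp_x x z - Dm x z / z"

lemma pq_cont: "continuous_on UNIV p1" "continuous_on UNIV p2" "continuous_on UNIV p3"
  "continuous_on UNIV q1" "continuous_on UNIV q2" "continuous_on UNIV q3"
  using p q by (meson DERIV_isCont continuous_at_imp_continuous_on)+

lemma Dp_eq: "Dp x z = (p1 (x + z) - q1 (x - z)) / (2 * z) - p2 (x + z)"
  and Dm_eq: "Dm x z = (p1 (x + z) - q1 (x - z)) / (2 * z) - q2 (x - z)"
  by (simp_all add: Dp_def Dm_def slope_def)

lemmas pq_cont2 = pq_cont[THEN continuous_on_compose2] p(4)[THEN continuous_on_compose2]
  q(4)[THEN continuous_on_compose2]

lemma D_cont:
  "continuous_on (UNIV \<times> {0<..}) (\<lambda>w. Dp (fst w) (snd w))"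
  "continuous_on (UNIV \<times> {0<..}) (\<lambda>w. Dm (fst w) (snd w))"
  "continuous_on (UNIV \<times> {0<..}) (\<lambda>w. Dp_x (fst w) (snd w))"
  "continuous_on (UNIV \<times> {0<..}) (\<lambda>w. Dp_xx (fst w) (snd w))"
  "continuous_on (UNIV \<times> {0<..}) (\<lambda>w. Dp_z (fst w) (snd w))"
proof -
  show *: "continuous_on (UNIV \<times> {0<..}) (\<lambda>w. Dp (fst w) (snd w))"
    "continuous_on (UNIV \<times> {0<..}) (\<lambda>w. Dm (fst w) (snd w))"
    "continuous_on (UNIV \<times> {0<..}) (\<lambda>w. Dp_x (fst w) (snd w))"
    "continuous_on (UNIV \<times> {0<..}) (\<lambda>w. Dp_xx (fst w) (snd w))"
    unfolding Dp_eq Dm_eq Dp_x_def Dp_xx_def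
    by (intro continuous_intros pq_cont2; force)+
  show "continuous_on (UNIV \<times> {0<..}) (\<lambda>w. Dp_z (fst w) (snd w))"
    unfolding Dp_z_def by (intro continuous_intros *) auto
qed

lemma x_shift: "((\<lambda>x. x + z) has_real_derivative 1) (at (x::real))" "((\<lambda>x. x - z) has_real_derivative 1) (at x)"
  "((\<lambda>z. x + z) has_real_derivative 1) (at z)" "((\<lambda>z. x - z) has_real_derivative - 1) (at z)"
  by (auto intro!: derivative_eq_intros)

lemma Dp_deriv_x: "((\<lambda>x. Dp x z) has_real_derivative Dp_x x z) (at x)"
proof -
  have "((\<lambda>x. Dp x z) has_real_derivative (p2 (x + z) * 1 - q2 (x - z) * 1) / (2 * z) - p3 (x + z) * 1) (at x)"
    unfolding Dp_eq by (intro DERIV_diff DERIV_cdivide DERIV_chain2[OF p(1)] DERIV_chain2[OF p(2)]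
        DERIV_chain2[OF q(1)] x_shift)
  thus ?thesis by (simp add: Dp_x_def)
qed

lemma Dp_x_deriv_x: "((\<lambda>x. Dp_x x z) has_real_derivative Dp_xx x z) (at x)"
proof -
  have "((\<lambda>x. Dp_x x z) has_real_derivative (p3 (x + z) * 1 - q3 (x - z) * 1) / (2 * z) - p4 (x + z) * 1) (at x)"
    unfolding Dp_x_def by (intro DERIV_diff DERIV_cdivide DERIV_chain2[OF p(2)] DERIV_chain2[OF p(3)]
        DERIV_chain2[OF q(2)] x_shift)
  thus ?thesis by (simp add: Dp_xx_def)
qed

lemma Dp_deriv_z:
  assumes "z \<noteq> 0"
  shows "(Dp x has_real_derivative Dp_z x z) (at z)"
proof -
  have "(Dp x has_real_derivative
      ((p2 (x + z) * 1 - q2 (x - z) * (-1)) * (2 * z) - (p1 (x + z) - q1 (x - z)) * (2 * 1)) / (2 * z * (2 * z))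
      - p3 (x + z) * 1) (at z)"
    unfolding Dp_eq[abs_def] using assms
    by (intro DERIV_diff DERIV_divide DERIV_cmult DERIV_ident DERIV_chain2[OF p(1)] DERIV_chain2[OF p(2)]
        DERIV_chain2[OF q(1)] x_shift) auto
  moreover have "((p2 (x + z) * 1 - q2 (x - z) * (-1)) * (2 * z) - (p1 (x + z) - q1 (x - z)) * (2 * 1))
      / (2 * z * (2 * z)) - p3 (x + z) * 1 = Dp_z x z"
    unfolding Dp_z_def Dp_x_def Dm_eq using assms by (simp add: field_simps)
  ultimately show ?thesis by simp
qed

text \<open>Otherwise the function would decrease to the right of \<open>u0\<close> and become negative.\<close>

lemma Dp_xx_pos:
  assumes "u1 < u0" "u0 < u2" and nonneg: "\<And>u. u \<in> {u1..u2} \<Longrightarrow> 0 \<le> Dp u e"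
    and "Dp u0 e = 0" "Dp_x u0 e = 0" "Dp_xx u0 e \<noteq> 0"
  shows "0 < Dp_xx u0 e"
proof (rule ccontr)
  assume "\<not> 0 < Dp_xx u0 e"
  hence "Dp_xx u0 e < 0" using assms by simp
  from DERIV_neg_dec_right[OF Dp_x_deriv_x this] obtain d where
    d: "d > 0" "\<And>h. h > 0 \<Longrightarrow> h < d \<Longrightarrow> Dp_x (u0 + h) e < Dp_x u0 e" by blast
  define h where "h = min (d / 2) (u2 - u0)"
  have h: "0 < h" "h < d" "u0 + h \<le> u2" using d assms by (auto simp: h_def)
  have "\<exists>\<xi>. u0 < \<xi> \<and> \<xi> < u0 + h \<and> Dp (u0 + h) e - Dp u0 e = (u0 + h - u0) * Dp_x \<xi> e"
    by (rule MVT2) (use h Dp_deriv_x in auto)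
  then obtain \<xi> where \<xi>: "u0 < \<xi>" "\<xi> < u0 + h" "Dp (u0 + h) e = h * Dp_x \<xi> e" using assms by auto
  have "Dp_x \<xi> e < 0" using d(2)[of "\<xi> - u0"] \<xi> h assms by simp
  hence "Dp (u0 + h) e < 0" using \<xi>(3) h by (simp add: mult_less_0_iff)
  moreover have "u0 + h \<in> {u1..u2}" using h assms(1) by simp
  ultimately show False using nonneg[of "u0 + h"] by simp
qed

text \<open>All estimates that are needed for the spine hold in a box of radius \<open>r\<close> around \<open>(u0, e)\<close>. The
  depth of the negative part of \<open>Dp\<close> is at most a multiple of $\varepsilon - \varepsilon_0$, which
  keeps the barriers inside the box.\<close>

lemma bifurcation:
  assumes u: "u1 < u0" "u0 < u2" and e: "0 < e"
    and Dp0: "Dp u0 e = 0" "Dp_x u0 e = 0" "Dp_xx u0 e \<noteq> 0"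
    and Dp_pos: "\<And>u. u \<in> {u1..u2} - {u0} \<Longrightarrow> 0 < Dp u e"
    and Dm_pos: "\<And>u. u \<in> {u1..u2} \<Longrightarrow> 0 < Dm u e"
  obtains ep k where "e < ep" "0 < k" "\<And>\<epsilon>. \<epsilon> \<in> {e<..<ep} \<Longrightarrow>
    \<exists>ul ur zl. u1 < ul \<and> ul < ur \<and> ur < u2 \<and> 49/50 * e \<le> zl \<and> zl \<le> \<epsilon> \<and> \<epsilon> \<le> 51/50 * e \<and>
      Dp ul \<epsilon> = 0 \<and> Dp ur \<epsilon> = 0 \<and> (\<forall>x\<in>{ul<..<ur}. Dp x \<epsilon> < 0) \<and>
      (\<forall>x\<in>{u1..u2} - {ul<..<ur}. 0 \<le> Dp x \<epsilon>) \<and> (\<forall>x\<in>{u1..u2}. 0 < Dm x \<epsilon>) \<and>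
      (\<forall>x\<in>{ul..ur}. \<bar>Dp_x x \<epsilon>\<bar> \<le> k / 50 \<and> - (4 / k) * Dp x \<epsilon> \<le> \<epsilon> - zl) \<and>
      (\<forall>x\<in>{ul..ur}. \<forall>z\<in>{zl..\<epsilon>}. \<bar>Dp_z x z + k\<bar> \<le> k / 50 \<and> \<bar>Dm x z - k * e\<bar> \<le> k * e / 50)"
proof -
  define k where "k = Dm u0 e / e"
  have k: "0 < k" "k * e = Dm u0 e" using Dm_pos[of u0] u e by (simp_all add: k_def)
  have Dpz0: "Dp_z u0 e = - k" by (simp add: Dp_z_def Dp0 k_def)
  have nonneg: "0 \<le> Dp u e" if "u \<in> {u1..u2}" for u
    using Dp_pos[of u] Dp0 that by (cases "u = u0") auto
  have Dpxx0: "0 < Dp_xx u0 e" by (rule Dp_xx_pos[OF u nonneg Dp0])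
  have "0 < k * e / 50" using k(1) e by simp
  from close_near_point[OF D_cont(2) e this, of u0] obtain r1 where r1: "r1 > 0"
    "\<forall>r'\<le>r1. \<forall>x z. \<bar>x - u0\<bar> \<le> r' \<longrightarrow> \<bar>z - e\<bar> \<le> r' \<longrightarrow> \<bar>Dm x z - Dm u0 e\<bar> < k * e / 50"
    unfolding fst_conv snd_conv by (elim exE conjE)
  have "0 < k / 50" using k(1) by simp
  from close_near_point[OF D_cont(3) e this, of u0] obtain r2 where r2: "r2 > 0"
    "\<forall>r'\<le>r2. \<forall>x z. \<bar>x - u0\<bar> \<le> r' \<longrightarrow> \<bar>z - e\<bar> \<le> r' \<longrightarrow> \<bar>Dp_x x z - Dp_x u0 e\<bar> < k / 50"
    unfolding fst_conv snd_conv by (elim exE conjE)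
  have "0 < Dp_xx u0 e" using Dpxx0 by simp
  from close_near_point[OF D_cont(4) e this, of u0] obtain r3 where r3: "r3 > 0"
    "\<forall>r'\<le>r3. \<forall>x z. \<bar>x - u0\<bar> \<le> r' \<longrightarrow> \<bar>z - e\<bar> \<le> r' \<longrightarrow> \<bar>Dp_xx x z - Dp_xx u0 e\<bar> < Dp_xx u0 e"
    unfolding fst_conv snd_conv by (elim exE conjE)
  have "0 < k / 50" using k(1) by simp
  from close_near_point[OF D_cont(5) e this, of u0] obtain r4 where r4: "r4 > 0"
    "\<forall>r'\<le>r4. \<forall>x z. \<bar>x - u0\<bar> \<le> r' \<longrightarrow> \<bar>z - e\<bar> \<le> r' \<longrightarrow> \<bar>Dp_z x z - Dp_z u0 e\<bar> < k / 50"
    unfolding fst_conv snd_conv by (elim exE conjE)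
  define r where "r = min (min (min r1 r2) (min r3 r4)) (min (e / 50) (min ((u0 - u1) / 2) ((u2 - u0) / 2)))"
  have r_le: "r \<le> r1" "r \<le> r2" "r \<le> r3" "r \<le> r4" "r \<le> e / 50" "r \<le> (u0 - u1) / 2" "r \<le> (u2 - u0) / 2"
    unfolding r_def by linarith+
  have r: "0 < r" unfolding r_def min_less_iff_conj
    using r1(1) r2(1) r3(1) r4(1) e u by (intro conjI) simp_all
  have near: "\<bar>Dm x z - k * e\<bar> \<le> k * e / 50" "\<bar>Dp_x x z\<bar> \<le> k / 50" "0 < Dp_xx x z" "\<bar>Dp_z x z + k\<bar> \<le> k / 50"
    if "\<bar>x - u0\<bar> \<le> r" "\<bar>z - e\<bar> \<le> r" for x z
  proof -
    show "\<bar>Dm x z - k * e\<bar> \<le> k * e / 50" using r1(2) r_le(1) that k(2) by (metis less_imp_le)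
    have "\<bar>Dp_x x z - Dp_x u0 e\<bar> < k / 50" using r2(2) r_le(2) that by blast
    thus "\<bar>Dp_x x z\<bar> \<le> k / 50" using Dp0 by simp
    have "\<bar>Dp_xx x z - Dp_xx u0 e\<bar> < Dp_xx u0 e" using r3(2) r_le(3) that by blast
    thus "0 < Dp_xx x z" by (simp add: abs_less_iff)
    have "\<bar>Dp_z x z - Dp_z u0 e\<bar> < k / 50" using r4(2) r_le(4) that by blast
    thus "\<bar>Dp_z x z + k\<bar> \<le> k / 50" by (simp add: Dpz0)
  qed
  define K where "K = {u1..u0 - r} \<union> {u0 + r..u2}"
  have K: "compact K" by (auto simp: K_def)
  obtain \<delta>1 where \<delta>1: "0 < \<delta>1" "\<And>x z. x \<in> K \<Longrightarrow> \<bar>z - e\<bar> < \<delta>1 \<Longrightarrow> 0 < Dp x z"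
  proof (rule positive_near_compact[OF D_cont(1) K e])
    show "0 < Dp (fst (x, e)) (snd (x, e))" if "x \<in> K" for x
      using Dp_pos[of x] that r u by (auto simp: K_def)
  qed auto
  obtain \<delta>2 where \<delta>2: "0 < \<delta>2" "\<And>x z. x \<in> {u1..u2} \<Longrightarrow> \<bar>z - e\<bar> < \<delta>2 \<Longrightarrow> 0 < Dm x z"
    by (rule positive_near_compact[OF D_cont(2) compact_Icc e, of u1 u2]) (use Dm_pos in auto)
  define ep where "ep = e + min (min \<delta>1 \<delta>2) (r / 8)"
  show thesis
  proof (rule that)
    show "e < ep" using \<delta>1 \<delta>2 r by (simp add: ep_def)
    fix \<epsilon> assume "\<epsilon> \<in> {e<..<ep}"
    hence \<epsilon>: "0 < \<epsilon> - e" "\<epsilon> - e < \<delta>1" "\<epsilon> - e < \<delta>2" "\<epsilon> - e < r / 8" by (auto simp: ep_def)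
    define I where "I = {u0 - r..u0 + r}"
    have I: "\<bar>x - u0\<bar> \<le> r" if "x \<in> I" for x using that by (auto simp: I_def abs_le_iff)
    have \<epsilon>_near: "\<bar>\<epsilon> - e\<bar> \<le> r" using \<epsilon> r by simp
    have conv: "convex_on I (\<lambda>x. Dp x \<epsilon>)"
    proof (rule f''_ge0_imp_convex[where f' = "\<lambda>x. Dp_x x \<epsilon>" and f'' = "\<lambda>x. Dp_xx x \<epsilon>"])
      show "0 \<le> Dp_xx x \<epsilon>" if "x \<in> I" for x using near(3)[OF I[OF that] \<epsilon>_near] by simp
    qed (auto simp: I_def intro: Dp_deriv_x Dp_x_deriv_x)
    have cont: "continuous_on I (\<lambda>x. Dp x \<epsilon>)"
      using Dp_deriv_x by (meson DERIV_isCont continuous_at_imp_continuous_on)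
    \<comment> \<open>Here $\varepsilon - \varepsilon_0 > 0$ is multiplied by a vertical derivative in $[-51k/50, -49k/50]$.\<close>
    have drop: "Dp x \<epsilon> \<le> Dp x e - 49/50 * k * (\<epsilon> - e)" "Dp x e - 51/50 * k * (\<epsilon> - e) \<le> Dp x \<epsilon>" if x: "x \<in> I" for x
    proof -
      have "\<exists>z. e < z \<and> z < \<epsilon> \<and> Dp x \<epsilon> - Dp x e = (\<epsilon> - e) * Dp_z x z"
        by (rule MVT2) (use \<epsilon> e Dp_deriv_z in auto)
      then obtain z where z: "e < z" "z < \<epsilon>" "Dp x \<epsilon> - Dp x e = (\<epsilon> - e) * Dp_z x z" by blast
      have "\<bar>Dp_z x z + k\<bar> \<le> k / 50" by (rule near(4)[OF I[OF x]]) (use z \<epsilon> r in auto)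
      hence b: "Dp_z x z \<le> - (49/50 * k)" "- (51/50 * k) \<le> Dp_z x z" unfolding abs_le_iff by linarith+
      have "(\<epsilon> - e) * Dp_z x z \<le> (\<epsilon> - e) * - (49/50 * k)" "(\<epsilon> - e) * - (51/50 * k) \<le> (\<epsilon> - e) * Dp_z x z"
        using \<epsilon> b by (intro mult_left_mono; simp)+
      thus "Dp x \<epsilon> \<le> Dp x e - 49/50 * k * (\<epsilon> - e)" "Dp x e - 51/50 * k * (\<epsilon> - e) \<le> Dp x \<epsilon>"
        using z(3) by (simp_all add: algebra_simps)
    qed
    have "0 < 49/50 * k * (\<epsilon> - e)" using k \<epsilon> by simp
    hence neg: "Dp u0 \<epsilon> < 0" using drop(1)[of u0] Dp0 r by (simp add: I_def)
    have ends: "0 < Dp (u0 - r) \<epsilon>" "0 < Dp (u0 + r) \<epsilon>"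
      using \<delta>1(2) r_le \<epsilon> u by (auto simp: K_def)
    obtain ul ur where ul: "u0 - r < ul" "ul < u0" and ur: "u0 < ur" "ur < u0 + r"
      and roots: "Dp ul \<epsilon> = 0" "Dp ur \<epsilon> = 0"
      and inside: "\<And>x. x \<in> {ul<..<ur} \<Longrightarrow> Dp x \<epsilon> < 0"
      and outside: "\<And>x. x \<in> {u0 - r..u0 + r} - {ul<..<ur} \<Longrightarrow> 0 \<le> Dp x \<epsilon>"
      using convex_two_roots[OF conv[unfolded I_def] cont[unfolded I_def] _ _ neg ends] r by auto
    \<comment> \<open>The factor 4 leaves a margin for $\varepsilon - z_l = 5 (\varepsilon - \varepsilon_0)$,
    which has to exceed the upper barrier, of height at most $4.08 (\varepsilon - \varepsilon_0)$.\<close>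
  define zl where "zl = e - 4 * (\<epsilon> - e)"
    have sub: "x \<in> I" "x \<in> {u1..u2}" if "x \<in> {ul..ur}" for x using that ul ur r_le u by (auto simp: I_def)
    have Dm_near: "0 < Dm x \<epsilon>" if "x \<in> {u1..u2}" for x using \<delta>2(2)[OF that, of \<epsilon>] \<epsilon> by simp
    have out: "0 \<le> Dp x \<epsilon>" if x: "x \<in> {u1..u2} - {ul<..<ur}" for x
    proof (cases "x \<in> K")
      case True
      thus ?thesis using \<delta>1(2)[of x \<epsilon>] \<epsilon> by simp
    next
      case False
      thus ?thesis using x by (intro outside) (auto simp: K_def)
    qed
    have small: "\<bar>Dp_x x \<epsilon>\<bar> \<le> k / 50 \<and> - (4 / k) * Dp x \<epsilon> \<le> \<epsilon> - zl" if x: "x \<in> {ul..ur}" for x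
    proof
      show "\<bar>Dp_x x \<epsilon>\<bar> \<le> k / 50" by (rule near(2)[OF I[OF sub(1)[OF x]] \<epsilon>_near])
      have "- Dp x \<epsilon> \<le> 51/50 * k * (\<epsilon> - e)" using drop(2)[OF sub(1)[OF x]] nonneg[OF sub(2)[OF x]] by linarith
      hence "(4 / k) * (- Dp x \<epsilon>) \<le> (4 / k) * (51/50 * k * (\<epsilon> - e))" using k by (intro mult_left_mono) auto
      also have "\<dots> = 204/50 * (\<epsilon> - e)" using k by simp
      also have "\<dots> \<le> \<epsilon> - zl" using \<epsilon> by (simp add: zl_def)
      finally show "- (4 / k) * Dp x \<epsilon> \<le> \<epsilon> - zl" by simp
    qed
    have box: "\<bar>Dp_z x z + k\<bar> \<le> k / 50 \<and> \<bar>Dm x z - k * e\<bar> \<le> k * e / 50"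
      if "x \<in> {ul..ur}" "z \<in> {zl..\<epsilon>}" for x z
    proof -
      have "\<bar>z - e\<bar> \<le> r" using that(2) \<epsilon> r by (auto simp: zl_def abs_le_iff)
      thus ?thesis using near(1,4)[OF I[OF sub(1)[OF that(1)]]] by blast
    qed
    show "\<exists>ul ur zl. u1 < ul \<and> ul < ur \<and> ur < u2 \<and> 49/50 * e \<le> zl \<and> zl \<le> \<epsilon> \<and> \<epsilon> \<le> 51/50 * e \<and>
      Dp ul \<epsilon> = 0 \<and> Dp ur \<epsilon> = 0 \<and> (\<forall>x\<in>{ul<..<ur}. Dp x \<epsilon> < 0) \<and>
      (\<forall>x\<in>{u1..u2} - {ul<..<ur}. 0 \<le> Dp x \<epsilon>) \<and> (\<forall>x\<in>{u1..u2}. 0 < Dm x \<epsilon>) \<and>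
      (\<forall>x\<in>{ul..ur}. \<bar>Dp_x x \<epsilon>\<bar> \<le> k / 50 \<and> - (4 / k) * Dp x \<epsilon> \<le> \<epsilon> - zl) \<and>
      (\<forall>x\<in>{ul..ur}. \<forall>z\<in>{zl..\<epsilon>}. \<bar>Dp_z x z + k\<bar> \<le> k / 50 \<and> \<bar>Dm x z - k * e\<bar> \<le> k * e / 50)"
    proof (rule exI[of _ ul], rule exI[of _ ur], rule exI[of _ zl], intro conjI ballI)
      show "u1 < ul" "ul < ur" "ur < u2" using ul ur r_le u by auto
      show "49/50 * e \<le> zl" "zl \<le> \<epsilon>" "\<epsilon> \<le> 51/50 * e" using \<epsilon> r_le(5) by (auto simp: zl_def)
    qed (use roots inside out Dm_near small box in blast)+
  qed (rule k(1))
qed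

end

theorem theorem8p1:
  fixes fp fm :: "real \<Rightarrow> real" and u1 u0 u2 \<epsilon>m \<epsilon>0 :: real
  assumes "C_k 4 fp" and "C_k 4 fm"
    and "u1 < u0" and "u0 < u2"
    and "0 \<le> \<epsilon>m" and "\<epsilon>m < \<epsilon>0"
    and "\<forall>u\<in>{u1..u2}. \<forall>\<epsilon>\<in>{\<epsilon>m<..<\<epsilon>0}. D_plus fp fm (u, \<epsilon>) > 0 \<and> D_minus fp fm (u, \<epsilon>) > 0"
    and "root_of_order 1 (\<lambda>\<epsilon>. D_plus fp fm (u0, \<epsilon>)) \<epsilon>0"
    and "\<forall>u\<in>{u1..u2} - {u0}. D_plus fp fm (u, \<epsilon>0) > 0"
    and "\<forall>u\<in>{u1..u2}. D_minus fp fm (u, \<epsilon>0) > 0"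
    and "root_of_order 2 (\<lambda>u. D_plus fp fm (u, \<epsilon>0)) u0"
  shows "\<exists>\<epsilon>p>\<epsilon>0. \<forall>\<epsilon>\<in>{\<epsilon>0<..<\<epsilon>p}.
    \<exists>ul ur. u1 < ul \<and> ul < ur \<and> ur < u2 \<and>
      D_plus fp fm (ul, \<epsilon>) = 0 \<and> D_plus fp fm (ur, \<epsilon>) = 0 \<and>
      (\<exists>B T.
        C1_smooth_on (Omega_R \<epsilon> u1 u2) B \<and>
        diag_concave_on (Omega_R \<epsilon> u1 u2) B \<and>
        boundary_values fp fm \<epsilon> (Omega_R \<epsilon> u1 u2) B \<and>
        right_simple_candidate fp fm \<epsilon> u1 ul B \<and>
        right_simple_candidate fp fm \<epsilon> ur u2 B \<and>
        left_herringbone_candidate fp fm \<epsilon> (ul + \<epsilon>) (ur + \<epsilon>) T B \<and>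
        herringbone_domain \<epsilon> (ul + \<epsilon>) (ur + \<epsilon>) T = Omega_R \<epsilon> ul ur \<and>
        T (ul + \<epsilon>) = \<epsilon> \<and> T (ur + \<epsilon>) = \<epsilon> \<and>
        (\<forall>u\<in>{ul + \<epsilon>..ur + \<epsilon>}. T u \<noteq> 0))"

proof -
  define p1 q1 p2 q2 p3 q3 p4 q4 where "p1 = deriv fp" and "q1 = deriv fm"
    and "p2 = (deriv ^^ 2) fp" and "q2 = (deriv ^^ 2) fm" and "p3 = (deriv ^^ 3) fp"
    and "q3 = (deriv ^^ 3) fm" and "p4 = (deriv ^^ 4) fp" and "q4 = (deriv ^^ 4) fm"
  note pq_defs = p1_def q1_def p2_def q2_def p3_def q3_def p4_def q4_def
  have fp: "(fp has_real_derivative p1 x) (at x)" and fm: "(fm has_real_derivative q1 x) (at x)" for x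
    using C_k_deriv[OF assms(1), of 0 x] C_k_deriv[OF assms(2), of 0 x] by (simp_all add: pq_defs)
  interpret boundary_data p1 q1 p2 q2 p3 q3 p4 q4
  proof
    fix x
    show "(p1 has_real_derivative p2 x) (at x)" "(p2 has_real_derivative p3 x) (at x)"
      "(p3 has_real_derivative p4 x) (at x)"
      using C_k_deriv[OF assms(1), of 1 x] C_k_deriv[OF assms(1), of 2 x] C_k_deriv[OF assms(1), of 3 x]
      unfolding pq_defs by (simp_all add: numeral_eq_Suc)
    show "(q1 has_real_derivative q2 x) (at x)" "(q2 has_real_derivative q3 x) (at x)"
      "(q3 has_real_derivative q4 x) (at x)"
      using C_k_deriv[OF assms(2), of 1 x] C_k_deriv[OF assms(2), of 2 x] C_k_deriv[OF assms(2), of 3 x]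
      unfolding pq_defs by (simp_all add: numeral_eq_Suc)
  qed (use assms(1,2) in \<open>auto simp: C_k_def pq_defs\<close>)
  have D_plus: "D_plus fp fm (x, z) = Dp x z" and D_minus: "D_minus fp fm (x, z) = Dm x z" if "z \<noteq> 0" for x z
    using that unfolding D_plus_def D_minus_def Dp_eq Dm_eq case_prod_conv pq_defs[symmetric]
    by (simp_all add: diff_divide_distrib)
  have e0: "0 < \<epsilon>0" using assms by simp
  have deriv1: "deriv (\<lambda>u. D_plus fp fm (u, \<epsilon>0)) = (\<lambda>u. Dp_x u \<epsilon>0)"
    using e0 by (intro ext DERIV_imp_deriv) (simp add: D_plus Dp_deriv_x)
  have deriv2: "deriv (\<lambda>u. Dp_x u \<epsilon>0) = (\<lambda>u. Dp_xx u \<epsilon>0)"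
    by (intro ext DERIV_imp_deriv Dp_x_deriv_x)
  have root: "(deriv ^^ i) (\<lambda>u. D_plus fp fm (u, \<epsilon>0)) u0 = 0" if "i < 2" for i
    using assms(11) that unfolding root_of_order_def by blast
  have Dp0: "Dp u0 \<epsilon>0 = 0" "Dp_x u0 \<epsilon>0 = 0"
  proof -
    show "Dp u0 \<epsilon>0 = 0" using root[of 0] e0 by (simp add: D_plus)
    show "Dp_x u0 \<epsilon>0 = 0" using root[of 1] by (simp add: deriv1)
  qed
  have "(deriv ^^ 2) (\<lambda>u. D_plus fp fm (u, \<epsilon>0)) u0 \<noteq> 0"
    using assms(11) unfolding root_of_order_def by blast
  hence Dpxx0: "Dp_xx u0 \<epsilon>0 \<noteq> 0" by (simp add: numeral_2_eq_2 deriv1 deriv2)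
  have pos: "0 < Dp u \<epsilon>0" if "u \<in> {u1..u2} - {u0}" for u using assms(9) that e0 by (simp add: D_plus)
  have pos': "0 < Dm u \<epsilon>0" if "u \<in> {u1..u2}" for u using assms(10) that e0 by (simp add: D_minus)
  obtain ep k where ep: "\<epsilon>0 < ep" "0 < k" and bif: "\<And>\<epsilon>. \<epsilon> \<in> {\<epsilon>0<..<ep} \<Longrightarrow>
    \<exists>ul ur zl. u1 < ul \<and> ul < ur \<and> ur < u2 \<and> 49/50 * \<epsilon>0 \<le> zl \<and> zl \<le> \<epsilon> \<and> \<epsilon> \<le> 51/50 * \<epsilon>0 \<and>
      Dp ul \<epsilon> = 0 \<and> Dp ur \<epsilon> = 0 \<and> (\<forall>x\<in>{ul<..<ur}. Dp x \<epsilon> < 0) \<and>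
      (\<forall>x\<in>{u1..u2} - {ul<..<ur}. 0 \<le> Dp x \<epsilon>) \<and> (\<forall>x\<in>{u1..u2}. 0 < Dm x \<epsilon>) \<and>
      (\<forall>x\<in>{ul..ur}. \<bar>Dp_x x \<epsilon>\<bar> \<le> k / 50 \<and> - (4 / k) * Dp x \<epsilon> \<le> \<epsilon> - zl) \<and>
      (\<forall>x\<in>{ul..ur}. \<forall>z\<in>{zl..\<epsilon>}. \<bar>Dp_z x z + k\<bar> \<le> k / 50 \<and> \<bar>Dm x z - k * \<epsilon>0\<bar> \<le> k * \<epsilon>0 / 50)"
    by (rule bifurcation[OF assms(3,4) e0 Dp0 Dpxx0 pos pos']) blast+
  show ?thesis
  proof (rule exI[of _ ep], intro conjI ballI ep(1))
    fix \<epsilon> assume \<epsilon>: "\<epsilon> \<in> {\<epsilon>0<..<ep}"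
    hence e: "0 < \<epsilon>" using e0 by simp
    obtain ul ur zl where u: "u1 < ul" "ul < ur" "ur < u2"
      and zl: "49/50 * \<epsilon>0 \<le> zl" "zl \<le> \<epsilon>" "\<epsilon> \<le> 51/50 * \<epsilon>0"
      and roots: "Dp ul \<epsilon> = 0" "Dp ur \<epsilon> = 0" and neg: "\<And>x. x \<in> {ul<..<ur} \<Longrightarrow> Dp x \<epsilon> < 0"
      and out: "\<And>x. x \<in> {u1..u2} - {ul<..<ur} \<Longrightarrow> 0 \<le> Dp x \<epsilon>"
      and Dm: "\<And>x. x \<in> {u1..u2} \<Longrightarrow> 0 < Dm x \<epsilon>"
      and small: "\<And>x. x \<in> {ul..ur} \<Longrightarrow> \<bar>Dp_x x \<epsilon>\<bar> \<le> k / 50"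
        "\<And>x. x \<in> {ul..ur} \<Longrightarrow> - (4 / k) * Dp x \<epsilon> \<le> \<epsilon> - zl"
      and box: "\<And>x z. x \<in> {ul..ur} \<Longrightarrow> z \<in> {zl..\<epsilon>} \<Longrightarrow> \<bar>Dp_z x z + k\<bar> \<le> k / 50"
        "\<And>x z. x \<in> {ul..ur} \<Longrightarrow> z \<in> {zl..\<epsilon>} \<Longrightarrow> \<bar>Dm x z - k * \<epsilon>0\<bar> \<le> k * \<epsilon>0 / 50"
      using bif[OF \<epsilon>] by (elim exE conjE) blast
    have spine: "\<exists>\<tau> \<tau>'. continuous_on UNIV \<tau> \<and> continuous_on {ul<..<ur} \<tau>' \<and>
      (\<forall>x. x \<notin> {ul<..<ur} \<longrightarrow> \<tau> x = \<epsilon>) \<and>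
      (\<forall>x\<in>{ul<..<ur}. 0 < \<tau> x \<and> \<tau> x < \<epsilon> \<and> (\<tau> has_real_derivative \<tau>' x) (at x) \<and> \<bar>\<tau>' x\<bar> < 1 \<and>
        0 < Dp x (\<tau> x) \<and> 0 < Dm x (\<tau> x) \<and>
        (1 + \<tau>' x) * (\<epsilon> + \<tau> x) * Dp x (\<tau> x) = (1 - \<tau>' x) * (\<epsilon> - \<tau> x) * Dm x (\<tau> x))"
    proof (rule spine_exists[of p1 q1 p2 q2 ul ur k \<epsilon>0 zl \<epsilon> "\<lambda>x. Dp x \<epsilon>" "\<lambda>x. Dp_x x \<epsilon>" Dp_z,
          folded Dp_def Dm_def])
      fix x z assume xz: "x \<in> {ul..ur}" "z \<in> {zl..\<epsilon>}"
      hence "z \<noteq> 0" using zl e0 by auto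
      from Dp_deriv_z[OF this, of x] box(1)[OF xz]
      show "(Dp x has_real_derivative Dp_z x z) (at z) \<and> \<bar>Dp_z x z + k\<bar> \<le> k / 50" by blast
    qed (use pq_cont u ep(2) e0 zl roots neg small box(2) Dp_deriv_x in \<open>simp_all\<close>)
    then obtain \<tau> \<tau>' where \<tau>: "continuous_on UNIV \<tau>" "continuous_on {ul<..<ur} \<tau>'"
      "\<And>x. x \<notin> {ul<..<ur} \<Longrightarrow> \<tau> x = \<epsilon>"
      and spine: "\<And>x. x \<in> {ul<..<ur} \<Longrightarrow> 0 < \<tau> x \<and> \<tau> x < \<epsilon> \<and> (\<tau> has_real_derivative \<tau>' x) (at x) \<and>
        \<bar>\<tau>' x\<bar> < 1 \<and> 0 < Dp x (\<tau> x) \<and> 0 < Dm x (\<tau> x) \<and>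
        (1 + \<tau>' x) * (\<epsilon> + \<tau> x) * Dp x (\<tau> x) = (1 - \<tau>' x) * (\<epsilon> - \<tau> x) * Dm x (\<tau> x)"
      by (elim exE conjE) blast
    interpret rib: herringbone_spine fp fm p1 q1 p2 q2 \<epsilon> u1 u2 ul ur \<tau> \<tau>'
    proof
      show "0 \<le> slope p1 q1 (x + \<tau> x) (x - \<tau> x) - p2 (x + \<tau> x) \<and>
        0 \<le> slope p1 q1 (x + \<tau> x) (x - \<tau> x) - q2 (x - \<tau> x)" if x: "x \<in> {u1..u2}" for x
        unfolding Dp_def[symmetric] Dm_def[symmetric]
      proof (cases "x \<in> {ul<..<ur}")
        case True
        thus "0 \<le> Dp x (\<tau> x) \<and> 0 \<le> Dm x (\<tau> x)" using spine[of x] by auto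
      next
        case False
        thus "0 \<le> Dp x (\<tau> x) \<and> 0 \<le> Dm x (\<tau> x)" using out[of x] Dm[of x] x \<tau>(3)[of x] by auto
      qed
    qed (use e u fp fm p(1) q(1) pq_cont \<tau> spine in \<open>simp_all add: Dp_def Dm_def\<close>)
    show "\<exists>ul ur. u1 < ul \<and> ul < ur \<and> ur < u2 \<and>
      D_plus fp fm (ul, \<epsilon>) = 0 \<and> D_plus fp fm (ur, \<epsilon>) = 0 \<and>
      (\<exists>B T.
        C1_smooth_on (Omega_R \<epsilon> u1 u2) B \<and>
        diag_concave_on (Omega_R \<epsilon> u1 u2) B \<and>
        boundary_values fp fm \<epsilon> (Omega_R \<epsilon> u1 u2) B \<and>
        right_simple_candidate fp fm \<epsilon> u1 ul B \<and>
        right_simple_candidate fp fm \<epsilon> ur u2 B \<and>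
        left_herringbone_candidate fp fm \<epsilon> (ul + \<epsilon>) (ur + \<epsilon>) T B \<and>
        herringbone_domain \<epsilon> (ul + \<epsilon>) (ur + \<epsilon>) T = Omega_R \<epsilon> ul ur \<and>
        T (ul + \<epsilon>) = \<epsilon> \<and> T (ur + \<epsilon>) = \<epsilon> \<and>
        (\<forall>u\<in>{ul + \<epsilon>..ur + \<epsilon>}. T u \<noteq> 0))"
    proof (rule exI[of _ ul], rule exI[of _ ur], intro conjI exI[of _ rib.B] exI[of _ rib.T] u ballI
        rib.B_C1 rib.B_diag rib.B_boundary rib.herringbone rib.domain_eq rib.T_ends rib.B_right_simple)
      show "D_plus fp fm (ul, \<epsilon>) = 0" "D_plus fp fm (ur, \<epsilon>) = 0" using roots e by (simp_all add: D_plus)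
    qed (use u in auto)
  qed
qed

end
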